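(* Let $G$ be a finite group and let $n$ be a positive integer. Then $G$ admits no $n$-partite digraphical representation if and only if one of the following occurs: (1) $n=1$ and $|G|\geq 3$; (2) $n=2$ and $G$ is isomorphic to one of $\mathbb{Z}_1$, $\mathbb{Z}_2$, $\mathbb{Z}_3$, $\mathbb{Z}_2\times\mathbb{Z}_2$ or $\mathbb{Z}_2\times\mathbb{Z}_2\times\mathbb{Z}_2$; (3) $3\leq n\leq 5$ and $G\cong\mathbb{Z}_1$.
   Context: A digraph $\Gamma$ is an ordered pair $(V\Gamma,A\Gamma)$ where $V\Gamma$ is a non-empty set (vertices) and $A\Gamma\subseteq V\Gamma\times V\Gamma$ (arcs). For an arc $(u,v)$, $v$ is an out-neighbour of $u$ and $u$ is an in-neighbour of $v$; the out-valency and in-valency of a vertex are its numbers of out-neighbours and in-neighbours. $\Gamma$ is regular if there is a non-negative integer $d$ such that every vertex has out-valency $d$ and in-valency $d$. For $X\subseteq V\Gamma$, the induced sub-digraph is $\Gamma[X]=(X,A\Gamma\cap(X\times X))$; it is the empty graph if it has no arcs. An automorphism of $\Gamma$ is a permutation $\sigma$ of $V\Gamma$ such that for all $u,v\in V\Gamma$, $(u^\sigma,v^\sigma)\in A\Gamma$ if and only if $(u,v)\in A\Gamma$; $\mathrm{Aut}(\Gamma)$ is the group of all automorphisms. A permutation group is semiregular if all its point stabilisers are trivial. $\mathbb{Z}_k$ denotes the cyclic group of order $k$. For a positive integer $n$, an $n$-partite digraphical representation ($n$-PDR) of a group $G$ is a digraph $\Gamma$ such that: $\Gamma$ is regular; $\mathrm{Aut}(\Gamma)$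 is isomorphic to $G$; $\mathrm{Aut}(\Gamma)$ acts semiregularly on $V\Gamma$; and $\mathrm{Aut}(\Gamma)$ has exactly $n$ orbits on $V\Gamma$ and, for every orbit $X$, $\Gamma[X]$ is the empty graph. $G$ admits an $n$-PDR if such a digraph exists. *)

theory Defs
  imports
    "HOL-Algebra.Elementary_Groups"
    "HOL-Algebra.Group_Action"
    "Graph_Theory.Pair_Digraph"
    "Graph_Theory.Digraph_Component"
begin

text \<open>
  A digraph with arc set contained in the square of its vertex set is a
  \<^typ>\<open>'v pair_pre_digraph\<close> satisfying \<^locale>\<open>pair_wf_digraph\<close>; loops are allowed.
  The finiteness conditions below are needed because \<^const>\<open>card\<close> is \<open>0\<close> on infinite sets.
\<close>

definition regular_digraph :: "'v pair_pre_digraph \<Rightarrow> bool" where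
  "regular_digraph \<Gamma> \<longleftrightarrow>
     (\<exists>d. \<forall>v\<in>pverts \<Gamma>.
        finite (out_arcs (with_proj \<Gamma>) v) \<and> out_degree (with_proj \<Gamma>) v = d \<and>
        finite (in_arcs (with_proj \<Gamma>) v) \<and> in_degree (with_proj \<Gamma>) v = d)"

definition digraph_automorphisms :: "'v pair_pre_digraph \<Rightarrow> ('v \<Rightarrow> 'v) set" where
  "digraph_automorphisms \<Gamma> =
     {\<sigma> \<in> Bij (pverts \<Gamma>).
        \<forall>u\<in>pverts \<Gamma>. \<forall>v\<in>pverts \<Gamma>. (\<sigma> u, \<sigma> v) \<in> parcs \<Gamma> \<longleftrightarrow> (u, v) \<in> parcs \<Gamma>}"

definition Aut_digraph :: "'v pair_pre_digraph \<Rightarrow> ('v \<Rightarrow> 'v) monoid" where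
  "Aut_digraph \<Gamma> = BijGroup (pverts \<Gamma>) \<lparr>carrier := digraph_automorphisms \<Gamma>\<rparr>"

text \<open>\<open>P\<close> is a permutation group on \<open>\<Omega>\<close>, acting by evaluation.\<close>

definition semiregular :: "('v \<Rightarrow> 'v) monoid \<Rightarrow> 'v set \<Rightarrow> bool" where
  "semiregular P \<Omega> \<longleftrightarrow> (\<forall>v\<in>\<Omega>. stabilizer P (\<lambda>\<sigma>. \<sigma>) v = {\<one>\<^bsub>P\<^esub>})"

definition is_PDR ::
  "nat \<Rightarrow> ('g, 'm) monoid_scheme \<Rightarrow> 'v pair_pre_digraph \<Rightarrow> bool" where
  "is_PDR n G \<Gamma> \<longleftrightarrow>
     pair_wf_digraph \<Gamma> \<and> pverts \<Gamma> \<noteq> {} \<and>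
     regular_digraph \<Gamma> \<and>
     Aut_digraph \<Gamma> \<cong> G \<and>
     semiregular (Aut_digraph \<Gamma>) (pverts \<Gamma>) \<and>
     finite (orbits (Aut_digraph \<Gamma>) (pverts \<Gamma>) (\<lambda>\<sigma>. \<sigma>)) \<and>
     card (orbits (Aut_digraph \<Gamma>) (pverts \<Gamma>) (\<lambda>\<sigma>. \<sigma>)) = n \<and>
     (\<forall>X \<in> orbits (Aut_digraph \<Gamma>) (pverts \<Gamma>) (\<lambda>\<sigma>. \<sigma>).
        arcs (with_proj \<Gamma> \<restriction> X) = {})"

text \<open>
  For finite \<open>G\<close> every such digraph is finite, so taking the vertices to be natural numbers is
  no restriction: see \<open>is_PDR_imp_admits_PDR\<close> below.
\<close>

definition admits_PDR :: "nat \<Rightarrow> ('g, 'm) monoid_scheme \<Rightarrow> bool" where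
  "admits_PDR n G \<longleftrightarrow> (\<exists>\<Gamma> :: nat pair_pre_digraph. is_PDR n G \<Gamma>)"

lemma carrier_Aut_digraph [simp]: "carrier (Aut_digraph \<Gamma>) = digraph_automorphisms \<Gamma>"
  by (simp add: Aut_digraph_def)

lemma one_Aut_digraph [simp]: "\<one>\<^bsub>Aut_digraph \<Gamma>\<^esub> = (\<lambda>x\<in>pverts \<Gamma>. x)"
  by (simp add: Aut_digraph_def BijGroup_def)

lemma mult_Aut_digraph:
  "\<sigma> \<in> digraph_automorphisms \<Gamma> \<Longrightarrow> \<tau> \<in> digraph_automorphisms \<Gamma> \<Longrightarrow>
     \<sigma> \<otimes>\<^bsub>Aut_digraph \<Gamma>\<^esub> \<tau> = compose (pverts \<Gamma>) \<sigma> \<tau>"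
  by (simp add: Aut_digraph_def BijGroup_def digraph_automorphisms_def)

lemma subgroup_digraph_automorphisms:
  "subgroup (digraph_automorphisms \<Gamma>) (BijGroup (pverts \<Gamma>))"
proof -
  let ?V = "pverts \<Gamma>"
  interpret B: group "BijGroup ?V" by (rule group_BijGroup)
  show ?thesis
  proof (rule B.subgroupI)
    show "digraph_automorphisms \<Gamma> \<subseteq> carrier (BijGroup ?V)"
      by (auto simp: digraph_automorphisms_def BijGroup_def)
    have "(\<lambda>x\<in>?V. x) \<in> digraph_automorphisms \<Gamma>"
      by (auto simp: digraph_automorphisms_def id_Bij)
    then show "digraph_automorphisms \<Gamma> \<noteq> {}" by blast
  next
    fix a assume a: "a \<in> digraph_automorphisms \<Gamma>"
    then have aB: "a \<in> Bij ?V" by (simp add: digraph_automorphisms_def)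
    then have bij: "bij_betw a ?V ?V" by (simp add: Bij_def)
    have "(\<lambda>x\<in>?V. inv_into ?V a x) \<in> digraph_automorphisms \<Gamma>"
      unfolding digraph_automorphisms_def
    proof (intro CollectI conjI ballI)
      show "(\<lambda>x\<in>?V. inv_into ?V a x) \<in> Bij ?V" by (rule restrict_inv_into_Bij[OF aB])
      fix u v assume uv: "u \<in> ?V" "v \<in> ?V"
      have "inv_into ?V a u \<in> ?V" "inv_into ?V a v \<in> ?V"
        using Bij_inv_into_mem[OF aB] uv by auto
      moreover have "a (inv_into ?V a u) = u" "a (inv_into ?V a v) = v"
        using bij uv by (auto simp: bij_betw_def f_inv_into_f)
      ultimately have "(inv_into ?V a u, inv_into ?V a v) \<in> parcs \<Gamma> \<longleftrightarrow> (u, v) \<in> parcs \<Gamma>"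
        using a by (force simp: digraph_automorphisms_def)
      then show "((\<lambda>x\<in>?V. inv_into ?V a x) u, (\<lambda>x\<in>?V. inv_into ?V a x) v) \<in> parcs \<Gamma>
          \<longleftrightarrow> (u, v) \<in> parcs \<Gamma>"
        using uv by simp
    qed
    then show "inv\<^bsub>BijGroup ?V\<^esub> a \<in> digraph_automorphisms \<Gamma>"
      by (simp add: inv_BijGroup[OF aB])
  next
    fix a b assume a: "a \<in> digraph_automorphisms \<Gamma>" and b: "b \<in> digraph_automorphisms \<Gamma>"
    then have aB: "a \<in> Bij ?V" and bB: "b \<in> Bij ?V"
      by (simp_all add: digraph_automorphisms_def)
    have "compose ?V a b \<in> digraph_automorphisms \<Gamma>"
      using a b compose_Bij[OF aB bB] Bij_imp_funcset[OF bB]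
      unfolding digraph_automorphisms_def by (auto simp: compose_def Pi_iff)
    then show "a \<otimes>\<^bsub>BijGroup ?V\<^esub> b \<in> digraph_automorphisms \<Gamma>"
      using aB bB by (simp add: BijGroup_def)
  qed
qed

lemma Aut_maps: "\<sigma> \<in> digraph_automorphisms \<Gamma> \<Longrightarrow> x \<in> pverts \<Gamma> \<Longrightarrow> \<sigma> x \<in> pverts \<Gamma>"
  by (auto simp: digraph_automorphisms_def dest!: Bij_imp_funcset)

lemma group_Aut_digraph: "group (Aut_digraph \<Gamma>)"
  unfolding Aut_digraph_def
  by (rule subgroup.subgroup_is_group[OF subgroup_digraph_automorphisms group_BijGroup])

text \<open>Transport of a digraph along an injection.\<close>

definition rename_digraph :: "('v \<Rightarrow> 'w) \<Rightarrow> 'v pair_pre_digraph \<Rightarrow> 'w pair_pre_digraph" where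
  "rename_digraph h \<Gamma> = \<lparr>pverts = h ` pverts \<Gamma>, parcs = map_prod h h ` parcs \<Gamma>\<rparr>"

lemma rename_inverse:
  assumes "pair_wf_digraph \<Gamma>" and "\<And>x. x \<in> pverts \<Gamma> \<Longrightarrow> g (h x) = x"
  shows "rename_digraph g (rename_digraph h \<Gamma>) = \<Gamma>"
proof -
  have "pverts (rename_digraph g (rename_digraph h \<Gamma>)) = pverts \<Gamma>"
    using assms(2) by (simp add: rename_digraph_def image_image)
  moreover have "map_prod g g (map_prod h h e) = e" if "e \<in> parcs \<Gamma>" for e
    using assms that by (cases e) (force simp: pair_wf_digraph_def)
  then have "parcs (rename_digraph g (rename_digraph h \<Gamma>)) = parcs \<Gamma>"
    by (simp add: rename_digraph_def image_image del: map_prod_simp)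
  ultimately show ?thesis by simp
qed

definition conj_perm ::
  "'v pair_pre_digraph \<Rightarrow> ('v \<Rightarrow> 'w) \<Rightarrow> ('w \<Rightarrow> 'v) \<Rightarrow> ('v \<Rightarrow> 'v) \<Rightarrow> 'w \<Rightarrow> 'w" where
  "conj_perm \<Gamma> h g \<sigma> = (\<lambda>y\<in>h ` pverts \<Gamma>. h (\<sigma> (g y)))"

context
  fixes \<Gamma> :: "'v pair_pre_digraph" and h :: "'v \<Rightarrow> 'w" and g :: "'w \<Rightarrow> 'v"
  assumes wf: "pair_wf_digraph \<Gamma>" and gh: "\<And>x. x \<in> pverts \<Gamma> \<Longrightarrow> g (h x) = x"
begin

lemma wf_rename: "pair_wf_digraph (rename_digraph h \<Gamma>)"
  using wf by (force simp: pair_wf_digraph_def rename_digraph_def)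

lemma arc_rename:
  assumes "u \<in> pverts \<Gamma>" "v \<in> pverts \<Gamma>"
  shows "(h u, h v) \<in> parcs (rename_digraph h \<Gamma>) \<longleftrightarrow> (u, v) \<in> parcs \<Gamma>"
proof
  assume "(h u, h v) \<in> parcs (rename_digraph h \<Gamma>)"
  then obtain a b where ab: "(a, b) \<in> parcs \<Gamma>" "h u = h a" "h v = h b"
    by (auto simp: rename_digraph_def)
  moreover have "a \<in> pverts \<Gamma>" "b \<in> pverts \<Gamma>"
    using wf ab by (force simp: pair_wf_digraph_def)+
  ultimately show "(u, v) \<in> parcs \<Gamma>" using gh assms by metis
qed (force simp: rename_digraph_def)

lemma inj_h: "inj_on h (pverts \<Gamma>)"
  using gh by (metis inj_onI)

lemma regular_rename:
  assumes "regular_digraph \<Gamma>"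
  shows "regular_digraph (rename_digraph h \<Gamma>)"
proof -
  have V: "fst e \<in> pverts \<Gamma>" "snd e \<in> pverts \<Gamma>" if "e \<in> parcs \<Gamma>" for e
    using wf that by (simp_all add: pair_wf_digraph.arc_fst_in_verts pair_wf_digraph.arc_snd_in_verts)
  have inj: "inj_on (map_prod h h) (parcs \<Gamma>)"
    by (rule inj_on_subset[OF map_prod_inj_on[OF inj_h inj_h]]) (use V in force)
  have eq: "h x = h y \<longleftrightarrow> x = y" if "x \<in> pverts \<Gamma>" "y \<in> pverts \<Gamma>" for x y
    using inj_h that by (auto dest: inj_onD)
  have out: "out_arcs (with_proj (rename_digraph h \<Gamma>)) (h v)
      = map_prod h h ` out_arcs (with_proj \<Gamma>) v" if "v \<in> pverts \<Gamma>" for v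
  proof -
    have "out_arcs (with_proj (rename_digraph h \<Gamma>)) (h v)
        = map_prod h h ` {e \<in> parcs \<Gamma>. h (fst e) = h v}"
      by (auto simp: out_arcs_def rename_digraph_def)
    also have "{e \<in> parcs \<Gamma>. h (fst e) = h v} = out_arcs (with_proj \<Gamma>) v"
      unfolding out_arcs_def with_proj_simps by (intro Collect_cong conj_cong refl eq V that)
    finally show ?thesis .
  qed
  have inn: "in_arcs (with_proj (rename_digraph h \<Gamma>)) (h v)
      = map_prod h h ` in_arcs (with_proj \<Gamma>) v" if "v \<in> pverts \<Gamma>" for v
  proof -
    have "in_arcs (with_proj (rename_digraph h \<Gamma>)) (h v)
        = map_prod h h ` {e \<in> parcs \<Gamma>. h (snd e) = h v}"
      by (auto simp: in_arcs_def rename_digraph_def)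
    also have "{e \<in> parcs \<Gamma>. h (snd e) = h v} = in_arcs (with_proj \<Gamma>) v"
      unfolding in_arcs_def with_proj_simps by (intro Collect_cong conj_cong refl eq V that)
    finally show ?thesis .
  qed
  have sub: "out_arcs (with_proj \<Gamma>) v \<subseteq> parcs \<Gamma>" "in_arcs (with_proj \<Gamma>) v \<subseteq> parcs \<Gamma>" for v
    by (auto simp: out_arcs_def in_arcs_def)
  note cards = card_image[OF inj_on_subset[OF inj sub(1)]] card_image[OF inj_on_subset[OF inj sub(2)]]
  obtain d where d: "\<forall>v\<in>pverts \<Gamma>.
      finite (out_arcs (with_proj \<Gamma>) v) \<and> out_degree (with_proj \<Gamma>) v = d \<and>
      finite (in_arcs (with_proj \<Gamma>) v) \<and> in_degree (with_proj \<Gamma>) v = d"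
    using assms unfolding regular_digraph_def by blast
  have verts: "pverts (rename_digraph h \<Gamma>) = h ` pverts \<Gamma>" by (simp add: rename_digraph_def)
  show ?thesis
    unfolding regular_digraph_def verts ball_simps
    using d by (intro exI[of _ d]) (simp add: out_degree_def in_degree_def out inn cards)
qed

lemma conj_perm_h: "x \<in> pverts \<Gamma> \<Longrightarrow> conj_perm \<Gamma> h g \<sigma> (h x) = h (\<sigma> x)"
  by (simp add: conj_perm_def gh)

lemma conj_perm_Aut:
  assumes "\<sigma> \<in> digraph_automorphisms \<Gamma>"
  shows "conj_perm \<Gamma> h g \<sigma> \<in> digraph_automorphisms (rename_digraph h \<Gamma>)"
proof -
  have bij: "bij_betw \<sigma> (pverts \<Gamma>) (pverts \<Gamma>)"
    using assms by (simp add: digraph_automorphisms_def Bij_def)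
  have bh: "bij_betw h (pverts \<Gamma>) (h ` pverts \<Gamma>)" using inj_h by (simp add: bij_betw_def)
  have bg: "bij_betw g (h ` pverts \<Gamma>) (pverts \<Gamma>)"
    by (rule bij_betwI'[where f = g]) (auto simp: gh)
  have "bij_betw (h \<circ> (\<sigma> \<circ> g)) (h ` pverts \<Gamma>) (h ` pverts \<Gamma>)"
    by (rule bij_betw_trans[OF bij_betw_trans[OF bg bij] bh])
  then have "bij_betw (conj_perm \<Gamma> h g \<sigma>) (h ` pverts \<Gamma>) (h ` pverts \<Gamma>)"
    by (rule bij_betw_cong[THEN iffD1, rotated]) (simp add: conj_perm_def)
  moreover have "(conj_perm \<Gamma> h g \<sigma> (h u), conj_perm \<Gamma> h g \<sigma> (h v)) \<in> parcs (rename_digraph h \<Gamma>)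
      \<longleftrightarrow> (h u, h v) \<in> parcs (rename_digraph h \<Gamma>)"
    if "u \<in> pverts \<Gamma>" "v \<in> pverts \<Gamma>" for u v
  proof -
    have "(\<sigma> u, \<sigma> v) \<in> parcs \<Gamma> \<longleftrightarrow> (u, v) \<in> parcs \<Gamma>"
      using assms that by (simp add: digraph_automorphisms_def)
    then show ?thesis
      using that by (simp add: conj_perm_h arc_rename Aut_maps[OF assms])
  qed
  ultimately show ?thesis
    unfolding digraph_automorphisms_def Bij_def
    by (auto simp: rename_digraph_def) (auto simp: conj_perm_def)
qed

end

lemma conj_perm_inverse:
  assumes gh: "\<And>x. x \<in> pverts \<Gamma> \<Longrightarrow> g (h x) = x"
    and \<sigma>: "\<sigma> \<in> digraph_automorphisms \<Gamma>"
  shows "conj_perm (rename_digraph h \<Gamma>) g h (conj_perm \<Gamma> h g \<sigma>) = \<sigma>"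
proof
  fix x
  have img: "g ` h ` pverts \<Gamma> = pverts \<Gamma>" by (simp add: image_image gh)
  have "\<sigma> \<in> extensional (pverts \<Gamma>)" using \<sigma> by (simp add: digraph_automorphisms_def Bij_def)
  then show "conj_perm (rename_digraph h \<Gamma>) g h (conj_perm \<Gamma> h g \<sigma>) x = \<sigma> x"
    using Aut_maps[OF \<sigma>, of x]
    by (cases "x \<in> pverts \<Gamma>")
       (auto simp: conj_perm_def rename_digraph_def img gh extensional_def)
qed

lemma is_PDR_rename:
  assumes pdr: "is_PDR n G \<Gamma>" and gh: "\<And>x. x \<in> pverts \<Gamma> \<Longrightarrow> g (h x) = x"
  shows "is_PDR n G (rename_digraph h \<Gamma>)"
proof -
  let ?V = "pverts \<Gamma>" and ?R = "rename_digraph h \<Gamma>"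
  let ?A = "Aut_digraph \<Gamma>" and ?B = "Aut_digraph ?R" and ?c = "conj_perm \<Gamma> h g"
  have wf: "pair_wf_digraph \<Gamma>" using pdr by (simp add: is_PDR_def)
  have VR: "pverts ?R = h ` ?V" by (simp add: rename_digraph_def)
  have wfR: "pair_wf_digraph ?R" using wf_rename[of \<Gamma> g h] wf gh by blast
  have hg: "h (g y) = y" if "y \<in> pverts ?R" for y using that gh by (auto simp: VR)
  have ren: "rename_digraph g ?R = \<Gamma>" using rename_inverse[of \<Gamma> g h] wf gh by blast
  have bij: "bij_betw ?c (digraph_automorphisms \<Gamma>) (digraph_automorphisms ?R)"
  proof (rule bij_betw_byWitness[where f' = "conj_perm ?R g h"])
    show "\<forall>a\<in>digraph_automorphisms \<Gamma>. conj_perm ?R g h (?c a) = a"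
      using conj_perm_inverse[of \<Gamma> g h] gh by blast
    show "\<forall>a\<in>digraph_automorphisms ?R. ?c (conj_perm ?R g h a) = a"
      using conj_perm_inverse[of ?R h g] hg unfolding ren by blast
    show "?c ` digraph_automorphisms \<Gamma> \<subseteq> digraph_automorphisms ?R"
      using conj_perm_Aut[of \<Gamma> g h] wf gh by blast
    show "conj_perm ?R g h ` digraph_automorphisms ?R \<subseteq> digraph_automorphisms \<Gamma>"
      using conj_perm_Aut[of ?R h g] wfR hg unfolding ren by blast
  qed
  then have AutR: "digraph_automorphisms ?R = ?c ` digraph_automorphisms \<Gamma>"
    by (simp add: bij_betw_def)
  have ch: "?c \<sigma> (h x) = h (\<sigma> x)" if "x \<in> ?V" for \<sigma> x
    using that gh by (simp add: conj_perm_def)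
  have "?c \<in> hom ?A ?B"
  proof (rule homI)
    fix \<sigma> \<tau> assume "\<sigma> \<in> carrier ?A" "\<tau> \<in> carrier ?A"
    then have st: "\<sigma> \<in> digraph_automorphisms \<Gamma>" "\<tau> \<in> digraph_automorphisms \<Gamma>" by simp_all
    then have "?c \<sigma> \<in> digraph_automorphisms ?R" "?c \<tau> \<in> digraph_automorphisms ?R"
      by (simp_all add: AutR)
    then show "?c (\<sigma> \<otimes>\<^bsub>?A\<^esub> \<tau>) = ?c \<sigma> \<otimes>\<^bsub>?B\<^esub> ?c \<tau>"
      using st Aut_maps[OF st(2)]
      by (auto simp: mult_Aut_digraph fun_eq_iff compose_def conj_perm_def VR gh)
  qed (simp add: AutR)
  then have "?A \<cong> ?B" using bij by (auto intro: is_isoI simp: iso_def)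
  then have "?B \<cong> ?A" by (rule group.iso_sym[OF group_Aut_digraph])
  moreover have "?A \<cong> G" using pdr by (simp add: is_PDR_def)
  ultimately have iso: "?B \<cong> G" by (rule iso_trans)
  have semi: "semiregular ?B (pverts ?R)"
    unfolding semiregular_def VR ball_simps
  proof
    fix v assume v: "v \<in> ?V"
    have s: "stabilizer ?A (\<lambda>\<sigma>. \<sigma>) v = {\<lambda>x\<in>?V. x}"
      using pdr v by (simp add: is_PDR_def semiregular_def)
    have hv: "h (\<sigma> v) = h v \<longleftrightarrow> \<sigma> v = v" if "\<sigma> \<in> digraph_automorphisms \<Gamma>" for \<sigma>
      using gh v Aut_maps[OF that v] by metis
    have "stabilizer ?B (\<lambda>\<sigma>. \<sigma>) (h v) = ?c ` stabilizer ?A (\<lambda>\<sigma>. \<sigma>) v"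
      using hv by (auto simp: stabilizer_def AutR ch[OF v])
    also have "\<dots> = {\<one>\<^bsub>?B\<^esub>}"
      by (auto simp: s conj_perm_def VR gh fun_eq_iff)
    finally show "stabilizer ?B (\<lambda>\<sigma>. \<sigma>) (h v) = {\<one>\<^bsub>?B\<^esub>}" .
  qed
  let ?O = "orbits ?A ?V (\<lambda>\<sigma>. \<sigma>)"
  have orb: "orbit ?B (\<lambda>\<sigma>. \<sigma>) (h v) = h ` orbit ?A (\<lambda>\<sigma>. \<sigma>) v" if "v \<in> ?V" for v
  proof -
    have "orbit ?B (\<lambda>\<sigma>. \<sigma>) (h v) = (\<lambda>\<sigma>. ?c \<sigma> (h v)) ` digraph_automorphisms \<Gamma>"
      by (auto simp: orbit_def AutR)
    also have "\<dots> = h ` orbit ?A (\<lambda>\<sigma>. \<sigma>) v"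
      by (auto simp: orbit_def ch[OF that])
    finally show ?thesis .
  qed
  have orbs: "orbits ?B (pverts ?R) (\<lambda>\<sigma>. \<sigma>) = (`) h ` ?O"
    unfolding orbits_def VR using orb by blast
  have sub: "X \<subseteq> ?V" if "X \<in> ?O" for X
    using that Aut_maps by (auto simp: orbits_def orbit_def)
  have "inj_on h ?V" by (rule inj_onI) (metis gh)
  then have "inj_on ((`) h) ?O"
    using sub by (auto intro: inj_on_subset[OF inj_on_image_Pow])
  then have card: "card (orbits ?B (pverts ?R) (\<lambda>\<sigma>. \<sigma>)) = n"
      "finite (orbits ?B (pverts ?R) (\<lambda>\<sigma>. \<sigma>))"
    using pdr by (simp_all add: orbs card_image is_PDR_def)
  have "arcs (with_proj ?R \<restriction> h ` X) = {}" if X: "X \<in> ?O" for X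
  proof -
    have e: "arcs (with_proj \<Gamma> \<restriction> X) = {}" using pdr X by (simp add: is_PDR_def)
    have "(h u, h v) \<notin> parcs ?R" if "u \<in> X" "v \<in> X" for u v
    proof -
      have "(h u, h v) \<in> parcs ?R \<longleftrightarrow> (u, v) \<in> parcs \<Gamma>"
        using arc_rename[of \<Gamma> g h u v] wf gh sub[OF X] that by blast
      then show ?thesis using e that by auto
    qed
    then show ?thesis by auto
  qed
  then have "\<forall>X \<in> orbits ?B (pverts ?R) (\<lambda>\<sigma>. \<sigma>). arcs (with_proj ?R \<restriction> X) = {}"
    by (simp add: orbs)
  moreover have "regular_digraph ?R"
    using regular_rename[of \<Gamma> g h] wf gh pdr by (auto simp: is_PDR_def)
  moreover have "pverts ?R \<noteq> {}" using pdr by (simp add: is_PDR_def VR)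
  ultimately show ?thesis
    using wfR iso semi card by (simp add: is_PDR_def)
qed

lemma is_PDR_finite:
  assumes pdr: "is_PDR n G \<Gamma>" and fin: "finite (carrier G)"
  shows "finite (pverts \<Gamma>)"
proof -
  let ?A = "Aut_digraph \<Gamma>" and ?V = "pverts \<Gamma>"
  have "?A \<cong> G" and O: "finite (orbits ?A ?V (\<lambda>\<sigma>. \<sigma>))"
    using pdr by (simp_all add: is_PDR_def)
  then have "finite (carrier ?A)"
    using fin by (auto simp: is_iso_def iso_def bij_betw_finite)
  then have "finite X" if "X \<in> orbits ?A ?V (\<lambda>\<sigma>. \<sigma>)" for X
    using that by (auto simp: orbits_def orbit_def)
  then have fU: "finite (\<Union> (orbits ?A ?V (\<lambda>\<sigma>. \<sigma>)))" using O by blast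
  have one: "\<one>\<^bsub>?A\<^esub> \<in> carrier ?A"
    by (rule monoid.one_closed[OF group.is_monoid[OF group_Aut_digraph]])
  have "v \<in> orbit ?A (\<lambda>\<sigma>. \<sigma>) v" if "v \<in> ?V" for v
    unfolding orbit_def using one that
    by (auto intro!: exI[of _ "\<one>\<^bsub>?A\<^esub>"])
  then have "?V \<subseteq> \<Union> (orbits ?A ?V (\<lambda>\<sigma>. \<sigma>))"
    by (auto simp: orbits_def)
  then show ?thesis using fU finite_subset by blast
qed

theorem is_PDR_imp_admits_PDR:
  fixes \<Gamma> :: "'v pair_pre_digraph"
  assumes "is_PDR n G \<Gamma>" and "finite (carrier G)"
  shows "admits_PDR n G"
proof -
  obtain h :: "'v \<Rightarrow> nat" where "inj_on h (pverts \<Gamma>)"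
    using finite_imp_inj_to_nat_seg[OF is_PDR_finite[OF assms]] by blast
  then have "is_PDR n G (rename_digraph h \<Gamma>)"
    by (intro is_PDR_rename[OF assms(1), of "inv_into (pverts \<Gamma>) h"]) simp
  then show ?thesis unfolding admits_PDR_def by blast
qed

end

theory Submission
  imports Defs
    "HOL-Algebra.Multiplicative_Group"
    "HOL-Combinatorics.Transposition"
begin

text \<open>
  Vertices are taken in \<open>G \<times> {..<n}\<close>, with arcs \<open>(g, i) \<rightarrow> (h, j)\<close> for \<open>h g\<^sup>-\<^sup>1 \<in> R i j\<close>. For existence,
  digons along identity matchings tie each fibre \<open>{g} \<times> {..<n}\<close> together, so an automorphism is
  essentially a permutation of \<open>G\<close> preserving several Cayley digraphs. A generating set
  \<open>x\<^sub>0, \<dots>, x\<^sub>k\<^sub>-\<^sub>1\<close> of minimum size is made one colour and the quotients \<open>x\<^sub>i\<^sub>+\<^sub>1 x\<^sub>i\<^sup>-\<^sup>1\<close> another; by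
  irredundance they form a path, and marking its end \<open>x\<^sub>0\<close> makes the stabiliser of \<open>1\<close> trivial. For
  \<open>n \<ge> 3\<close> there are enough pairs of layers to place the mark in any group. For \<open>n = 2\<close> the mark is a
  generator that is not an involution; cyclic groups and elementary abelian 2-groups of rank at
  least 4 are treated separately.

  Conversely, a partite representation whose digraph, or multipartite complement, has valency 0 or 1
  has an extra automorphism (a transposition or the successor function), which leaves only the
  trivial group with \<open>n = 5\<close> and the groups \<open>\<int>\<^sub>2\<^sup>2\<close> and \<open>\<int>\<^sub>2\<^sup>3\<close> with \<open>n = 2\<close>. The first case is a finite search; in the others the digraph is a
  colouring of an affine space over the field of order 2 by four colours, and a finite search finds
  an affine map that preserves the colouring or interchanges the colours of the two directions.
\<close>

section \<open>Layered digraphs\<close>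

text \<open>Minimum size of the generating set, rather than irredundance alone, is demanded because
  generators get replaced: any other generating sequence of the same length is again of minimum
  size. With two layers there is little room. Regularity forces the connection sets \<open>F\<close>
  and \<open>B\<close> of the two directions to have equal size, and \<open>k\<close> generators
  against \<open>k - 1\<close> steps leave exactly one place in \<open>B\<close> for the mark. A
  mark in both \<open>F\<close> and \<open>B\<close> must not be an involution, since it would
  create digons off the identity matching. In an elementary abelian 2-group every generator is an
  involution, so the mark becomes a product of three generators, and a fourth generator is needed to
  tell the two ends of this triple apart. Automorphisms exchanging the layers are a second obstacle:
  recentred at the identity they turn out to be group automorphisms exchanging \<open>F\<close> and
  \<open>B\<close>, and these are refuted inside the group.\<close>

definition layered ::
  "('g, 'm) monoid_scheme \<Rightarrow> nat \<Rightarrow> (nat \<Rightarrow> nat \<Rightarrow> 'g set) \<Rightarrow> ('g \<times> nat) pair_pre_digraph" where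
  "layered G n R =
     \<lparr>pverts = carrier G \<times> {..<n},
      parcs = {((g, i), (h, j)) | g i h j.
        g \<in> carrier G \<and> h \<in> carrier G \<and> i < n \<and> j < n \<and> h \<otimes>\<^bsub>G\<^esub> inv\<^bsub>G\<^esub> g \<in> R i j}\<rparr>"

text \<open>Right translation preserves every quotient \<open>h \<otimes> inv g\<close>, hence every
  connection set. The inverse of \<open>a\<close> makes the action a homomorphism, since composition
  applies its right factor first.\<close>

definition right_shift :: "('g, 'm) monoid_scheme \<Rightarrow> nat \<Rightarrow> 'g \<Rightarrow> 'g \<times> nat \<Rightarrow> 'g \<times> nat" where
  "right_shift G n a = (\<lambda>v\<in>carrier G \<times> {..<n}. (fst v \<otimes>\<^bsub>G\<^esub> inv\<^bsub>G\<^esub> a, snd v))"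

lemma pverts_layered [simp]: "pverts (layered G n R) = carrier G \<times> {..<n}"
  by (simp add: layered_def)

lemma parcs_layered [simp]:
  "((g, i), (h, j)) \<in> parcs (layered G n R) \<longleftrightarrow>
     g \<in> carrier G \<and> h \<in> carrier G \<and> i < n \<and> j < n \<and> h \<otimes>\<^bsub>G\<^esub> inv\<^bsub>G\<^esub> g \<in> R i j"
  by (simp add: layered_def)

lemma wf_layered: "pair_wf_digraph (layered G n R)"
  by unfold_locales (auto simp: layered_def)

lemma (in group) quot_right_shift:
  assumes "g \<in> carrier G" "h \<in> carrier G" "a \<in> carrier G"
  shows "(h \<otimes> a) \<otimes> inv (g \<otimes> a) = h \<otimes> inv g"
  using assms by (simp add: inv_mult_group m_assoc inv_solve_right[symmetric] flip: m_assoc[of a])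

lemma (in group) right_shift_Aut:
  assumes "a \<in> carrier G"
  shows "right_shift G n a \<in> digraph_automorphisms (layered G n R)"
proof -
  have "bij_betw (right_shift G n a) (carrier G \<times> {..<n}) (carrier G \<times> {..<n})"
    by (rule bij_betw_byWitness[where f' = "right_shift G n (inv a)"])
      (use assms in \<open>auto simp: right_shift_def m_assoc\<close>)
  then show ?thesis
    unfolding digraph_automorphisms_def Bij_def
    by (auto simp: right_shift_def assms quot_right_shift)
qed

lemma (in group) out_degree_layered:
  assumes "finite (carrier G)" and R: "\<And>i j. R i j \<subseteq> carrier G" and "g \<in> carrier G" "i < n"
  shows "finite (out_arcs (with_proj (layered G n R)) (g, i))"
    and "out_degree (with_proj (layered G n R)) (g, i) = (\<Sum>j<n. card (R i j))"
proof -
  let ?f = "\<lambda>(j, r). ((g, i), (r \<otimes> g, j))"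
  have "e \<in> out_arcs (with_proj (layered G n R)) (g, i) \<longleftrightarrow> e \<in> ?f ` Sigma {..<n} (R i)" for e
  proof
    assume "e \<in> out_arcs (with_proj (layered G n R)) (g, i)"
    then obtain h j where e: "e = ((g, i), (h, j))" "h \<in> carrier G" "j < n" "h \<otimes> inv g \<in> R i j"
      by (cases e) (auto simp: out_arcs_def)
    then have "h = (h \<otimes> inv g) \<otimes> g" using assms by (simp add: m_assoc)
    then show "e \<in> ?f ` Sigma {..<n} (R i)"
      using e by (intro image_eqI[of _ _ "(j, h \<otimes> inv g)"]) auto
  next
    assume "e \<in> ?f ` Sigma {..<n} (R i)"
    moreover have "(r \<otimes> g) \<otimes> inv g = r" "r \<otimes> g \<in> carrier G" if "r \<in> R i j" for r j
      using that R assms by (auto simp: m_assoc subset_iff)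
    ultimately show "e \<in> out_arcs (with_proj (layered G n R)) (g, i)"
      using assms by (auto simp: out_arcs_def)
  qed
  then have eq: "out_arcs (with_proj (layered G n R)) (g, i) = ?f ` Sigma {..<n} (R i)" by blast
  have inj: "inj_on ?f (Sigma {..<n} (R i))"
    using R assms by (auto simp: inj_on_def subset_iff)
  have fin: "\<And>j. finite (R i j)" using R assms(1) finite_subset by blast
  show "finite (out_arcs (with_proj (layered G n R)) (g, i))"
    by (simp add: eq fin)
  show "out_degree (with_proj (layered G n R)) (g, i) = (\<Sum>j<n. card (R i j))"
    by (simp add: out_degree_def eq card_image[OF inj] card_SigmaI fin)
qed

lemma (in group) in_degree_layered:
  assumes "finite (carrier G)" and R: "\<And>i j. R i j \<subseteq> carrier G" and "h \<in> carrier G" "j < n"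
  shows "finite (in_arcs (with_proj (layered G n R)) (h, j))"
    and "in_degree (with_proj (layered G n R)) (h, j) = (\<Sum>i<n. card (R i j))"
proof -
  let ?f = "\<lambda>(i, r). ((inv r \<otimes> h, i), (h, j))"
  have "e \<in> in_arcs (with_proj (layered G n R)) (h, j) \<longleftrightarrow> e \<in> ?f ` Sigma {..<n} (\<lambda>i. R i j)" for e
  proof
    assume "e \<in> in_arcs (with_proj (layered G n R)) (h, j)"
    then obtain g i where e: "e = ((g, i), (h, j))" "g \<in> carrier G" "i < n" "h \<otimes> inv g \<in> R i j"
      by (cases e) (auto simp: in_arcs_def)
    then have "g = inv (h \<otimes> inv g) \<otimes> h" using assms by (simp add: inv_mult_group m_assoc)
    then show "e \<in> ?f ` Sigma {..<n} (\<lambda>i. R i j)"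
      using e by (intro image_eqI[of _ _ "(i, h \<otimes> inv g)"]) auto
  next
    assume "e \<in> ?f ` Sigma {..<n} (\<lambda>i. R i j)"
    moreover have "h \<otimes> inv (inv r \<otimes> h) = r" "inv r \<otimes> h \<in> carrier G" if "r \<in> R i j" for r i
    proof -
      have r: "r \<in> carrier G" using that R by blast
      then show "inv r \<otimes> h \<in> carrier G" using assms by simp
      have "h \<otimes> (inv h \<otimes> r) = r" using r assms by (simp flip: m_assoc)
      then show "h \<otimes> inv (inv r \<otimes> h) = r" using r assms by (simp add: inv_mult_group)
    qed
    ultimately show "e \<in> in_arcs (with_proj (layered G n R)) (h, j)"
      using assms by (auto simp: in_arcs_def)
  qed
  then have eq: "in_arcs (with_proj (layered G n R)) (h, j) = ?f ` Sigma {..<n} (\<lambda>i. R i j)" by blast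
  have inj: "inj_on ?f (Sigma {..<n} (\<lambda>i. R i j))"
    using R assms(3) by (auto simp: inj_on_def subset_iff; metis inv_inv)
  have fin: "\<And>i. finite (R i j)" using R assms(1) finite_subset by blast
  show "finite (in_arcs (with_proj (layered G n R)) (h, j))"
    by (simp add: eq fin)
  show "in_degree (with_proj (layered G n R)) (h, j) = (\<Sum>i<n. card (R i j))"
    by (simp add: in_degree_def eq card_image[OF inj] card_SigmaI fin)
qed

text \<open>The criterion behind every existence result. Right translations act regularly on each
  layer, so the layers are the orbits and \<open>G\<close> is the automorphism group as soon as
  \<open>rigid\<close> excludes all other automorphisms.\<close>

lemma (in group) layered_PDR:
  assumes fin: "finite (carrier G)" and n: "n \<ge> 1"
    and R: "\<And>i j. R i j \<subseteq> carrier G" and irr: "\<And>i. R i i = {}"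
    and out: "\<And>i. i < n \<Longrightarrow> (\<Sum>j<n. card (R i j)) = d"
    and inn: "\<And>j. j < n \<Longrightarrow> (\<Sum>i<n. card (R i j)) = d"
    and rigid: "\<And>\<sigma>. \<sigma> \<in> digraph_automorphisms (layered G n R) \<Longrightarrow>
      \<exists>a\<in>carrier G. \<forall>g\<in>carrier G. \<forall>i<n. \<sigma> (g, i) = (g \<otimes> a, i)"
  shows "is_PDR n G (layered G n R)"
proof -
  let ?D = "layered G n R"
  let ?A = "Aut_digraph ?D"
  have Aut: "digraph_automorphisms ?D = right_shift G n ` carrier G"
  proof (intro equalityI subsetI)
    fix \<sigma> assume s: "\<sigma> \<in> digraph_automorphisms ?D"
    then obtain a where a: "a \<in> carrier G" "\<forall>g\<in>carrier G. \<forall>i<n. \<sigma> (g, i) = (g \<otimes> a, i)"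
      using rigid by blast
    have "\<sigma> \<in> extensional (carrier G \<times> {..<n})"
      using s by (simp add: digraph_automorphisms_def Bij_def)
    then have "\<sigma> = right_shift G n (inv a)"
      using a by (auto simp: right_shift_def extensional_def fun_eq_iff)
    then show "\<sigma> \<in> right_shift G n ` carrier G" using a by blast
  qed (use right_shift_Aut in blast)
  have "right_shift G n \<in> hom G ?A"
  proof (rule homI)
    fix a b assume ab: "a \<in> carrier G" "b \<in> carrier G"
    then show "right_shift G n (a \<otimes> b) = right_shift G n a \<otimes>\<^bsub>?A\<^esub> right_shift G n b"
      unfolding mult_Aut_digraph[OF right_shift_Aut[OF ab(1)] right_shift_Aut[OF ab(2)]]
      by (auto simp: compose_def right_shift_def fun_eq_iff inv_mult_group m_assoc)
  qed (simp add: right_shift_Aut)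
  moreover have "inj_on (right_shift G n) (carrier G)"
  proof (rule inj_onI)
    fix a b assume ab: "a \<in> carrier G" "b \<in> carrier G" "right_shift G n a = right_shift G n b"
    have "right_shift G n a (\<one>, 0) = right_shift G n b (\<one>, 0)" using ab(3) by simp
    then have "inv a = inv b" using ab n by (simp add: right_shift_def)
    then show "a = b" using ab(1,2) inv_inj by (auto dest: inj_onD)
  qed
  ultimately have "G \<cong> ?A"
    by (intro is_isoI) (simp add: iso_def bij_betw_def Aut)
  then have iso: "?A \<cong> G" by (rule iso_sym)
  have semi: "semiregular ?A (pverts ?D)"
    unfolding semiregular_def
  proof
    fix v assume "v \<in> pverts ?D"
    then obtain g i where v: "v = (g, i)" "g \<in> carrier G" "i < n" by auto
    have "right_shift G n a v = v \<longleftrightarrow> a = \<one>" if "a \<in> carrier G" for a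
      using that v by (simp add: right_shift_def)
    then have "stabilizer ?A (\<lambda>\<sigma>. \<sigma>) v = {right_shift G n \<one>}"
      by (auto simp: stabilizer_def Aut)
    then show "stabilizer ?A (\<lambda>\<sigma>. \<sigma>) v = {\<one>\<^bsub>?A\<^esub>}"
      by (auto simp: right_shift_def fun_eq_iff)
  qed
  have "(\<one>, 0) \<in> pverts ?D" using n by simp
  then have ne: "pverts ?D \<noteq> {}" by blast
  have orb: "orbit ?A (\<lambda>\<sigma>. \<sigma>) (g, i) = carrier G \<times> {i}" if "g \<in> carrier G" "i < n" for g i
  proof (intro equalityI subsetI)
    fix w assume "w \<in> carrier G \<times> {i}"
    then obtain h where h: "w = (h, i)" "h \<in> carrier G" by auto
    then have "right_shift G n (inv h \<otimes> g) (g, i) = w"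
      using that by (simp add: right_shift_def inv_mult_group flip: m_assoc)
    then show "w \<in> orbit ?A (\<lambda>\<sigma>. \<sigma>) (g, i)"
      using that h by (auto simp: orbit_def Aut intro!: exI[of _ "right_shift G n (inv h \<otimes> g)"])
  qed (use that in \<open>auto simp: orbit_def Aut right_shift_def\<close>)
  have orbs: "orbits ?A (pverts ?D) (\<lambda>\<sigma>. \<sigma>) = (\<lambda>i. carrier G \<times> {i}) ` {..<n}"
    unfolding orbits_def using orb one_closed by (auto simp: image_def) blast
  have "inj_on (\<lambda>i. carrier G \<times> {i}) {..<n}"
    using one_closed by (auto simp: inj_on_def)
  then have card: "card (orbits ?A (pverts ?D) (\<lambda>\<sigma>. \<sigma>)) = n"
    unfolding orbs by (simp add: card_image)
  have finO: "finite (orbits ?A (pverts ?D) (\<lambda>\<sigma>. \<sigma>))" unfolding orbs by simp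
  have "regular_digraph ?D"
    unfolding regular_digraph_def
    by (rule exI[of _ d])
      (auto simp: out_degree_layered[OF fin R] in_degree_layered[OF fin R] out inn)
  moreover have "\<forall>X \<in> orbits ?A (pverts ?D) (\<lambda>\<sigma>. \<sigma>). arcs (with_proj ?D \<restriction> X) = {}"
    unfolding orbs by (auto simp: irr)
  ultimately show ?thesis
    unfolding is_PDR_def using iso semi card finO wf_layered ne by (intro conjI)
qed

section \<open>Digon paths, coloured Cayley digraphs and generating sets\<close>

text \<open>A digon path of length \<open>m\<close>; \<open>D\<close> is the digon relation and \<open>V\<close> the vertex set.\<close>

definition digon_path :: "'v set \<Rightarrow> ('v \<Rightarrow> 'v \<Rightarrow> bool) \<Rightarrow> nat \<Rightarrow> (nat \<Rightarrow> 'v) \<Rightarrow> bool" where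
  "digon_path V D m p \<longleftrightarrow> p ` {..<m} \<subseteq> V \<and> inj_on p {..<m} \<and>
     (\<forall>i<m. \<forall>v\<in>V. D (p i) v \<longleftrightarrow> (\<exists>j<m. v = p j \<and> (j = Suc i \<or> i = Suc j)))"

text \<open>A path contains all digon neighbours of its vertices. The image of the next vertex is
  therefore a digon neighbour of the previous image, and the neighbour on the other side is already
  taken by an earlier vertex.\<close>

lemma digon_path_image:
  assumes bij: "bij_betw \<sigma> V V" and D: "\<And>u v. u \<in> V \<Longrightarrow> v \<in> V \<Longrightarrow> D (\<sigma> u) (\<sigma> v) \<longleftrightarrow> D u v"
    and p: "digon_path V D m p" and q: "digon_path V D m q"
    and start: "\<sigma> (p 0) = q 0" and "i < m"
  shows "\<sigma> (p i) = q i"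
  using \<open>i < m\<close>
proof (induction i rule: less_induct)
  case (less i)
  show ?case
  proof (cases i)
    case 0 then show ?thesis using start by simp
  next
    case (Suc k)
    have V: "p i \<in> V" "p k \<in> V" using p less.prems Suc by (auto simp: digon_path_def)
    have "D (p k) (p i)" using p less.prems Suc V unfolding digon_path_def by fastforce
    then have "D (q k) (\<sigma> (p i))" using D V less Suc by (metis lessI Suc_lessD)
    moreover have "\<sigma> (p i) \<in> V" using bij V by (auto simp: bij_betw_def)
    ultimately obtain j where j: "j < m" "\<sigma> (p i) = q j" "j = Suc k \<or> k = Suc j"
      using q less.prems Suc unfolding digon_path_def by (metis Suc_lessD)
    show ?thesis
    proof (cases "j = i")
      case False
      then have "k = Suc j" using j Suc by blast
      then have "\<sigma> (p j) = q j" using less Suc by auto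
      then have "\<sigma> (p j) = \<sigma> (p i)" using j by simp
      moreover have "p j \<in> V" using p j by (auto simp: digon_path_def)
      ultimately have "p j = p i" using bij V by (auto simp: bij_betw_def dest: inj_onD)
      then have "j = i" using p j less.prems by (auto simp: digon_path_def dest: inj_onD)
      then show ?thesis using False by simp
    qed (use j in simp)
  qed
qed

text \<open>Lets \<open>digon_path_image\<close> treat an automorphism that carries the first vertex
  of a path to a last one.\<close>

lemma digon_path_rev:
  assumes "digon_path V D m p"
  shows "digon_path V D m (\<lambda>i. p (m - Suc i))"
  unfolding digon_path_def
proof (intro conjI allI impI ballI)
  show "(\<lambda>i. p (m - Suc i)) ` {..<m} \<subseteq> V" using assms by (auto simp: digon_path_def)
  have "inj_on p {..<m}" using assms by (simp add: digon_path_def)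
  then have "inj_on (p \<circ> (\<lambda>i. m - Suc i)) {..<m}"
    by (intro comp_inj_on) (auto simp: inj_on_def elim!: inj_on_subset)
  then show "inj_on (\<lambda>i. p (m - Suc i)) {..<m}" by (simp add: comp_def)
  fix i v assume i: "i < m" and v: "v \<in> V"
  then have "D (p (m - Suc i)) v \<longleftrightarrow>
      (\<exists>j<m. v = p j \<and> (j = Suc (m - Suc i) \<or> m - Suc i = Suc j))"
    using assms by (auto simp: digon_path_def)
  also have "\<dots> \<longleftrightarrow> (\<exists>j<m. v = p (m - Suc j) \<and> (j = Suc i \<or> i = Suc j))"
  proof
    assume "\<exists>j<m. v = p j \<and> (j = Suc (m - Suc i) \<or> m - Suc i = Suc j)"
    then obtain j where "j < m" "v = p j" "j = Suc (m - Suc i) \<or> m - Suc i = Suc j" by blast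
    then show "\<exists>j<m. v = p (m - Suc j) \<and> (j = Suc i \<or> i = Suc j)"
      using i by (intro exI[of _ "m - Suc j"]) auto
  next
    assume "\<exists>j<m. v = p (m - Suc j) \<and> (j = Suc i \<or> i = Suc j)"
    then obtain j where "j < m" "v = p (m - Suc j)" "j = Suc i \<or> i = Suc j" by blast
    then show "\<exists>j<m. v = p j \<and> (j = Suc (m - Suc i) \<or> m - Suc i = Suc j)"
      using i by (intro exI[of _ "m - Suc j"]) auto
  qed
  finally show "D (p (m - Suc i)) v \<longleftrightarrow> (\<exists>j<m. v = p (m - Suc j) \<and> (j = Suc i \<or> i = Suc j))" .
qed

text \<open>An end has at most one digon neighbour and an inner vertex has two; automorphisms
  preserve their number.\<close>

lemma digon_path_end:
  assumes bij: "bij_betw \<sigma> V V" and D: "\<And>u v. u \<in> V \<Longrightarrow> v \<in> V \<Longrightarrow> D (\<sigma> u) (\<sigma> v) \<longleftrightarrow> D u v"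
    and p: "digon_path V D m p" and q: "digon_path V D m q"
    and i: "\<sigma> (p 0) = q i" "i < m"
  shows "i = 0 \<or> Suc i = m"
proof (rule ccontr)
  assume "\<not> (i = 0 \<or> Suc i = m)"
  then have inner: "0 < i" "Suc i < m" using i by auto
  have V: "q (Suc i) \<in> V" "q (i - 1) \<in> V" "p 0 \<in> V"
    using p q inner by (auto simp: digon_path_def)
  have "\<sigma> ` V = V" using bij by (simp add: bij_betw_def)
  then obtain a b where ab: "a \<in> V" "b \<in> V" "\<sigma> a = q (Suc i)" "\<sigma> b = q (i - 1)"
    using V by (metis imageE)
  have qD: "D (q i) v \<longleftrightarrow> (\<exists>j<m. v = q j \<and> (j = Suc i \<or> i = Suc j))" if "v \<in> V" for v
    using q i that by (simp add: digon_path_def)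
  have pD: "D (p 0) v \<longleftrightarrow> 1 < m \<and> v = p 1" if "v \<in> V" for v
    using p i that by (auto simp: digon_path_def)
  have "D (q i) (q (Suc i))" unfolding qD[OF V(1)] using inner by blast
  moreover have "D (q i) (q (i - 1))"
    unfolding qD[OF V(2)] using inner by (intro exI[of _ "i - 1"]) auto
  ultimately have "D (p 0) a" "D (p 0) b"
    using ab V D[of "p 0" a] D[of "p 0" b] i by simp_all
  then have "a = p 1" "b = p 1" using ab pD by simp_all
  then have "q (Suc i) = q (i - 1)" using ab by simp
  then have "Suc i = i - 1" using q inner by (auto simp: digon_path_def dest!: inj_onD)
  then show False by simp
qed

text \<open>The sets in \<open>\<R>\<close> are the connection sets of the colours of a coloured Cayley digraph.\<close>

definition colour_perm :: "('g, 'm) monoid_scheme \<Rightarrow> 'g set set \<Rightarrow> ('g \<Rightarrow> 'g) \<Rightarrow> bool" where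
  "colour_perm G \<R> \<phi> \<longleftrightarrow> bij_betw \<phi> (carrier G) (carrier G) \<and>
     (\<forall>R\<in>\<R>. \<forall>g\<in>carrier G. \<forall>h\<in>carrier G.
        \<phi> h \<otimes>\<^bsub>G\<^esub> inv\<^bsub>G\<^esub> \<phi> g \<in> R \<longleftrightarrow> h \<otimes>\<^bsub>G\<^esub> inv\<^bsub>G\<^esub> g \<in> R)"

lemma colour_permD:
  assumes "colour_perm G \<R> \<phi>"
  shows "bij_betw \<phi> (carrier G) (carrier G)" "inj_on \<phi> (carrier G)"
    "\<And>g. g \<in> carrier G \<Longrightarrow> \<phi> g \<in> carrier G"
    "\<And>R g h. R \<in> \<R> \<Longrightarrow> g \<in> carrier G \<Longrightarrow> h \<in> carrier G \<Longrightarrow>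
       \<phi> h \<otimes>\<^bsub>G\<^esub> inv\<^bsub>G\<^esub> \<phi> g \<in> R \<longleftrightarrow> h \<otimes>\<^bsub>G\<^esub> inv\<^bsub>G\<^esub> g \<in> R"
  using assms by (auto simp: colour_perm_def bij_betw_def)

lemma (in group) bij_betw_mult_right:
  "a \<in> carrier G \<Longrightarrow> bij_betw (\<lambda>g. g \<otimes> a) (carrier G) (carrier G)"
  by (rule bij_betw_byWitness[where f' = "\<lambda>g. g \<otimes> inv a"]) (auto simp: m_assoc)

lemma (in group) bij_betw_recentre:
  assumes "bij_betw \<phi> (carrier G) (carrier G)" "g \<in> carrier G"
  shows "bij_betw (\<lambda>h. \<phi> (h \<otimes> g) \<otimes> inv (\<phi> g)) (carrier G) (carrier G)"
proof -
  have "\<phi> g \<in> carrier G" using assms by (auto simp: bij_betw_def)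
  then show ?thesis
    using bij_betw_trans[OF bij_betw_trans[OF bij_betw_mult_right[OF assms(2)] assms(1)]
        bij_betw_mult_right[of "inv (\<phi> g)"]]
    by (simp add: comp_def)
qed

text \<open>Moves an arbitrary base point to the identity: the result fixes \<open>\<one>\<close>,
  and only right translations have been composed with \<open>\<phi>\<close>.\<close>

lemma (in group) colour_perm_recentre:
  assumes "colour_perm G \<R> \<phi>" "g \<in> carrier G"
  shows "colour_perm G \<R> (\<lambda>h. \<phi> (h \<otimes> g) \<otimes> inv (\<phi> g))"
  unfolding colour_perm_def
  using bij_betw_recentre[OF colour_permD(1)[OF assms(1)] assms(2)] assms
  by (auto simp: quot_right_shift colour_permD)

text \<open>Rigidity at the identity spreads over the group: recentring at \<open>h\<close> turns
  \<open>local\<close> into \<open>\<phi> (x \<otimes> h) = x \<otimes> \<phi> h\<close>, and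
  induction on words in the generators does the rest.\<close>

lemma (in group) colour_perm_translation:
  assumes gen: "generate G X = carrier G"
    and local: "\<And>\<psi> x. colour_perm G \<R> \<psi> \<Longrightarrow> \<psi> \<one> = \<one> \<Longrightarrow> x \<in> X \<Longrightarrow> \<psi> x = x"
    and cp: "colour_perm G \<R> \<phi>" and "g \<in> carrier G"
  shows "\<phi> g = g \<otimes> \<phi> \<one>"
proof -
  have X: "X \<subseteq> carrier G" using gen generate.incl by fastforce
  note \<phi> = colour_permD(3)[OF cp]
  have step: "\<phi> (x \<otimes> h) = x \<otimes> \<phi> h" if x: "x \<in> X" and h: "h \<in> carrier G" for x h
  proof -
    have "\<phi> (x \<otimes> h) \<otimes> inv (\<phi> h) = x"
      using local[OF colour_perm_recentre[OF cp h] _ x] \<phi> h by simp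
    then show ?thesis using x X h \<phi> by (metis inv_solve_right m_closed subsetD)
  qed
  have "\<phi> (w \<otimes> h) = w \<otimes> \<phi> h" if "w \<in> generate G X" "h \<in> carrier G" for w h
    using that
  proof (induction arbitrary: h rule: generate.induct)
    case one then show ?case using \<phi> by simp
  next
    case (incl x) then show ?case using step by blast
  next
    case (inv x)
    then have x: "x \<in> carrier G" using X by blast
    have "\<phi> h = x \<otimes> \<phi> (inv x \<otimes> h)"
      using step[of x "inv x \<otimes> h"] inv x by (simp flip: m_assoc)
    then show ?case using x inv \<phi> by (simp flip: m_assoc)
  next
    case (eng w1 w2)
    then have "w1 \<in> carrier G" "w2 \<in> carrier G" using gen by auto
    then show ?case using eng \<phi> by (simp add: m_assoc)
  qed
  from this[of g \<one>] show ?thesis using gen assms(4) by simp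
qed

section \<open>Irredundant and minimum generating sequences\<close>

definition irredundant :: "('g, 'm) monoid_scheme \<Rightarrow> nat \<Rightarrow> (nat \<Rightarrow> 'g) \<Rightarrow> bool" where
  "irredundant G k x \<longleftrightarrow> (\<forall>i<k. x i \<in> carrier G \<and> x i \<notin> generate G (x ` ({..<k} - {i})))"

text \<open>As a connection set this colour has an arc from each \<open>x l\<close> to
  \<open>x (Suc l)\<close>.\<close>

definition steps :: "('g, 'm) monoid_scheme \<Rightarrow> nat \<Rightarrow> (nat \<Rightarrow> 'g) \<Rightarrow> 'g set" where
  "steps G k x = {x (Suc l) \<otimes>\<^bsub>G\<^esub> inv\<^bsub>G\<^esub> x l | l. Suc l < k}"

text \<open>Minimality is expressed by the bound \<open>k\<close> alone, so that it passes to any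
  other generating sequence of length \<open>k\<close>.\<close>

definition min_generating :: "('g, 'm) monoid_scheme \<Rightarrow> nat \<Rightarrow> (nat \<Rightarrow> 'g) \<Rightarrow> bool" where
  "min_generating G k x \<longleftrightarrow> x ` {..<k} \<subseteq> carrier G \<and> generate G (x ` {..<k}) = carrier G \<and>
     (\<forall>X. X \<subseteq> carrier G \<longrightarrow> finite X \<longrightarrow> generate G X = carrier G \<longrightarrow> k \<le> card X)"

lemma (in group) min_generating_exists:
  assumes "finite (carrier G)"
  obtains k x where "min_generating G k x"
proof -
  let ?P = "\<lambda>X. X \<subseteq> carrier G \<and> finite X \<and> generate G X = carrier G"
  have "generate G (carrier G) = carrier G"
    using generate_incl[of "carrier G"] generate.incl by fast
  then have "?P (carrier G)" using assms by blast
  then obtain X where X: "?P X" and min: "\<And>Y. ?P Y \<Longrightarrow> card X \<le> card Y"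
    using exists_least_iff[of "\<lambda>k. \<exists>X. ?P X \<and> card X = k"] by (metis not_le)
  obtain x where "bij_betw x {..<card X} X"
    using X ex_bij_betw_nat_finite[of X] by (auto simp: atLeast0LessThan)
  then have "x ` {..<card X} = X" by (simp add: bij_betw_def)
  then have "min_generating G (card X) x" unfolding min_generating_def using X min by auto
  then show thesis by (rule that)
qed

lemma (in group) min_generating_irredundant:
  assumes "min_generating G k x"
  shows "irredundant G k x"
  unfolding irredundant_def
proof (intro allI impI conjI)
  fix i assume i: "i < k"
  have xc: "x ` {..<k} \<subseteq> carrier G" and gen: "generate G (x ` {..<k}) = carrier G"
    using assms by (auto simp: min_generating_def)
  then show "x i \<in> carrier G" using i by blast
  let ?Y = "x ` ({..<k} - {i})"
  have Y: "?Y \<subseteq> carrier G" using xc by blast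
  show "x i \<notin> generate G ?Y"
  proof
    assume "x i \<in> generate G ?Y"
    then have "x ` {..<k} \<subseteq> generate G ?Y" by (auto intro: generate.incl)
    then have "carrier G \<subseteq> generate G ?Y"
      using generate_subgroup_incl[OF _ generate_is_subgroup[OF Y]] gen by blast
    then have "generate G ?Y = carrier G" using generate_incl[OF Y] by blast
    then have "k \<le> card ?Y" using assms Y unfolding min_generating_def by blast
    also have "\<dots> \<le> card ({..<k} - {i})" by (rule card_image_le) simp
    also have "\<dots> < k" using i by simp
    finally show False by simp
  qed
qed

context group
begin

context
  fixes k :: nat and x :: "nat \<Rightarrow> 'a"
  assumes irr: "irredundant G k x"
begin

lemma irredundant_closed [simp]: "i < k \<Longrightarrow> x i \<in> carrier G"
  using irr by (simp add: irredundant_def)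

lemma irredundant_notin:
  assumes "i < k" "J \<subseteq> {..<k} - {i}"
  shows "x i \<notin> generate G (x ` J)"
  using irr assms mono_generate[of "x ` J" "x ` ({..<k} - {i})"]
  by (auto simp: irredundant_def)

lemma generate_image_mem:
  "i \<in> J \<Longrightarrow> x i \<in> generate G (x ` J)" "i \<in> J \<Longrightarrow> inv x i \<in> generate G (x ` J)"
  by (auto intro: generate.incl generate.inv)

lemma irredundant_inj: "inj_on x {..<k}"
proof (rule inj_onI, rule ccontr)
  fix i j assume "i \<in> {..<k}" "j \<in> {..<k}" "x i = x j" "i \<noteq> j"
  then show False using irredundant_notin[of i "{j}"] generate.incl[of "x j" "x ` {j}" G] by auto
qed

lemma irredundant_not_one: "i < k \<Longrightarrow> x i \<noteq> \<one>"
  using irredundant_notin[of i "{}"] generate.one[of G "{}"] by auto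

text \<open>If \<open>i\<close> or \<open>j\<close> were missing from \<open>{l, m}\<close>, the
  equation could be solved for that generator in terms of the others, against irredundance.\<close>

lemma irredundant_quot:
  assumes lt: "i < k" "j < k" "l < k" "m < k" and ne: "i \<noteq> j"
    and eq: "x j \<otimes> inv x i = x m \<otimes> inv x l"
  shows "{i, j} \<subseteq> {l, m}"
proof (rule ccontr)
  assume "\<not> {i, j} \<subseteq> {l, m}"
  then consider "j \<notin> {l, m}" | "i \<notin> {l, m}" by blast
  then show False
  proof cases
    case 1
    let ?J = "{i, l, m}"
    have "x j = (x m \<otimes> inv x l) \<otimes> x i"
      using eq lt by (metis inv_solve_right' irredundant_closed m_closed inv_closed)
    then have "x j \<in> generate G (x ` ?J)"
      by (simp only:) (intro generate.eng generate_image_mem; simp)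
    then show False using irredundant_notin[of j ?J] 1 lt ne by auto
  next
    case 2
    let ?J = "{j, l, m}"
    have "x i = inv (x m \<otimes> inv x l) \<otimes> x j"
      using lt by (simp flip: eq add: inv_mult_group m_assoc)
    also have "\<dots> = (x l \<otimes> inv x m) \<otimes> x j"
      using lt by (simp add: inv_mult_group)
    finally have "x i = (x l \<otimes> inv x m) \<otimes> x j" .
    then have "x i \<in> generate G (x ` ?J)"
      by (simp only:) (intro generate.eng generate_image_mem; simp)
    then show False using irredundant_notin[of i ?J] 2 lt ne by auto
  qed
qed

text \<open>Only undirected adjacency is available: a step that is an involution gives arcs both
  ways.\<close>

lemma steps_edge:
  assumes "i < k" "j < k" "i \<noteq> j" "x j \<otimes> inv x i \<in> steps G k x"
  shows "j = Suc i \<or> i = Suc j"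
proof -
  obtain l where "Suc l < k" "x j \<otimes> inv x i = x (Suc l) \<otimes> inv x l"
    using assms by (auto simp: steps_def)
  then have "{i, j} \<subseteq> {l, Suc l}" using assms by (intro irredundant_quot) auto
  then show ?thesis using assms by auto
qed

text \<open>Keeps the colour of the generators apart from the steps and their inverses. The equation
  would either make a generator trivial or express \<open>x m\<close> by \<open>x i\<close> and
  \<open>x l\<close>.\<close>

lemma generator_ne_quot:
  assumes lt: "i < k" "l < k" "m < k" and ne: "l \<noteq> m"
  shows "x i \<noteq> x m \<otimes> inv x l"
proof
  assume eq: "x i = x m \<otimes> inv x l"
  show False
  proof (cases "i = m")
    case True
    then have "inv x l = \<one>" using eq lt
      by (metis inv_closed irredundant_closed l_cancel_one')
    then show False using irredundant_not_one lt by (metis inv_eq_1_iff irredundant_closed)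
  next
    case False
    then have "x m = x i \<otimes> x l" using eq lt by (simp add: m_assoc)
    then have "x m \<in> generate G (x ` {i, l})"
      by (simp only:) (intro generate.eng generate_image_mem; simp)
    then show False using irredundant_notin[of m "{i, l}"] lt False ne by auto
  qed
qed

lemma generator_notin_steps: "i < k \<Longrightarrow> x i \<notin> steps G k x"
  unfolding steps_def using generator_ne_quot by fastforce

lemma generator_notin_inv_steps: "i < k \<Longrightarrow> s \<in> steps G k x \<Longrightarrow> x i \<noteq> inv s"
proof -
  assume i: "i < k" and "s \<in> steps G k x"
  then obtain l where l: "Suc l < k" "s = x (Suc l) \<otimes> inv x l" by (auto simp: steps_def)
  then have "inv s = x l \<otimes> inv x (Suc l)" by (simp add: inv_mult_group)
  then show "x i \<noteq> inv s" using generator_ne_quot[of i "Suc l" l] i l by simp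
qed

lemma one_notin_steps: "\<one> \<notin> steps G k x"
proof
  assume "\<one> \<in> steps G k x"
  then obtain l where l: "Suc l < k" "x (Suc l) \<otimes> inv x l = \<one>" by (auto simp: steps_def)
  then have "x (Suc l) = x l" by (simp add: Suc_lessD inv_solve_right')
  then show False using irredundant_inj l by (auto dest!: inj_onD)
qed

lemma steps_closed: "steps G k x \<subseteq> carrier G"
  by (auto simp: steps_def)

lemma card_steps: "card (steps G k x) = k - 1"
proof -
  let ?f = "\<lambda>l. x (Suc l) \<otimes> inv x l"
  have eq: "steps G k x = ?f ` {..<k - 1}" by (auto simp: steps_def image_def)
  have "inj_on ?f {..<k - 1}"
  proof (rule inj_onI)
    fix l m assume "l \<in> {..<k - 1}" "m \<in> {..<k - 1}" and e: "?f l = ?f m"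
    then have "{l, Suc l} \<subseteq> {m, Suc m}" by (intro irredundant_quot[OF _ _ _ _ _ e]) auto
    then show "l = m" by auto
  qed
  then show ?thesis by (simp add: eq card_image)
qed

text \<open>The steps make the generators into a path, so an injection fixing \<open>x 0\<close> fixes them all.\<close>

lemma path_fixed:
  assumes im: "\<And>i. i < k \<Longrightarrow> \<phi> (x i) \<in> x ` {..<k}" and inj: "inj_on \<phi> (carrier G)"
    and start: "\<phi> (x 0) = x 0"
    and edge: "\<And>i j. i < k \<Longrightarrow> j < k \<Longrightarrow> i \<noteq> j \<Longrightarrow> \<phi> (x j) \<otimes> inv \<phi> (x i) \<in> S \<longleftrightarrow> x j \<otimes> inv x i \<in> S"
    and S: "steps G k x \<subseteq> S"
      "\<And>i j. i < k \<Longrightarrow> j < k \<Longrightarrow> i \<noteq> j \<Longrightarrow> x j \<otimes> inv x i \<in> S \<Longrightarrow> j = Suc i \<or> i = Suc j"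
    and "i < k"
  shows "\<phi> (x i) = x i"
  using \<open>i < k\<close>
proof (induction i rule: less_induct)
  case (less i)
  show ?case
  proof (cases i)
    case 0 then show ?thesis using start by simp
  next
    case (Suc l)
    obtain j where j: "j < k" "\<phi> (x i) = x j" using im less.prems by blast
    have fl: "\<phi> (x l) = x l" using less Suc by simp
    have "x i \<otimes> inv x l \<in> S" using S(1) less.prems Suc by (auto simp: steps_def)
    then have "x j \<otimes> inv x l \<in> S" using edge[of l i] less.prems Suc j fl by simp
    moreover have "j \<noteq> l"
    proof
      assume "j = l"
      then have "\<phi> (x i) = \<phi> (x l)" using j fl by simp
      then have "x i = x l" using inj less.prems Suc by (auto dest: inj_onD)
      then show False using irredundant_inj less.prems Suc by (auto dest!: inj_onD)
    qed
    \<comment> \<open>The second alternative turns back to a vertex that is already fixed, which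
      injectivity forbids.\<close>
    ultimately consider "j = i" | "l = Suc j" using S(2)[of l j] j less.prems Suc by auto
    then show ?thesis
    proof cases
      case 2
      then have "\<phi> (x j) = \<phi> (x i)" using less Suc j by simp
      then have "x j = x i" using inj_onD[OF inj, of "x j" "x i"] j less.prems by simp
      then show ?thesis using j by simp
    qed (use j in simp)
  qed
qed

end

end

section \<open>At least three orbits\<close>

lemma layered_AutD:
  assumes "\<sigma> \<in> digraph_automorphisms (layered G n R)"
  shows "bij_betw \<sigma> (carrier G \<times> {..<n}) (carrier G \<times> {..<n})"
    "\<And>u v. u \<in> carrier G \<times> {..<n} \<Longrightarrow> v \<in> carrier G \<times> {..<n} \<Longrightarrow>
       (\<sigma> u, \<sigma> v) \<in> parcs (layered G n R) \<longleftrightarrow> (u, v) \<in> parcs (layered G n R)"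
  using assms by (auto simp: digraph_automorphisms_def Bij_def)

text \<open>Once an automorphism acts on all layers through one permutation of the group, the
  digraph can be forgotten and only the connection sets remain.\<close>

lemma fibrewise_colour_perm:
  assumes \<sigma>: "\<sigma> \<in> digraph_automorphisms (layered G n R)" and n: "n \<ge> 1"
    and \<phi>: "\<And>g i. g \<in> carrier G \<Longrightarrow> i < n \<Longrightarrow> \<sigma> (g, i) = (\<phi> g, i)"
  shows "colour_perm G {R i j | i j. i < n \<and> j < n} \<phi>"
proof -
  note bij = layered_AutD(1)[OF \<sigma>] and arc = layered_AutD(2)[OF \<sigma>]
  have closed: "\<phi> g \<in> carrier G" if "g \<in> carrier G" for g
    using bij_betw_apply[OF bij, of "(g, 0)"] \<phi>[of g 0] that n by simp
  have inj: "inj_on \<phi> (carrier G)"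
  proof (rule inj_onI)
    fix g h assume gh: "g \<in> carrier G" "h \<in> carrier G" "\<phi> g = \<phi> h"
    then have "\<sigma> (g, 0) = \<sigma> (h, 0)" using \<phi> n by simp
    then have "(g, 0) = (h, 0)"
      using inj_onD[OF bij_betw_imp_inj_on[OF bij], of "(g, 0)" "(h, 0)"] gh n by simp
    then show "g = h" by simp
  qed
  have surj: "h \<in> \<phi> ` carrier G" if h: "h \<in> carrier G" for h
  proof -
    have "(h, 0) \<in> \<sigma> ` (carrier G \<times> {..<n})"
      using bij_betw_imp_surj_on[OF bij] h n by simp
    then show ?thesis using \<phi> by auto
  qed
  have "\<phi> h \<otimes>\<^bsub>G\<^esub> inv\<^bsub>G\<^esub> \<phi> g \<in> R i j \<longleftrightarrow> h \<otimes>\<^bsub>G\<^esub> inv\<^bsub>G\<^esub> g \<in> R i j"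
    if "i < n" "j < n" "g \<in> carrier G" "h \<in> carrier G" for i j g h
    using arc[of "(g, i)" "(h, j)"] that by (simp add: \<phi> closed)
  then show ?thesis
    unfolding colour_perm_def bij_betw_def using inj surj closed by blast
qed

text \<open>
  Identity digons join consecutive layers and add one to the valencies, except in the end layers
  \<open>0\<close> and \<open>n - 1\<close>, which are compensated by the arcs between them. The asymmetry of these arcs
  also rules out reversing the layers.
\<close>

definition chain_conn ::
  "('g, 'm) monoid_scheme \<Rightarrow> nat \<Rightarrow> nat \<Rightarrow> (nat \<Rightarrow> 'g) \<Rightarrow> nat \<Rightarrow> nat \<Rightarrow> 'g set" where
  "chain_conn G n k x i j =
     (if j = Suc i then insert \<one>\<^bsub>G\<^esub> (if i = 0 then steps G k x else x ` {1..<k})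
      else if i = Suc j then {\<one>\<^bsub>G\<^esub>}
      else if i = n - 1 \<and> j = 0 then x ` {..<k}
      else if i = 0 \<and> j = n - 1 then {\<one>\<^bsub>G\<^esub>}
      else {})"

text \<open>The digons are exactly the identity digons, so each fibre is a digon path and
  automorphisms act fibrewise. Three pairs of layers then fix the generators: the pair from
  \<open>n - 1\<close> to \<open>0\<close> shows the set of all generators, the pair from
  \<open>0\<close> to \<open>1\<close> shows the path through them, and the pair from
  \<open>1\<close> to \<open>2\<close> misses only \<open>x 0\<close> and so marks its end.\<close>

lemma (in group) chain_PDR:
  assumes fin: "finite (carrier G)" and n: "n \<ge> 3" and k: "k \<ge> 1"
    and irr: "irredundant G k x" and gen: "generate G (x ` {..<k}) = carrier G"
  shows "is_PDR n G (layered G n (chain_conn G n k x))"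
proof (rule layered_PDR[where d = "k + 1"])
  let ?R = "chain_conn G n k x" and ?D = "layered G n (chain_conn G n k x)"
  let ?V = "carrier G \<times> {..<n}"
  note inj = irredundant_inj[OF irr] and x [simp] = irredundant_closed[OF irr]
  have one: "\<one> \<notin> x ` {..<k}" using irredundant_not_one[OF irr] by fastforce
  then have one': "\<one> \<notin> x ` {1..<k}" by force
  show "finite (carrier G)" "n \<ge> 1" using fin n by auto
  show "?R i j \<subseteq> carrier G" for i j
    using steps_closed[OF irr] by (auto simp: chain_conn_def)
  show "?R i i = {}" for i using n by (auto simp: chain_conn_def)
  have "inj_on x {1..<k}" by (rule inj_on_subset[OF inj]) auto
  moreover have "finite (steps G k x)"
    using fin steps_closed[OF irr] finite_subset by blast
  ultimately have card: "card (?R i j) = (if j = Suc i then k else 0) + (if i = Suc j then 1 else 0)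
      + (if i = n - 1 \<and> j = 0 then k else 0) + (if i = 0 \<and> j = n - 1 then 1 else 0)" for i j
    using n k one' one_notin_steps[OF irr] card_steps[OF irr] inj
    by (auto simp: chain_conn_def card_image)
  show "(\<Sum>j<n. card (?R i j)) = k + 1" if "i < n" for i
  proof -
    have "(\<Sum>j<n. if i = Suc j then 1 else (0::nat)) = (if i = 0 then 0 else 1)"
      using that by (cases i) auto
    moreover have "(\<Sum>j<n. if i = n - 1 \<and> j = 0 then k else 0) = (if i = n - 1 then k else 0)"
      "(\<Sum>j<n. if i = 0 \<and> j = n - 1 then 1 else (0::nat)) = (if i = 0 then 1 else 0)"
      using n by (cases "i = n - 1"; cases "i = 0"; simp)+
    ultimately show ?thesis
      using that n unfolding card sum.distrib by auto
  qed
  show "(\<Sum>i<n. card (?R i j)) = k + 1" if "j < n" for j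
  proof -
    have "(\<Sum>i<n. if j = Suc i then k else 0) = (if j = 0 then 0 else k)"
      using that by (cases j) auto
    moreover have "(\<Sum>i<n. if i = n - 1 \<and> j = 0 then k else 0) = (if j = 0 then k else 0)"
      "(\<Sum>i<n. if i = 0 \<and> j = n - 1 then 1 else (0::nat)) = (if j = n - 1 then 1 else 0)"
      using n by (cases "j = n - 1"; cases "j = 0"; simp)+
    ultimately show ?thesis
      using that n unfolding card sum.distrib by auto
  qed
  fix \<sigma> assume \<sigma>: "\<sigma> \<in> digraph_automorphisms ?D"
  note bij = layered_AutD(1)[OF \<sigma>] and arc = layered_AutD(2)[OF \<sigma>]
  define D where "D u v \<longleftrightarrow> (u, v) \<in> parcs ?D \<and> (v, u) \<in> parcs ?D" for u v
  have D\<sigma>: "D (\<sigma> u) (\<sigma> v) \<longleftrightarrow> D u v" if "u \<in> ?V" "v \<in> ?V" for u v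
    using arc that unfolding D_def by blast
  have Dsym: "D u v \<longleftrightarrow> D v u" for u v by (auto simp: D_def)
  have D1: "D (g, i) (h, Suc i) \<longleftrightarrow> h = g"
    if "g \<in> carrier G" "h \<in> carrier G" "Suc i < n" for g h i
    using that inv_equality[of h "inv g"] by (auto simp: D_def chain_conn_def)
       (metis inv_closed inv_inv inv_equality)+
  \<comment> \<open>The arc leaving layer \<open>0\<close> forces equal group elements, and then the
    returning quotient is \<open>\<one>\<close>, which is not a generator.\<close>
  have D2: "\<not> D (g, n - 1) (h, 0)" if "g \<in> carrier G" "h \<in> carrier G" for g h
  proof
    assume "D (g, n - 1) (h, 0)"
    then have "g \<otimes> inv h = \<one>" "h \<otimes> inv g \<in> x ` {..<k}"
      using n by (auto simp: D_def chain_conn_def split: if_splits)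
    moreover from this have "g = h" using that by (simp add: inv_solve_right')
    ultimately show False using one that by simp
  qed
  have Diff: "D (g, i) (h, j) \<longleftrightarrow> h = g \<and> (j = Suc i \<or> i = Suc j)"
    if gh: "g \<in> carrier G" "h \<in> carrier G" and ij: "i < n" "j < n" for g h i j
  proof -
    consider "j = Suc i" | "i = Suc j" | "i = n - 1" "j = 0" "i \<noteq> Suc j" | "j = n - 1" "i = 0" "j \<noteq> Suc i"
      | "j \<noteq> Suc i" "i \<noteq> Suc j" "\<not> (i = n - 1 \<and> j = 0)" "\<not> (i = 0 \<and> j = n - 1)" by blast
    then show ?thesis
    proof cases
      case 1 then show ?thesis using D1 that by auto
    next
      case 2 then show ?thesis using D1[of h g j] Dsym that by auto
    next
      case 3 then show ?thesis using D2[of g h] that n by auto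
    next
      case 4 then show ?thesis using D2[of h g] Dsym that n by auto
    next
      case 5
      then have "?R i j = {}" unfolding chain_conn_def by argo
      then show ?thesis using 5 by (simp add: D_def)
    qed
  qed
  have path: "digon_path ?V D n (\<lambda>i. (g, i))" if "g \<in> carrier G" for g
    using that by (auto simp: digon_path_def inj_on_def Diff)
  have fibre: "\<sigma> (g, i) = (fst (\<sigma> (g, 0)), i)" if g: "g \<in> carrier G" and i: "i < n" for g i
  proof -
    obtain h l where hl: "\<sigma> (g, 0) = (h, l)" "h \<in> carrier G" "l < n"
      using bij_betw_apply[OF bij, of "(g, 0)"] g n by (cases "\<sigma> (g, 0)") auto
    have "l = 0 \<or> Suc l = n"
      by (rule digon_path_end[OF bij _ path[OF g] path[OF hl(2)] hl(1,3)]) (rule D\<sigma>)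
    \<comment> \<open>A reversal would carry the arc from \<open>(g, 0)\<close> to
      \<open>(g, n - 1)\<close> to an arc from layer \<open>n - 1\<close> to layer \<open>0\<close>
      with quotient \<open>\<one>\<close>.\<close>
    moreover have "Suc l \<noteq> n"
    proof
      assume l: "Suc l = n"
      have "\<sigma> (g, n - 1) = (h, n - Suc (n - 1))"
        by (rule digon_path_image[OF bij _ path[OF g] digon_path_rev[OF path[OF hl(2)]]])
          (use D\<sigma> hl l n in auto)
      then have "\<sigma> (g, n - 1) = (h, 0)" using n by simp
      moreover have "((g, 0), (g, n - 1)) \<in> parcs ?D" using g n by (simp add: chain_conn_def)
      then have "(\<sigma> (g, 0), \<sigma> (g, n - 1)) \<in> parcs ?D" using arc g n by simp
      ultimately have "((h, n - 1), (h, 0)) \<in> parcs ?D" using hl l by auto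
      then show False using one hl(2) n by (auto simp: chain_conn_def split: if_splits)
    qed
    ultimately have "\<sigma> (g, 0) = (h, 0)" using hl by simp
    then have "\<sigma> (g, i) = (h, i)"
      using digon_path_image[OF bij D\<sigma> path[OF g] path[OF hl(2)]] i by blast
    then show ?thesis using hl by simp
  qed
  let ?C = "{?R i j | i j. i < n \<and> j < n}"
  have cp: "colour_perm G ?C (\<lambda>g. fst (\<sigma> (g, 0)))"
    by (rule fibrewise_colour_perm[OF \<sigma> _ fibre]) (use n in auto)
  have fixed: "\<psi> y = y" if \<psi>: "colour_perm G ?C \<psi>" "\<psi> \<one> = \<one>" and y: "y \<in> x ` {..<k}" for \<psi> y
  proof -
    have pres: "\<psi> h \<otimes> inv \<psi> g \<in> ?R i j \<longleftrightarrow> h \<otimes> inv g \<in> ?R i j"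
      if "g \<in> carrier G" "h \<in> carrier G" "i < n" "j < n" for g h i j
      using colour_permD(4)[OF \<psi>(1)] that by blast
    have pres1: "\<psi> h \<in> ?R i j \<longleftrightarrow> h \<in> ?R i j" if "h \<in> carrier G" "i < n" "j < n" for h i j
      using pres[of \<one> h i j] that \<psi>(2) colour_permD(3)[OF \<psi>(1)] by simp
    have X: "?R (n - 1) 0 = x ` {..<k}" and S: "?R 0 1 = insert \<one> (steps G k x)"
      and Y: "?R 1 2 = insert \<one> (x ` {1..<k})"
      using n by (auto simp: chain_conn_def)
    have im: "\<psi> (x i) \<in> x ` {..<k}" if "i < k" for i
      using pres1[of "x i" "n - 1" 0] that n unfolding X by auto
    \<comment> \<open>\<open>x 0\<close> is the only generator outside this connection set, hence
      its image, again a generator outside the set, is \<open>x 0\<close>.\<close>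
    have "x 0 \<notin> ?R 1 2" unfolding Y using irredundant_not_one[OF irr, of 0] k inj
      by (auto dest!: inj_onD)
    then have "\<psi> (x 0) \<notin> ?R 1 2" using pres1[of "x 0" 1 2] k n by simp
    then have start: "\<psi> (x 0) = x 0" using im[of 0] k unfolding Y
      by (auto simp: image_iff) (metis Suc_le_eq atLeastLessThan_iff not_gr_zero)
    obtain i where i: "y = x i" "i < k" using y by auto
    have "\<psi> (x i) = x i"
    proof (rule path_fixed[OF irr im colour_permD(2)[OF \<psi>(1)] start])
      show "\<psi> (x j) \<otimes> inv \<psi> (x i) \<in> ?R 0 1 \<longleftrightarrow> x j \<otimes> inv x i \<in> ?R 0 1" if "i < k" "j < k" for i j
        using pres that n by simp
      show "steps G k x \<subseteq> ?R 0 1" unfolding S by blast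
      show "j = Suc i \<or> i = Suc j" if "i < k" "j < k" "i \<noteq> j" "x j \<otimes> inv x i \<in> ?R 0 1" for i j
      proof -
        have "x j \<noteq> x i" using inj that by (auto dest: inj_onD)
        then have "x j \<otimes> inv x i \<noteq> \<one>" using that by (simp add: inv_solve_right')
        then show ?thesis using steps_edge[OF irr] that unfolding S by blast
      qed
    qed (use i in auto)
    then show ?thesis using i by simp
  qed
  have "fst (\<sigma> (g, 0)) = g \<otimes> fst (\<sigma> (\<one>, 0))" if "g \<in> carrier G" for g
    by (rule colour_perm_translation[OF gen _ cp that]) (rule fixed)
  then have "\<forall>g\<in>carrier G. \<forall>i<n. \<sigma> (g, i) = (g \<otimes> fst (\<sigma> (\<one>, 0)), i)"
    using fibre by metis
  then show "\<exists>a\<in>carrier G. \<forall>g\<in>carrier G. \<forall>i<n. \<sigma> (g, i) = (g \<otimes> a, i)"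
    using colour_permD(3)[OF cp, of \<one>] by blast
qed

section \<open>Two orbits: Haar digraphs\<close>

text \<open>Without arcs every permutation of the group is an automorphism. If one were not a
  translation, then \<open>\<phi> g\<close>, \<open>\<phi> \<one>\<close> and
  \<open>g \<otimes> \<phi> \<one>\<close> would be three distinct elements for some
  \<open>g\<close>.\<close>

lemma (in group) edgeless_PDR:
  assumes fin: "finite (carrier G)" and "order G \<le> 2"
  shows "is_PDR 1 G (layered G 1 (\<lambda>_ _. {}))"
proof (rule layered_PDR[where d = 0])
  fix \<sigma> assume \<sigma>: "\<sigma> \<in> digraph_automorphisms (layered G 1 (\<lambda>_ _. {}))"
  note bij = layered_AutD(1)[OF \<sigma>]
  define \<phi> where "\<phi> g = fst (\<sigma> (g, 0))" for g
  have \<phi>: "\<sigma> (g, 0) = (\<phi> g, 0)" "\<phi> g \<in> carrier G" if "g \<in> carrier G" for g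
    using bij_betw_apply[OF bij, of "(g, 0)"] that by (auto simp: \<phi>_def)
  have "\<phi> g = g \<otimes> \<phi> \<one>" if g: "g \<in> carrier G" for g
  proof (rule ccontr)
    assume ne: "\<phi> g \<noteq> g \<otimes> \<phi> \<one>"
    then have "g \<noteq> \<one>" using \<phi> by auto
    then have "\<phi> g \<noteq> \<phi> \<one>"
      using inj_onD[OF bij_betw_imp_inj_on[OF bij], of "(g, 0)" "(\<one>, 0)"] \<phi> g by auto
    moreover have "g \<otimes> \<phi> \<one> \<noteq> \<phi> \<one>" using \<phi> g \<open>g \<noteq> \<one>\<close> by simp
    ultimately have "card {\<phi> g, \<phi> \<one>, g \<otimes> \<phi> \<one>} = 3" using ne by auto
    moreover have "card {\<phi> g, \<phi> \<one>, g \<otimes> \<phi> \<one>} \<le> order G"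
      unfolding order_def using \<phi> g fin by (intro card_mono) auto
    ultimately show False using assms(2) by simp
  qed
  then have "\<sigma> (g, i) = (g \<otimes> \<phi> \<one>, i)" if "g \<in> carrier G" "i < 1" for g i
    using \<phi>(1)[of g] that by (metis less_one)
  then show "\<exists>a\<in>carrier G. \<forall>g\<in>carrier G. \<forall>i<1. \<sigma> (g, i) = (g \<otimes> a, i)"
    using \<phi>(2)[OF one_closed] by blast
qed (use fin in auto)

text \<open>The permutation of the group induced by an automorphism that exchanges the two
  layers.\<close>

definition swap_perm :: "('g, 'm) monoid_scheme \<Rightarrow> 'g set \<Rightarrow> 'g set \<Rightarrow> ('g \<Rightarrow> 'g) \<Rightarrow> bool" where
  "swap_perm G F B \<phi> \<longleftrightarrow> bij_betw \<phi> (carrier G) (carrier G) \<and>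
     (\<forall>g\<in>carrier G. \<forall>h\<in>carrier G.
        (\<phi> h \<otimes>\<^bsub>G\<^esub> inv\<^bsub>G\<^esub> \<phi> g \<in> B \<longleftrightarrow> h \<otimes>\<^bsub>G\<^esub> inv\<^bsub>G\<^esub> g \<in> F) \<and>
        (\<phi> h \<otimes>\<^bsub>G\<^esub> inv\<^bsub>G\<^esub> \<phi> g \<in> F \<longleftrightarrow> h \<otimes>\<^bsub>G\<^esub> inv\<^bsub>G\<^esub> g \<in> B))"

lemma (in group) swap_perm_recentre:
  assumes "swap_perm G F B \<phi>" "g \<in> carrier G"
  shows "swap_perm G F B (\<lambda>h. \<phi> (h \<otimes> g) \<otimes> inv (\<phi> g))"
proof -
  have bij: "bij_betw \<phi> (carrier G) (carrier G)" using assms by (simp add: swap_perm_def)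
  then have "\<phi> h \<in> carrier G" if "h \<in> carrier G" for h using that by (rule bij_betw_apply)
  then show ?thesis
    using bij_betw_recentre[OF bij assms(2)] assms
    by (auto simp: swap_perm_def quot_right_shift)
qed

text \<open>Two exchanges cancel to a colour permutation, to which rigidity applies; any two
  exchanges fixing \<open>\<one>\<close> can thus be compared.\<close>

lemma (in group) swap_perm_quot:
  assumes "swap_perm G F B \<phi>" "swap_perm G F B \<psi>"
  shows "colour_perm G {F, B} (inv_into (carrier G) \<phi> \<circ> \<psi>)"
proof -
  let ?i = "inv_into (carrier G) \<phi>"
  have b: "bij_betw \<phi> (carrier G) (carrier G)" "bij_betw \<psi> (carrier G) (carrier G)"
    using assms by (auto simp: swap_perm_def)
  have bi: "bij_betw ?i (carrier G) (carrier G)" using b(1) by (rule bij_betw_inv_into)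
  have bc: "bij_betw (?i \<circ> \<psi>) (carrier G) (carrier G)" by (rule bij_betw_trans[OF b(2) bi])
  have "\<phi> (?i (\<psi> g)) = \<psi> g" "?i (\<psi> g) \<in> carrier G" if "g \<in> carrier G" for g
    using b bi that by (auto simp: bij_betw_inv_into_right bij_betw_apply)
  then show ?thesis
    unfolding colour_perm_def using bc assms unfolding swap_perm_def by (auto; metis)
qed

text \<open>The identity lies in both directions, so that each fibre is a digon; \<open>F\<close>
  and \<open>B\<close> carry the remaining structure.\<close>

definition haar_conn ::
  "('g, 'm) monoid_scheme \<Rightarrow> 'g set \<Rightarrow> 'g set \<Rightarrow> nat \<Rightarrow> nat \<Rightarrow> 'g set" where
  "haar_conn G F B i j =
     (if i = 0 \<and> j = 1 then insert \<one>\<^bsub>G\<^esub> F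
      else if i = 1 \<and> j = 0 then insert \<one>\<^bsub>G\<^esub> B else {})"

text \<open>By \<open>dig\<close> the only digons are the fibres, so automorphisms permute fibres.
  Those that keep the layers are translations by \<open>local\<close>. An exchange of the layers
  would, after recentring, be a group automorphism contradicting \<open>noswap\<close>.\<close>

lemma (in group) haar_PDR:
  assumes fin: "finite (carrier G)" and FB: "F \<subseteq> carrier G" "B \<subseteq> carrier G"
    and one: "\<one> \<notin> F" "\<one> \<notin> B" and card: "card F = card B"
    and dig: "\<And>s. s \<in> F \<Longrightarrow> inv s \<notin> B"
    and gen: "generate G F = carrier G"
    and local: "\<And>\<psi> y. colour_perm G {F, B} \<psi> \<Longrightarrow> \<psi> \<one> = \<one> \<Longrightarrow> y \<in> F \<Longrightarrow> \<psi> y = y"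
    and noswap: "\<And>\<psi>. \<psi> \<in> hom G G \<Longrightarrow> inj_on \<psi> (carrier G) \<Longrightarrow> \<psi> ` F = B \<Longrightarrow> \<psi> ` B = F \<Longrightarrow> False"
  shows "is_PDR 2 G (layered G 2 (haar_conn G F B))"
proof (rule layered_PDR[where d = "Suc (card F)"])
  let ?R = "haar_conn G F B" and ?D = "layered G 2 (haar_conn G F B)"
  let ?V = "carrier G \<times> {..<2::nat}"
  have finFB: "finite F" "finite B" using FB fin finite_subset by blast+
  have two: "{..<2} = {0, 1::nat}" by auto
  show "finite (carrier G)" "(1::nat) \<le> 2" using fin by auto
  show "?R i j \<subseteq> carrier G" "?R i i = {}" for i j using FB by (auto simp: haar_conn_def)
  show "(\<Sum>j<2. card (?R i j)) = Suc (card F)" if "i < 2" for i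
    using that one card finFB by (auto simp: two haar_conn_def less_2_cases_iff)
  show "(\<Sum>i<2. card (?R i j)) = Suc (card F)" if "j < 2" for j
    using that one card finFB by (auto simp: two haar_conn_def less_2_cases_iff)
  fix \<sigma> assume \<sigma>: "\<sigma> \<in> digraph_automorphisms ?D"
  note bij = layered_AutD(1)[OF \<sigma>] and arc = layered_AutD(2)[OF \<sigma>]
  have quot1: "h \<otimes> inv g = \<one> \<longleftrightarrow> h = g" if "g \<in> carrier G" "h \<in> carrier G" for g h
    using that by (simp add: inv_solve_right')
  have fw: "((g, 0), (h, 1)) \<in> parcs ?D \<longleftrightarrow> h = g \<or> h \<otimes> inv g \<in> F"
    and bw: "((g, 1), (h, 0)) \<in> parcs ?D \<longleftrightarrow> h = g \<or> h \<otimes> inv g \<in> B"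
    if "g \<in> carrier G" "h \<in> carrier G" for g h
    using that by (auto simp: haar_conn_def quot1)
  have same: "((g, i), (h, i)) \<notin> parcs ?D" for g h i by (auto simp: haar_conn_def)
  have dig': "h = g" if "((g, i), (h, j)) \<in> parcs ?D" "((h, j), (g, i)) \<in> parcs ?D" for g h i j
  proof -
    have gh: "g \<in> carrier G" "h \<in> carrier G" using that by auto
    have inv: "inv (h \<otimes> inv g) = g \<otimes> inv h" using gh by (simp add: inv_mult_group)
    have inv': "inv (g \<otimes> inv h) = h \<otimes> inv g" using gh by (simp add: inv_mult_group)
    from that have "(i = 0 \<and> j = 1) \<or> (i = 1 \<and> j = 0)" by (auto simp: haar_conn_def split: if_splits)
    then show ?thesis
    proof (elim disjE conjE)
      assume "i = 0" "j = 1"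
      then show ?thesis
        using that fw[OF gh] bw[OF gh(2,1)] dig[of "h \<otimes> inv g"] by (auto simp: inv)
    next
      assume "i = 1" "j = 0"
      then show ?thesis
        using that bw[OF gh] fw[OF gh(2,1)] dig[of "g \<otimes> inv h"] by (auto simp: inv')
    qed
  qed
  define \<phi> where "\<phi> g = fst (\<sigma> (g, 0))" for g
  define s where "s g = snd (\<sigma> (g, 0))" for g
  have im0: "\<sigma> (g, 0) = (\<phi> g, s g)" for g by (simp add: \<phi>_def s_def)
  have \<phi>: "\<phi> g \<in> carrier G" "s g < 2" if "g \<in> carrier G" for g
    using bij_betw_apply[OF bij, of "(g, 0)"] that by (auto simp: im0)
  have im1: "\<sigma> (g, 1) = (\<phi> g, 1 - s g)" if g: "g \<in> carrier G" for g
  proof -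
    obtain h j where hj: "\<sigma> (g, 1) = (h, j)" "j < 2"
      using bij_betw_apply[OF bij, of "(g, 1)"] g by (cases "\<sigma> (g, 1)") auto
    have "(\<sigma> (g, 0), \<sigma> (g, 1)) \<in> parcs ?D" "(\<sigma> (g, 1), \<sigma> (g, 0)) \<in> parcs ?D"
      using arc[of "(g, 0)" "(g, 1)"] arc[of "(g, 1)" "(g, 0)"] fw[OF g g] bw[OF g g] g by auto
    then have a: "((\<phi> g, s g), (h, j)) \<in> parcs ?D" "((h, j), (\<phi> g, s g)) \<in> parcs ?D"
      by (simp_all only: im0 hj)
    then have "h = \<phi> g" by (rule dig')
    moreover have "j \<noteq> s g" using a same by metis
    then have "j = 1 - s g" using hj(2) \<phi>(2)[OF g] by auto
    ultimately show ?thesis using hj by simp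
  qed
  \<comment> \<open>If the layer of the image changed along an arc given by \<open>F\<close>, the
    image of the arc would lie inside one layer. As \<open>F\<close> generates the group,
    \<open>s\<close> is constant.\<close>
  have step: "s (f \<otimes> g) = s g" if f: "f \<in> F" and g: "g \<in> carrier G" for f g
  proof (rule ccontr)
    assume ne: "s (f \<otimes> g) \<noteq> s g"
    have fg: "f \<in> carrier G" "f \<otimes> g \<in> carrier G" using f g FB by auto
    have "((g, 0), (f \<otimes> g, 1)) \<in> parcs ?D" using fw[OF g fg(2)] f g fg by (simp add: m_assoc)
    then have "(\<sigma> (g, 0), \<sigma> (f \<otimes> g, 1)) \<in> parcs ?D" using arc g fg by simp
    then have "((\<phi> g, s g), (\<phi> (f \<otimes> g), 1 - s (f \<otimes> g))) \<in> parcs ?D"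
      by (simp only: im0 im1[OF fg(2)])
    moreover have "1 - s (f \<otimes> g) = s g" using ne \<phi>(2)[OF g] \<phi>(2)[OF fg(2)] by auto
    ultimately show False using same by metis
  qed
  have words: "s (w \<otimes> h) = s h" if "w \<in> generate G F" "h \<in> carrier G" for w h
    using that
  proof (induction arbitrary: h rule: generate.induct)
    case (inv f)
    then have "f \<in> carrier G" using FB by blast
    then show ?case using step[of f "inv f \<otimes> h"] inv by (simp flip: m_assoc)
  next
    case (eng w1 w2)
    then have "w1 \<in> carrier G" "w2 \<in> carrier G" using gen by auto
    then show ?case using eng by (simp add: m_assoc)
  qed (use step in auto)
  have s: "s g = s \<one>" if "g \<in> carrier G" for g using words[of g \<one>] that gen by simp
  have "s \<one> \<noteq> 1"
  proof
    assume s1: "s \<one> = 1"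
    then have im: "\<sigma> (g, 0) = (\<phi> g, 1)" "\<sigma> (g, 1) = (\<phi> g, 0)" if "g \<in> carrier G" for g
      using im0[of g] im1[OF that] s[OF that] s1 by simp_all
    have inj: "inj_on \<phi> (carrier G)"
    proof (rule inj_onI)
      fix g h assume gh: "g \<in> carrier G" "h \<in> carrier G" "\<phi> g = \<phi> h"
      then have "\<sigma> (g, 0) = \<sigma> (h, 0)" using im by simp
      then show "g = h"
        using inj_onD[OF bij_betw_imp_inj_on[OF bij], of "(g, 0)" "(h, 0)"] gh by simp
    qed
    moreover have "\<phi> ` carrier G = carrier G"
      by (rule endo_inj_surj[OF fin _ inj]) (use \<phi> in auto)
    ultimately have b\<phi>: "bij_betw \<phi> (carrier G) (carrier G)" by (simp add: bij_betw_def)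
    have sw: "swap_perm G F B \<phi>"
      unfolding swap_perm_def
    proof (intro conjI ballI b\<phi>)
      fix g h assume gh: "g \<in> carrier G" "h \<in> carrier G"
      have eq: "\<phi> h = \<phi> g \<longleftrightarrow> h = g" using inj gh by (auto dest: inj_onD)
      have q: "h \<otimes> inv g \<notin> F \<and> h \<otimes> inv g \<notin> B" if "h = g" using that gh one by simp
      have q': "\<phi> h \<otimes> inv \<phi> g \<notin> F \<and> \<phi> h \<otimes> inv \<phi> g \<notin> B" if "h = g"
        using that gh one \<phi> by simp
      show "\<phi> h \<otimes> inv \<phi> g \<in> B \<longleftrightarrow> h \<otimes> inv g \<in> F"
        using arc[of "(g, 0)" "(h, 1)"] fw[OF gh] bw[OF \<phi>(1)[OF gh(1)] \<phi>(1)[OF gh(2)]] im gh eq q q'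
        by (cases "h = g") auto
      show "\<phi> h \<otimes> inv \<phi> g \<in> F \<longleftrightarrow> h \<otimes> inv g \<in> B"
        using arc[of "(g, 1)" "(h, 0)"] bw[OF gh] fw[OF \<phi>(1)[OF gh(1)] \<phi>(1)[OF gh(2)]] im gh eq q q'
        by (cases "h = g") auto
    qed
    define a where "a = \<phi> \<one>"
    have a: "a \<in> carrier G" using \<phi> by (simp add: a_def)
    define \<psi> where "\<psi> h = \<phi> h \<otimes> inv a" for h
    have "swap_perm G F B (\<lambda>h. \<phi> (h \<otimes> \<one>) \<otimes> inv \<phi> \<one>)"
      by (rule swap_perm_recentre[OF sw]) simp
    then have sw\<psi>: "swap_perm G F B \<psi>"
      by (simp add: swap_perm_def \<psi>_def a_def cong: bij_betw_cong)
    then have b\<psi>: "bij_betw \<psi> (carrier G) (carrier G)" by (simp add: swap_perm_def)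
    have \<psi>1: "\<psi> \<one> = \<one>" using a by (simp add: \<psi>_def a_def)
    \<comment> \<open>Recentring \<open>\<phi>\<close> at \<open>g\<close> and at
      \<open>\<one>\<close> gives two exchanges fixing \<open>\<one>\<close>; they differ by a
      colour permutation fixing \<open>\<one>\<close>, which is the identity. This independence of
      \<open>g\<close> is what makes \<open>\<psi>\<close> a homomorphism.\<close>
    have rec: "\<phi> (h \<otimes> g) \<otimes> inv (\<phi> g) = \<psi> h" if g: "g \<in> carrier G" and h: "h \<in> carrier G" for g h
    proof -
      let ?c = "inv_into (carrier G) \<psi> \<circ> (\<lambda>h. \<phi> (h \<otimes> g) \<otimes> inv (\<phi> g))"
      have c: "colour_perm G {F, B} ?c"
        by (rule swap_perm_quot[OF sw\<psi> swap_perm_recentre[OF sw g]])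
      have "?c \<one> = \<one>"
        using g \<phi> \<psi>1 b\<psi> by (simp add: bij_betw_def inv_into_f_eq)
      then have "?c h = h" using colour_perm_translation[OF gen _ c h] local h by simp
      moreover have "\<phi> (h \<otimes> g) \<otimes> inv (\<phi> g) \<in> carrier G" using \<phi> g h by simp
      ultimately show ?thesis using b\<psi> by (auto dest: bij_betw_inv_into_right)
    qed
    have hom: "\<psi> \<in> hom G G"
    proof (rule homI)
      fix h g assume hg: "h \<in> carrier G" "g \<in> carrier G"
      then have "\<phi> (h \<otimes> g) = \<psi> h \<otimes> \<phi> g"
        using rec[of g h] \<phi> a by (metis \<psi>_def inv_closed inv_solve_right m_closed)
      then show "\<psi> (h \<otimes> g) = \<psi> h \<otimes> \<psi> g" using hg \<phi> a by (simp add: \<psi>_def m_assoc)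
    qed (use \<phi> a in \<open>simp add: \<psi>_def\<close>)
    have c: "\<psi> h \<in> carrier G" if "h \<in> carrier G" for h using hom that by (auto simp: hom_def)
    have iff: "\<psi> h \<in> B \<longleftrightarrow> h \<in> F" "\<psi> h \<in> F \<longleftrightarrow> h \<in> B" if "h \<in> carrier G" for h
      using sw\<psi> that \<psi>1 c unfolding swap_perm_def by (metis inv_one one_closed r_one)+
    have im: "\<psi> ` carrier G = carrier G" using b\<psi> by (simp add: bij_betw_def)
    have image: "\<psi> ` X = Y"
      if XY: "X \<subseteq> carrier G" "Y \<subseteq> carrier G" "\<And>h. h \<in> carrier G \<Longrightarrow> \<psi> h \<in> Y \<longleftrightarrow> h \<in> X" for X Y
    proof (intro equalityI subsetI)
      fix b assume b: "b \<in> Y"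
      then obtain h where "h \<in> carrier G" "b = \<psi> h" using im XY(2) by blast
      then show "b \<in> \<psi> ` X" using XY(3) b by blast
    qed (use XY in auto)
    show False
      by (rule noswap[OF hom bij_betw_imp_inj_on[OF b\<psi>]
            image[OF FB iff(1)] image[OF FB(2,1) iff(2)]])
  qed
  then have s0: "s g = 0" if "g \<in> carrier G" for g using s[OF that] \<phi>(2)[of \<one>] by auto
  have fibre: "\<sigma> (g, i) = (\<phi> g, i)" if "g \<in> carrier G" "i < 2" for g i
    using that im0[of g] im1[of g] s0 by (auto simp: less_2_cases_iff)
  have cp: "colour_perm G {?R i j | i j. i < 2 \<and> j < 2} \<phi>"
    by (rule fibrewise_colour_perm[OF \<sigma> _ fibre]) auto
  have cp': "colour_perm G {F, B} \<phi>"
  proof -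
    have "\<phi> h \<otimes> inv \<phi> g \<in> F \<longleftrightarrow> h \<otimes> inv g \<in> F" "\<phi> h \<otimes> inv \<phi> g \<in> B \<longleftrightarrow> h \<otimes> inv g \<in> B"
      if gh: "g \<in> carrier G" "h \<in> carrier G" for g h
    proof -
      have eq: "\<phi> h = \<phi> g \<longleftrightarrow> h = g" using colour_permD(2)[OF cp] gh by (auto dest: inj_onD)
      have "\<phi> h \<otimes> inv \<phi> g \<in> ?R i j \<longleftrightarrow> h \<otimes> inv g \<in> ?R i j" if "i < 2" "j < 2" for i j
        using colour_permD(4)[OF cp] that gh by blast
      from this[of 0 1] this[of 1 0]
      show "\<phi> h \<otimes> inv \<phi> g \<in> F \<longleftrightarrow> h \<otimes> inv g \<in> F" "\<phi> h \<otimes> inv \<phi> g \<in> B \<longleftrightarrow> h \<otimes> inv g \<in> B"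
        using quot1 eq \<phi> gh one by (auto simp: haar_conn_def)
    qed
    then show ?thesis using colour_permD(1)[OF cp] by (simp add: colour_perm_def)
  qed
  have "\<phi> g = g \<otimes> \<phi> \<one>" if "g \<in> carrier G" for g
    by (rule colour_perm_translation[OF gen _ cp' that]) (rule local)
  then have "\<sigma> (g, i) = (g \<otimes> \<phi> \<one>, i)" if "g \<in> carrier G" "i < 2" for g i
    using fibre that by metis
  then show "\<exists>a\<in>carrier G. \<forall>g\<in>carrier G. \<forall>i<2. \<sigma> (g, i) = (g \<otimes> a, i)"
    using \<phi>(1)[OF one_closed] by blast
qed

text \<open>The two sets meet in \<open>x 0\<close> alone, which therefore is fixed and starts the
  path. As \<open>x 0\<close> is not an involution, it causes no digon.\<close>

lemma (in group) generators_haar_PDR: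
  assumes fin: "finite (carrier G)" and k: "k \<ge> 2"
    and irr: "irredundant G k x" and gen: "generate G (x ` {..<k}) = carrier G"
    and x0: "x 0 \<otimes> x 0 \<noteq> \<one>"
  shows "is_PDR 2 G (layered G 2 (haar_conn G (x ` {..<k}) (insert (x 0) (steps G k x))))"
proof (rule haar_PDR)
  let ?F = "x ` {..<k}" and ?B = "insert (x 0) (steps G k x)"
  note inj = irredundant_inj[OF irr] and x [simp] = irredundant_closed[OF irr]
  have k0: "0 < k" "1 < k" using k by auto
  have x0c [simp]: "x 0 \<in> carrier G" using k0 by simp
  have x0inv: "x 0 \<noteq> inv (x 0)" using x0 k0 by (metis r_inv x)
  have inv0: "x i \<noteq> inv (x 0)" if "i < k" for i
  proof (cases "i = 0")
    case False
    have "inv (x 0) \<in> generate G (x ` {0})" using generate_image_mem(2)[OF irr, of 0 "{0}"] by simp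
    then show ?thesis using irredundant_notin[OF irr that, of "{0}"] False k0 by auto
  qed (use x0inv in simp)
  show "finite (carrier G)" "?F \<subseteq> carrier G" "?B \<subseteq> carrier G" "generate G ?F = carrier G"
    using fin gen steps_closed[OF irr] k0 by auto
  show "\<one> \<notin> ?F" "\<one> \<notin> ?B"
    using irredundant_not_one[OF irr] one_notin_steps[OF irr] k0 by fastforce+
  have "finite (steps G k x)" using steps_closed[OF irr] fin finite_subset by blast
  then show "card ?F = card ?B"
    using card_image[OF inj] card_steps[OF irr] generator_notin_steps[OF irr k0(1)] k0 by simp
  show "inv s \<notin> ?B" if s: "s \<in> ?F" for s
  proof -
    obtain i where i: "s = x i" "i < k" using s by auto
    then have "inv s \<noteq> x 0" using inv0[OF i(2)] by (metis inv_inv x)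
    moreover have "inv s \<notin> steps G k x"
      using generator_notin_inv_steps[OF irr i(2), of "inv s"] i by auto
    ultimately show ?thesis by blast
  qed
  have FB: "y = x 0" if "y \<in> ?F" "y \<in> ?B" for y
    using that generator_notin_steps[OF irr] by auto
  fix \<psi>
  show "\<psi> y = y" if \<psi>: "colour_perm G {?F, ?B} \<psi>" "\<psi> \<one> = \<one>" and y: "y \<in> ?F" for y
  proof -
    have pres: "\<psi> h \<otimes> inv \<psi> g \<in> R \<longleftrightarrow> h \<otimes> inv g \<in> R"
      if "g \<in> carrier G" "h \<in> carrier G" "R \<in> {?F, ?B}" for g h R
      using colour_permD(4)[OF \<psi>(1) that(3,1,2)] .
    have pres1: "\<psi> h \<in> R \<longleftrightarrow> h \<in> R" if "h \<in> carrier G" "R \<in> {?F, ?B}" for h R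
      using pres[OF one_closed that] that \<psi>(2) colour_permD(3)[OF \<psi>(1)] by simp
    have im: "\<psi> (x i) \<in> x ` {..<k}" if "i < k" for i
      using pres1[of "x i" ?F] that by simp
    have start: "\<psi> (x 0) = x 0"
      using FB[OF im[OF k0(1)]] pres1[of "x 0" ?B] by simp
    obtain i where i: "y = x i" "i < k" using y by auto
    have "\<psi> (x i) = x i"
    proof (rule path_fixed[OF irr im colour_permD(2)[OF \<psi>(1)] start])
      show "\<psi> (x j) \<otimes> inv \<psi> (x i) \<in> ?B \<longleftrightarrow> x j \<otimes> inv x i \<in> ?B" if "i < k" "j < k" for i j
        by (rule pres) (use that in auto)
      show "j = Suc i \<or> i = Suc j" if "i < k" "j < k" "i \<noteq> j" "x j \<otimes> inv x i \<in> ?B" for i j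
        using generator_ne_quot[OF irr k0(1), of i j] steps_edge[OF irr] that by auto
    qed (use i in auto)
    then show ?thesis using i by simp
  qed
  assume hom: "\<psi> \<in> hom G G" and inj\<psi>: "inj_on \<psi> (carrier G)" and im: "\<psi> ` ?F = ?B" "\<psi> ` ?B = ?F"
  have "x 0 \<in> ?F" using k0 by blast
  then have "\<psi> (x 0) \<in> ?B" unfolding im(1)[symmetric] by blast
  moreover have "\<psi> (x 0) \<in> ?F" unfolding im(2)[symmetric] by blast
  ultimately have \<psi>0: "\<psi> (x 0) = x 0" by (intro FB)
  have "x 1 \<in> ?F" using k0 by blast
  then have "\<psi> (x 1) \<in> ?B" unfolding im(1)[symmetric] by blast
  moreover have "\<psi> (x 1) \<noteq> x 0"
  proof
    assume "\<psi> (x 1) = x 0"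
    then have "x 1 = x 0" using \<psi>0 inj_onD[OF inj\<psi>, of "x 1" "x 0"] k0 by simp
    then show False using inj_onD[OF inj, of 1 0] k0 by simp
  qed
  ultimately obtain l where l: "Suc l < k" "\<psi> (x 1) = x (Suc l) \<otimes> inv (x l)"
    by (auto simp: steps_def)
  \<comment> \<open>An exchange sends the generator \<open>x 1\<close> to a step and the step
    \<open>x 1 \<otimes> inv (x 0)\<close> to a generator \<open>x m\<close>. Comparing the two
    expresses \<open>x (Suc l)\<close> by \<open>x m\<close>, \<open>x 0\<close> and
    \<open>x l\<close>, against irredundance unless \<open>m = Suc l\<close>; in that case
    \<open>x l\<close> is the inverse of \<open>x 0\<close>.\<close>
  have "\<psi> (x 1) = \<psi> ((x 1 \<otimes> inv (x 0)) \<otimes> x 0)" using k0 by (simp add: m_assoc)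
  also have "\<dots> = \<psi> (x 1 \<otimes> inv (x 0)) \<otimes> \<psi> (x 0)" using k0 by (intro hom_mult[OF hom]) auto
  finally have e: "\<psi> (x 1) = \<psi> (x 1 \<otimes> inv (x 0)) \<otimes> x 0" by (simp add: \<psi>0)
  have "x 1 \<otimes> inv (x 0) \<in> ?B" using k0 by (auto simp: steps_def)
  then have "\<psi> (x 1 \<otimes> inv (x 0)) \<in> ?F" unfolding im(2)[symmetric] by blast
  then obtain m where m: "m < k" "\<psi> (x 1 \<otimes> inv (x 0)) = x m" by auto
  have lc: "x l \<in> carrier G" "x (Suc l) \<in> carrier G" "x m \<in> carrier G" using l m by auto
  have "x (Suc l) \<otimes> inv (x l) = x m \<otimes> x 0" using e l m by simp
  then have eq: "x (Suc l) = x m \<otimes> x 0 \<otimes> x l" using lc k0 by (simp add: inv_solve_right')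
  show False
  proof (cases "m = Suc l")
    case True
    then have "x 0 \<otimes> x l = \<one>" using eq lc k0 by (simp add: m_assoc)
    then have "x l = inv (x 0)" using lc k0 inv_equality[of "x 0" "x l"]
      by (metis inv_inv x)
    then show False using inv0 l by simp
  next
    case False
    have "x (Suc l) \<in> generate G (x ` {0, l, m})"
      unfolding eq by (intro generate.eng generate_image_mem[OF irr]) auto
    then show False using irredundant_notin[OF irr l(1), of "{0, l, m}"] False l m by auto
  qed
qed

text \<open>Both dangers mean that the cube of \<open>x\<close> is trivial: a digon off the fibres
  makes \<open>x \<otimes> x\<close> the inverse of \<open>x\<close>, and an exchange gives that
  \<open>x\<close> equals its fourth power.\<close>

lemma (in group) cyclic_haar_PDR:
  assumes fin: "finite (carrier G)" and x: "x \<in> carrier G" and gen: "generate G {x} = carrier G"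
    and "order G \<ge> 4"
  shows "is_PDR 2 G (layered G 2 (haar_conn G {x} {x \<otimes> x}))"
proof (rule haar_PDR)
  have "ord x = order G" using generate_pow_card[OF x] gen by (simp add: order_def)
  moreover have "ord x \<le> m" if "x [^] m = \<one>" "m > 0" for m
    using pow_eq_id[OF x, of m] that by (auto intro: dvd_imp_le)
  ultimately have pow: "x [^] m \<noteq> \<one>" if "0 < m" "m < 4" for m :: nat
    using assms(4) that by (metis leD order.strict_trans2)
  have p: "x \<noteq> \<one>" "x \<otimes> x \<noteq> \<one>" "x \<otimes> (x \<otimes> x) \<noteq> \<one>"
    using pow[of 1] pow[of 2] pow[of 3] x by (simp_all add: numeral_eq_Suc m_assoc)
  show "finite (carrier G)" "{x} \<subseteq> carrier G" "{x \<otimes> x} \<subseteq> carrier G" "generate G {x} = carrier G"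
    "\<one> \<notin> {x}" "\<one> \<notin> {x \<otimes> x}" "card {x} = card {x \<otimes> x}"
    using fin x gen p by auto
  show "inv s \<notin> {x \<otimes> x}" if "s \<in> {x}" for s
    using that p(3) x by auto (metis m_assoc r_inv)
  fix \<psi>
  show "\<psi> y = y" if "colour_perm G {{x}, {x \<otimes> x}} \<psi>" "\<psi> \<one> = \<one>" "y \<in> {x}" for y
    using colour_permD(4)[OF that(1), of "{x}" \<one> x] colour_permD(3)[OF that(1) x] that x by simp
  assume hom: "\<psi> \<in> hom G G" and "\<psi> ` {x} = {x \<otimes> x}" "\<psi> ` {x \<otimes> x} = {x}"
  then have "x = (x \<otimes> x) \<otimes> (x \<otimes> x)" using hom_mult[OF hom x x] by simp
  then have "x \<otimes> (x \<otimes> (x \<otimes> x)) = x" using x by (simp add: m_assoc)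
  then show False using p(3) x by simp
qed

section \<open>Elementary abelian 2-groups of rank at least four\<close>

text \<open>The vector space of dimension \<open>k\<close> over the field of order 2, as sets under
  symmetric difference. Singletons are the basis, steps are pairs of consecutive numbers, and
  coincidences become statements about small sets.\<close>

definition subset_group :: "nat \<Rightarrow> nat set monoid" where
  "subset_group k =
     \<lparr>carrier = Pow {..<k}, monoid.mult = (\<lambda>A B. (A - B) \<union> (B - A)), one = {}\<rparr>"

lemma subset_group_simps [simp]:
  "carrier (subset_group k) = Pow {..<k}"
  "\<one>\<^bsub>subset_group k\<^esub> = {}"
  "A \<otimes>\<^bsub>subset_group k\<^esub> B = (A - B) \<union> (B - A)"
  by (simp_all add: subset_group_def)

lemma group_subset_group: "group (subset_group k)"
proof (rule groupI)
  fix A assume "A \<in> carrier (subset_group k)"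
  then show "\<exists>B\<in>carrier (subset_group k). B \<otimes>\<^bsub>subset_group k\<^esub> A = \<one>\<^bsub>subset_group k\<^esub>"
    by (intro bexI[of _ A]) auto
qed auto

lemma inv_subset_group [simp]: "A \<subseteq> {..<k} \<Longrightarrow> inv\<^bsub>subset_group k\<^esub> A = A"
  by (rule group.inv_equality[OF group_subset_group]) auto

lemma subset_group_irredundant: "irredundant (subset_group k) k (\<lambda>i. {i})"
proof -
  have "generate (subset_group k) ((\<lambda>i. {i}) ` ({..<k} - {i})) \<subseteq> Pow ({..<k} - {i})" for i
  proof
    fix A assume "A \<in> generate (subset_group k) ((\<lambda>i. {i}) ` ({..<k} - {i}))"
    then show "A \<in> Pow ({..<k} - {i})" by (induction rule: generate.induct) auto
  qed
  then show ?thesis unfolding irredundant_def by fastforce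
qed

lemma subset_group_generate: "generate (subset_group k) ((\<lambda>i. {i}) ` {..<k}) = Pow {..<k}"
proof
  show "generate (subset_group k) ((\<lambda>i. {i}) ` {..<k}) \<subseteq> Pow {..<k}"
    using group.generate_incl[OF group_subset_group, of "(\<lambda>i. {i}) ` {..<k}" k] by auto
  have "A \<in> generate (subset_group k) ((\<lambda>i. {i}) ` {..<k})" if "finite A" "A \<subseteq> {..<k}" for A
    using that
  proof (induction A rule: finite_induct)
    case empty
    then show ?case using generate.one[of "subset_group k"] by simp
  next
    case (insert a A)
    have "{a} \<otimes>\<^bsub>subset_group k\<^esub> A \<in> generate (subset_group k) ((\<lambda>i. {i}) ` {..<k})"
      using insert by (intro generate.eng[OF generate.incl]) auto
    then show ?case using insert by simp
  qed
  then show "Pow {..<k} \<subseteq> generate (subset_group k) ((\<lambda>i. {i}) ` {..<k})"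
    using finite_subset by blast
qed

text \<open>One point remains only if the pair lies inside the triple, which leaves
  \<open>{0, 1}\<close> and \<open>{1, 2}\<close>.\<close>

lemma triple_minus_pair:
  fixes i l :: nat
  assumes e: "{i} = ({0, 1, 2} - {l, Suc l}) \<union> ({l, Suc l} - {0, 1, 2})"
  shows "i = 0 \<or> i = 2"
proof -
  consider "l = 0" | "l = 1" | "l \<ge> 2" by linarith
  then show ?thesis
  proof cases
    case 1
    have "2 \<in> {i}" unfolding e using 1 by simp
    then show ?thesis by simp
  next
    case 2
    have "0 \<in> {i}" unfolding e using 2 by simp
    then show ?thesis by simp
  next
    case 3
    have "0 \<in> {i}" "1 \<in> {i}" unfolding e using 3 by simp_all
    then show ?thesis by simp
  qed
qed

text \<open>The symmetric difference of two pairs has even size.\<close>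

lemma pair_minus_pair:
  fixes a l m :: nat
  assumes e: "{a} = ({l, Suc l} - {m, Suc m}) \<union> ({m, Suc m} - {l, Suc l})"
  shows False
proof -
  consider "l = m" | "l = Suc m" | "m = Suc l" | "l \<noteq> m" "l \<noteq> Suc m" "m \<noteq> Suc l" by blast
  then show ?thesis
  proof cases
    case 1
    have "a \<in> {a}" by simp
    then show False unfolding e using 1 by simp
  next
    case 2
    have "m \<in> {a}" "Suc l \<in> {a}" unfolding e using 2 by simp_all
    then show False using 2 by simp
  next
    case 3
    have "l \<in> {a}" "Suc m \<in> {a}" unfolding e using 3 by simp_all
    then show False using 3 by simp
  next
    case 4
    have "l \<in> {a}" "Suc l \<in> {a}" unfolding e using 4 by simp_all
    then show False by simp
  qed
qed

text \<open>
  All coincidences between the two connection sets come from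
  \<open>{0} + {1} + {2} = {0, 1, 2}\<close>: only \<open>{0}\<close> and \<open>{2}\<close> have an out-neighbour in the second set
  among the members of that set.
\<close>

lemma subset_group_haar_PDR:
  assumes k: "k \<ge> 4"
  defines "x \<equiv> \<lambda>i::nat. {i}"
  shows "is_PDR 2 (subset_group k) (layered (subset_group k) 2
    (haar_conn (subset_group k) (x ` {..<k}) (insert {0, 1, 2} (steps (subset_group k) k x))))"
proof -
  let ?G = "subset_group k"
  define F where "F = x ` {..<k}"
  define B where "B = insert {0, 1, 2} (steps ?G k x)"
  interpret group ?G by (rule group_subset_group)
  have irr: "irredundant ?G k x" using subset_group_irredundant by (simp add: x_def)
  have steps: "steps ?G k x = {{l, Suc l} | l. Suc l < k}"
    unfolding steps_def by (intro Collect_cong ex_cong1) (auto simp: x_def)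
  have F_iff: "A \<in> F \<longleftrightarrow> (\<exists>i<k. A = {i})" for A by (auto simp: F_def x_def)
  have B_iff: "A \<in> B \<longleftrightarrow> A = {0, 1, 2} \<or> (\<exists>l. Suc l < k \<and> A = {l, Suc l})" for A
    by (auto simp: B_def steps)
  have "{1, Suc 1} \<in> B" unfolding B_iff using k by (intro disjI2 exI[of _ 1]) auto
  moreover have "{2, Suc 2} \<in> B" unfolding B_iff using k by (intro disjI2 exI[of _ 2]) auto
  ultimately have B12: "{1, 2} \<in> B" "{2, 3} \<in> B" by (simp_all add: numeral_eq_Suc)
  have Bsub: "A \<subseteq> {..<k}" if "A \<in> B" for A
    using that k unfolding B_iff by auto
  have cB: "card A = 2 \<or> A = {0, 1, 2}" if "A \<in> B" for A using that unfolding B_iff by auto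
  have FB: "A \<notin> B" if "A \<in> F" for A using that by (auto simp: F_iff B_iff doubleton_eq_iff)
  have pairB: "j = Suc i \<or> i = Suc j" if ij: "i \<noteq> j" "{i, j} \<in> B" for i j
  proof -
    have "card {i, j} = 2" using ij by simp
    then have "{i, j} \<noteq> {0, 1, 2}" by force
    then obtain l where "{i, j} = {l, Suc l}" using ij by (auto simp: B_iff)
    then show ?thesis by (auto simp: doubleton_eq_iff)
  qed
  show ?thesis unfolding F_def[symmetric] B_def[symmetric]
  proof (rule haar_PDR)
    show "finite (carrier ?G)" "F \<subseteq> carrier ?G" "B \<subseteq> carrier ?G" "generate ?G F = carrier ?G"
      using Bsub subset_group_generate by (auto simp: F_def x_def)
    show "\<one>\<^bsub>?G\<^esub> \<notin> F" "\<one>\<^bsub>?G\<^esub> \<notin> B" by (auto simp: F_iff B_iff)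
    have "{0, 1, 2} \<notin> steps ?G k x"
    proof
      assume "{0, 1, 2} \<in> steps ?G k x"
      then obtain l where "{0, 1, 2} = {l, Suc l}" by (auto simp: steps)
      then have "card {0, 1, 2::nat} = card {l, Suc l}" by simp
      then show False by simp
    qed
    moreover have "finite (steps ?G k x)" 
      using steps_closed[OF irr] finite_subset[of _ "Pow {..<k}"] by simp
    ultimately show "card F = card B"
      unfolding F_def B_def
      using card_image[OF irredundant_inj[OF irr]] card_steps[OF irr] k by simp
    show "inv\<^bsub>?G\<^esub> s \<notin> B" if "s \<in> F" for s
    proof -
      have "inv\<^bsub>?G\<^esub> s = s" using that by (auto simp: F_iff)
      then show ?thesis using FB[OF that] by simp
    qed
    fix \<psi>
    show "\<psi> y = y" if \<psi>: "colour_perm ?G {F, B} \<psi>" "\<psi> \<one>\<^bsub>?G\<^esub> = \<one>\<^bsub>?G\<^esub>" and y: "y \<in> F" for y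
    proof -
      have c: "\<psi> A \<subseteq> {..<k}" if "A \<subseteq> {..<k}" for A
        using colour_permD(3)[OF \<psi>(1), of A] that by simp
      have pres: "\<psi> C \<otimes>\<^bsub>?G\<^esub> \<psi> A \<in> R \<longleftrightarrow> C \<otimes>\<^bsub>?G\<^esub> A \<in> R"
        if "A \<subseteq> {..<k}" "C \<subseteq> {..<k}" "R \<in> {F, B}" for A C R
        using colour_permD(4)[OF \<psi>(1) that(3), of A C] that c by simp
      have pres1: "\<psi> A \<in> R \<longleftrightarrow> A \<in> R" if "A \<subseteq> {..<k}" "R \<in> {F, B}" for A R
        using pres[of "{}" A R] that \<psi>(2) by simp
      have im: "\<psi> (x i) \<in> x ` {..<k}" if "i < k" for i
        using pres1[of "x i" F] that by (simp add: F_def x_def)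
      \<comment> \<open>Sets that differ in one point have sizes of different parity, so one of the
        two is the triple and the other a pair.\<close>
      have mark: "i = 0 \<or> i = 2" if A: "A \<in> B" "A \<otimes>\<^bsub>?G\<^esub> {i} \<in> B" for A i
      proof -
        let ?A = "A \<otimes>\<^bsub>?G\<^esub> {i}"
        have eq: "{i} = (A - ?A) \<union> (?A - A)" by auto
        have odd: False if "card A = 2" "card ?A = 2"
        proof (cases "i \<in> A")
          case True
          then have "?A = A - {i}" by auto
          then show False using that True by simp
        next
          case False
          then have "?A = insert i A" by auto
          moreover have "finite A" using that(1) card.infinite by fastforce
          ultimately show False using that False by simp
        qed
        consider "A = {0, 1, 2}" "?A = {0, 1, 2}" | "A = {0, 1, 2}" "card ?A = 2"
          | "?A = {0, 1, 2}" "card A = 2" using cB[OF A(1)] cB[OF A(2)] odd by blast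
        then show ?thesis
        proof cases
          case 1 then show ?thesis using eq by auto
        next
          case 2
          then obtain l where "?A = {l, Suc l}" using A(2) by (auto simp: B_iff)
          then have "{i} = ({0, 1, 2} - {l, Suc l}) \<union> ({l, Suc l} - {0, 1, 2})"
            using eq 2 by simp
          then show ?thesis by (rule triple_minus_pair)
        next
          case 3
          then obtain l where "A = {l, Suc l}" using A(1) by (auto simp: B_iff)
          then have "{i} = ({0, 1, 2} - {l, Suc l}) \<union> ({l, Suc l} - {0, 1, 2})"
            using eq 3 by auto
          then show ?thesis by (rule triple_minus_pair)
        qed
      qed
      obtain i where i: "i < k" "\<psi> {0} = {i}" using im[of 0] k by (auto simp: x_def)
      \<comment> \<open>\<open>{1, 2}\<close> is a member of \<open>B\<close> joined to
        \<open>{0}\<close> by the triple. The image of \<open>{0}\<close> has such a neighbour too,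
        and \<open>mark\<close> leaves two candidates.\<close>
      have "{1, 2} \<otimes>\<^bsub>?G\<^esub> {0} = {0, 1, 2}" by auto
      then have "{1, 2} \<otimes>\<^bsub>?G\<^esub> {0} \<in> B" "{1, 2} \<in> B" using B12(1) B_iff by auto
      then have "\<psi> {1, 2} \<otimes>\<^bsub>?G\<^esub> {i} \<in> B" "\<psi> {1, 2} \<in> B"
        using pres[of "{0}" "{1, 2}" B] pres1[of "{1, 2}" B] k i by auto
      then have "i = 0 \<or> i = 2" by (intro mark)
      moreover have "i \<noteq> 2"
      proof
        assume i2: "i = 2"
        \<comment> \<open>The two candidates differ in their neighbours among the singletons:
          \<open>{2}\<close> is joined to \<open>{1}\<close> and \<open>{3}\<close>, but
          \<open>{0}\<close> only to \<open>{1}\<close>. The neighbour \<open>{3}\<close> exists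
          because \<open>k\<close> is at least 4.\<close>
        have "A = {1}" if A: "A \<subseteq> {..<k}" "\<psi> A = {j}" "j = 1 \<or> j = 3" for A j
        proof -
          have "{j} \<in> F" using A(3) k by (auto simp: F_iff)
          then have "A \<in> F" using pres1[OF A(1), of F] A(2) by simp
          then obtain a where a: "A = {a}" "a < k" by (auto simp: F_iff)
          have "{1} \<otimes>\<^bsub>?G\<^esub> {2} = {1, 2}" "{3} \<otimes>\<^bsub>?G\<^esub> {2} = {2, 3}" by auto
          then have "{j} \<otimes>\<^bsub>?G\<^esub> {i} \<in> B" using B12 A(3) i2 by metis
          then have "{a} \<otimes>\<^bsub>?G\<^esub> {0} \<in> B" using pres[of "{0}" "{a}" B] a A(2) i k by simp
          moreover have "a \<noteq> 0"
          proof
            assume "a = 0"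
            then show False using a A(2,3) i i2 by auto
          qed
          then have "{a} \<otimes>\<^bsub>?G\<^esub> {0} = {0, a}" by auto
          ultimately show "A = {1}" using pairB[of 0 a] \<open>a \<noteq> 0\<close> a by auto
        qed
        moreover have "\<psi> ` Pow {..<k} = Pow {..<k}"
          using colour_permD(1)[OF \<psi>(1)] by (simp add: bij_betw_def)
        then have "{1} \<in> \<psi> ` Pow {..<k}" "{3} \<in> \<psi> ` Pow {..<k}" using k by auto
        then obtain A C where AC: "A \<subseteq> {..<k}" "\<psi> A = {1}" "C \<subseteq> {..<k}" "\<psi> C = {3}" by force
        ultimately have "A = C" by metis
        then show False using AC by simp
      qed
      ultimately have start: "\<psi> (x 0) = x 0" using i by (simp add: x_def)
      obtain i where i: "y = x i" "i < k" using y by (auto simp: F_def)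
      have "\<psi> (x i) = x i"
      proof (rule path_fixed[OF irr im colour_permD(2)[OF \<psi>(1)] start])
        show "\<psi> (x j) \<otimes>\<^bsub>?G\<^esub> inv\<^bsub>?G\<^esub> \<psi> (x i) \<in> B \<longleftrightarrow> x j \<otimes>\<^bsub>?G\<^esub> inv\<^bsub>?G\<^esub> x i \<in> B"
          if "i < k" "j < k" for i j
          using colour_permD(4)[OF \<psi>(1), of B "x i" "x j"] that by (simp add: x_def)
        show "j = Suc i \<or> i = Suc j"
          if ij: "i < k" "j < k" "i \<noteq> j" "x j \<otimes>\<^bsub>?G\<^esub> inv\<^bsub>?G\<^esub> x i \<in> B" for i j
        proof -
          have "x j \<otimes>\<^bsub>?G\<^esub> inv\<^bsub>?G\<^esub> x i = {i, j}" using ij by (auto simp: x_def)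
          then show ?thesis using pairB ij by metis
        qed
      qed (use i in \<open>auto simp: B_def\<close>)
      then show ?thesis using i by simp
    qed
    assume hom: "\<psi> \<in> hom ?G ?G" and inj: "inj_on \<psi> (carrier ?G)"
      and im: "\<psi> ` F = B" "\<psi> ` B = F"
    \<comment> \<open>Otherwise both images are pairs, while their sum, the image of a step, would
      be a singleton. Applied to the disjoint pairs starting at 0 and at 2, this yields two
      singletons with the same image.\<close>
    have top: "\<psi> {i} = {0, 1, 2} \<or> \<psi> {Suc i} = {0, 1, 2}" if i: "Suc i < k" for i
    proof (rule ccontr)
      assume no: "\<not> ?thesis"
      have "{i} \<in> F" "{Suc i} \<in> F" using i by (auto simp: F_iff)
      then have "\<psi> {i} \<in> B" "\<psi> {Suc i} \<in> B" unfolding im(1)[symmetric] by blast+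
      then obtain l m where lm: "\<psi> {i} = {l, Suc l}" "\<psi> {Suc i} = {m, Suc m}"
        using no by (auto simp: B_iff)
      have "{i, Suc i} \<in> B" using i by (auto simp: B_iff)
      then have "\<psi> {i, Suc i} \<in> F" unfolding im(2)[symmetric] by blast
      then obtain a where a: "\<psi> {i, Suc i} = {a}" by (auto simp: F_iff)
      have pair: "{i, Suc i} = {i} \<otimes>\<^bsub>?G\<^esub> {Suc i}" by auto
      have "\<psi> {i, Suc i} = \<psi> {i} \<otimes>\<^bsub>?G\<^esub> \<psi> {Suc i}"
        unfolding pair by (rule hom_mult[OF hom]) (use i in auto)
      then have "{a} = ({l, Suc l} - {m, Suc m}) \<union> ({m, Suc m} - {l, Suc l})" using a lm by simp
      then show False by (rule pair_minus_pair)
    qed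
    have inj': "i = j" if "\<psi> {i} = \<psi> {j}" "i < k" "j < k" for i j
      using inj_onD[OF inj that(1)] that by simp
    have "\<psi> {0} = {0, 1, 2} \<or> \<psi> {Suc 0} = {0, 1, 2}" "\<psi> {2} = {0, 1, 2} \<or> \<psi> {Suc 2} = {0, 1, 2}"
      by (rule top, use k in simp)+
    then obtain i j where ij: "i \<le> Suc 0" "\<psi> {i} = {0, 1, 2}" "2 \<le> j" "j \<le> Suc 2" "\<psi> {j} = {0, 1, 2}"
      by (metis le_SucI le0 le_refl)
    then have "i = j" using k by (intro inj') auto
    then show False using ij by simp
  qed
qed

section \<open>Recognising cyclic groups and elementary abelian 2-groups\<close>

lemma (in group) iso_integer_mod_group:
  assumes fin: "finite (carrier G)" and x: "x \<in> carrier G" and gen: "generate G {x} = carrier G"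
  shows "G \<cong> integer_mod_group (order G)"
proof -
  let ?Z = "integer_mod_group (order G)"
  have ord: "ord x = order G" using generate_pow_card[OF x] gen by (simp add: order_def)
  have pos: "order G > 0" using fin by (simp add: order_gt_0_iff_finite)
  then have Z: "carrier ?Z = {0..<int (order G)}" by (simp add: carrier_integer_mod_group)
  let ?f = "\<lambda>i::int. x [^] i"
  have red: "?f (i mod int (order G)) = ?f i" for i
    using x by (simp add: int_pow_eq ord)
  have "?f \<in> hom ?Z G"
    by (rule homI) (use x in \<open>simp_all add: red int_pow_mult\<close>)
  moreover have "inj_on ?f (carrier ?Z)"
  proof (rule inj_onI)
    fix i j assume ij: "i \<in> carrier ?Z" "j \<in> carrier ?Z" "?f i = ?f j"
    then have "int (order G) dvd j - i" using x by (simp add: int_pow_eq ord)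
    then have "j mod int (order G) = i mod int (order G)" by (simp add: mod_eq_dvd_iff)
    then show "i = j" using ij Z by simp
  qed
  moreover have "?f ` carrier ?Z = carrier G"
  proof
    show "?f ` carrier ?Z \<subseteq> carrier G" using x by auto
    show "carrier G \<subseteq> ?f ` carrier ?Z"
    proof
      fix g assume "g \<in> carrier G"
      then obtain i :: int where "g = ?f i" using gen generate_pow[OF x] by auto
      then have "g = ?f (i mod int (order G))" by (simp add: red)
      then show "g \<in> ?f ` carrier ?Z" using pos Z by auto
    qed
  qed
  ultimately have "?Z \<cong> G" by (intro is_isoI) (simp add: iso_def bij_betw_def)
  then show ?thesis by (rule group.iso_sym[OF group_integer_mod_group])
qed

text \<open>The isomorphism takes a set of indices to the product of its generators. In a product of
  two such values the common indices occur squared and vanish, which gives symmetric difference; the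
  kernel is trivial by irredundance.\<close>

lemma (in group) exponent_two_iso:
  assumes fin: "finite (carrier G)" and sq: "\<And>g. g \<in> carrier G \<Longrightarrow> g \<otimes> g = \<one>"
    and irr: "irredundant G k x" and gen: "generate G (x ` {..<k}) = carrier G"
  shows "subset_group k \<cong> G"
proof -
  have "comm_group G"
  proof (rule group_comm_groupI)
    fix g h assume gh: "g \<in> carrier G" "h \<in> carrier G"
    then have "inv g = g" "inv h = h" "inv (g \<otimes> h) = g \<otimes> h"
      using sq by (simp_all add: inv_equality)
    then show "g \<otimes> h = h \<otimes> g" using inv_mult_group[OF gh] by simp
  qed
  then interpret comm_group G .
  note x [simp] = irredundant_closed[OF irr]
  let ?p = "finprod G x"
  have c: "x \<in> A \<rightarrow> carrier G" if "A \<subseteq> {..<k}" for A using that by auto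
  have finA: "finite A" if "A \<subseteq> {..<k}" for A using that finite_subset by blast
  have p [simp]: "?p A \<in> carrier G" if "A \<subseteq> {..<k}" for A using c[OF that] by simp
  have split: "?p A = ?p (A - B) \<otimes> ?p (A \<inter> B)" if "A \<subseteq> {..<k}" for A B
  proof -
    have "?p ((A - B) \<union> (A \<inter> B)) = ?p (A - B) \<otimes> ?p (A \<inter> B)"
      by (rule finprod_Un_disjoint) (use that finA in auto)
    moreover have "(A - B) \<union> (A \<inter> B) = A" by blast
    ultimately show ?thesis by simp
  qed
  have mult: "?p ((A - B) \<union> (B - A)) = ?p A \<otimes> ?p B" if AB: "A \<subseteq> {..<k}" "B \<subseteq> {..<k}" for A B
  proof -
    have sub: "A - B \<subseteq> {..<k}" "B - A \<subseteq> {..<k}" "A \<inter> B \<subseteq> {..<k}" using AB by auto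
    have "?p ((A - B) \<union> (B - A)) = ?p (A - B) \<otimes> ?p (B - A)"
      by (rule finprod_Un_disjoint) (use AB finA in auto)
    also have "\<dots> = (?p (A - B) \<otimes> ?p (B - A)) \<otimes> (?p (A \<inter> B) \<otimes> ?p (A \<inter> B))"
      using sub by (simp add: sq)
    also have "\<dots> = (?p (A - B) \<otimes> ?p (A \<inter> B)) \<otimes> (?p (B - A) \<otimes> ?p (A \<inter> B))"
      using sub by (simp add: m_ac)
    also have "\<dots> = ?p A \<otimes> ?p B"
      using split[OF AB(1), of B] split[OF AB(2), of A] by (simp add: Int_commute)
    finally show ?thesis .
  qed
  have hom: "?p \<in> hom (subset_group k) G"
    by (rule homI) (use mult in auto)
  have gen_mem: "?p A \<in> generate G (x ` A)" if "finite A" "A \<subseteq> {..<k}" for A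
    using that
  proof (induction A rule: finite_induct)
    case empty then show ?case by (simp add: generate.one)
  next
    case (insert a A)
    have "?p (insert a A) = x a \<otimes> ?p A" using insert c[of A] by simp
    moreover have "?p A \<in> generate G (x ` insert a A)"
      using insert mono_generate[of "x ` A" "x ` insert a A"] by auto
    moreover have "x a \<in> generate G (x ` insert a A)" by (intro generate.incl) blast
    ultimately show ?case by (metis generate.eng)
  qed
  have "A = {}" if A: "A \<subseteq> {..<k}" "?p A = \<one>" for A
  proof (rule ccontr)
    assume "A \<noteq> {}"
    then obtain a where a: "a \<in> A" by blast
    let ?A = "A - {a}"
    have A': "?A \<subseteq> {..<k}" using A by blast
    have "?p (insert a ?A) = x a \<otimes> ?p ?A"
      using A a finA by (intro finprod_insert) auto
    then have "x a \<otimes> ?p ?A = \<one>" using A a by (simp add: insert_absorb)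
    moreover have "?p ?A \<in> carrier G" "x a \<in> carrier G" using p[OF A'] A a by auto
    ultimately have "x a = inv (?p ?A)" using inv_equality by metis
    moreover have "inv (?p ?A) = ?p ?A" using p[OF A'] sq by (simp add: inv_equality)
    moreover have "?p ?A \<in> generate G (x ` ?A)" using gen_mem finA A' by blast
    ultimately show False using irredundant_notin[OF irr, of a ?A] A a by auto
  qed
  then have triv: "A = {}" if "A \<subseteq> {..<k}" "?p A = \<one>" for A using that by blast
  have inj: "inj_on ?p (Pow {..<k})"
  proof (rule inj_onI)
    fix A B assume AB: "A \<in> Pow {..<k}" "B \<in> Pow {..<k}" "?p A = ?p B"
    then have "?p ((A - B) \<union> (B - A)) = \<one>" by (simp add: mult sq)
    then have "(A - B) \<union> (B - A) = {}" using AB by (intro triv) auto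
    then show "A = B" by blast
  qed
  have "carrier G \<subseteq> ?p ` Pow {..<k}"
  proof
    fix g assume "g \<in> carrier G"
    then have "g \<in> generate G (x ` {..<k})" using gen by simp
    then show "g \<in> ?p ` Pow {..<k}"
    proof (induction rule: generate.induct)
      case one
      show ?case by (rule image_eqI[of _ _ "{}"]) auto
    next
      case (incl h)
      then obtain i where "h = x i" "i < k" by auto
      then show ?case by (intro image_eqI[of _ _ "{i}"]) auto
    next
      case (inv h)
      then obtain i where i: "h = x i" "i < k" by auto
      then have "inv h = h" using sq inv_equality by simp
      then show ?case using i by (intro image_eqI[of _ _ "{i}"]) auto
    next
      case (eng g h)
      then obtain A B where "g = ?p A" "h = ?p B" "A \<subseteq> {..<k}" "B \<subseteq> {..<k}" by auto
      then show ?case using mult by (intro image_eqI[of _ _ "(A - B) \<union> (B - A)"]) auto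
    qed
  qed
  then have "?p ` Pow {..<k} = carrier G" by auto
  then show ?thesis
    using hom inj by (intro is_isoI) (simp add: iso_def bij_betw_def)
qed

section \<open>Minimum generating sequences beginning with a non-involution\<close>

lemma (in group) min_generating_transfer:
  assumes x: "min_generating G k x" and y: "\<And>i. i < k \<Longrightarrow> y i \<in> carrier G"
    and xy: "\<And>i. i < k \<Longrightarrow> x i \<in> generate G (y ` {..<k})"
  shows "min_generating G k y"
proof -
  have ysub: "y ` {..<k} \<subseteq> carrier G" using y by auto
  have "generate G (x ` {..<k}) \<subseteq> generate G (y ` {..<k})"
    by (rule generate_subgroup_incl[OF _ generate_is_subgroup[OF ysub]]) (use xy in auto)
  then have "generate G (y ` {..<k}) = carrier G"
    using x generate_incl[OF ysub] by (auto simp: min_generating_def)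
  then show ?thesis using x ysub by (simp add: min_generating_def)
qed

lemma (in group) min_generating_noninvolution_first:
  assumes x: "min_generating G k x" and i: "i < k" "x i \<otimes> x i \<noteq> \<one>"
  obtains y where "min_generating G k y" "y 0 \<otimes> y 0 \<noteq> \<one>"
proof -
  let ?y = "x(0 := x i, i := x 0)"
  have xc: "x j \<in> carrier G" if "j < k" for j using x that by (auto simp: min_generating_def)
  have "min_generating G k ?y"
  proof (rule min_generating_transfer[OF x])
    show "?y j \<in> carrier G" if "j < k" for j using that i xc by simp
    show "x j \<in> generate G (?y ` {..<k})" if "j < k" for j
      by (intro generate.incl image_eqI[of _ _ "if j = 0 then i else if j = i then 0 else j"])
        (use that i in auto)
  qed
  moreover have "?y 0 = x i" by simp
  ultimately show thesis using that i by metis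
qed

text \<open>Suppose all generators are involutions. If two do not commute, their product is not an
  involution and may replace one of them. If all commute, every element squares to
  \<open>\<one>\<close>, contrary to the choice of \<open>g\<close>.\<close>

lemma (in group) min_generating_noninvolution:
  assumes x: "min_generating G k x" and g: "g \<in> carrier G" "g \<otimes> g \<noteq> \<one>"
  obtains y where "min_generating G k y" "y 0 \<otimes> y 0 \<noteq> \<one>"
proof (cases "\<forall>i<k. x i \<otimes> x i = \<one>")
  case False
  then show thesis using min_generating_noninvolution_first[OF x] that by blast
next
  case inv: True
  have xc: "x i \<in> carrier G" if "i < k" for i using x that by (auto simp: min_generating_def)
  have gen: "generate G (x ` {..<k}) = carrier G" using x by (simp add: min_generating_def)
  show thesis
  proof (cases "\<forall>i<k. \<forall>j<k. x i \<otimes> x j = x j \<otimes> x i")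
    case False
    then obtain i j where ij: "i < k" "j < k" "x i \<otimes> x j \<noteq> x j \<otimes> x i" by blast
    then have ne: "i \<noteq> j" by auto
    let ?y = "x(i := x i \<otimes> x j)"
    have my: "min_generating G k ?y"
    proof (rule min_generating_transfer[OF x])
      show "?y l \<in> carrier G" if "l < k" for l using that xc ij by simp
      show "x l \<in> generate G (?y ` {..<k})" if l: "l < k" for l
      proof (cases "l = i")
        case True
        have "?y i \<in> ?y ` {..<k}" "?y j \<in> ?y ` {..<k}" using ij by blast+
        then have "?y i \<otimes> inv (?y j) \<in> generate G (?y ` {..<k})"
          by (intro generate.eng[OF generate.incl generate.inv])
        moreover have "?y i \<otimes> inv (?y j) = x i" using ne xc ij by (simp add: m_assoc)
        ultimately show ?thesis using True by simp
      next
        case False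
        then have "x l = ?y l" by simp
        then show ?thesis using l by (intro generate.incl) blast
      qed
    qed
    have "?y i \<otimes> ?y i \<noteq> \<one>"
    proof
      assume "?y i \<otimes> ?y i = \<one>"
      then have "inv (x i \<otimes> x j) = x i \<otimes> x j" using ij xc by (simp add: inv_equality)
      moreover have "inv (x i) = x i" "inv (x j) = x j" using inv ij xc by (simp_all add: inv_equality)
      ultimately show False using ij xc inv_mult_group[of "x i" "x j"] by simp
    qed
    then show thesis using min_generating_noninvolution_first[OF my ij(1)] that by blast
  next
    case True
    have inv_x: "inv h = h" if "h \<in> x ` {..<k}" for h
      using that inv xc by (auto simp: inv_equality)
    have comm1: "w \<otimes> x j = x j \<otimes> w" if "w \<in> generate G (x ` {..<k})" "j < k" for w j
      using that
    proof (induction rule: generate.induct)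
      case one then show ?case using xc by simp
    next
      case (incl h) then show ?case using True by auto
    next
      case (inv h)
      then show ?case using inv_x True by auto
    next
      case (eng w1 w2)
      then have "w1 \<in> carrier G" "w2 \<in> carrier G" "x j \<in> carrier G" using gen xc by auto
      then show ?case using eng by (metis m_assoc)
    qed
    have comm2: "w \<otimes> v = v \<otimes> w" if "v \<in> generate G (x ` {..<k})" "w \<in> carrier G" for v w
      using that
    proof (induction rule: generate.induct)
      case one then show ?case by simp
    next
      case (incl h) then show ?case using comm1 gen by auto
    next
      case (inv h)
      then show ?case using inv_x comm1 gen by auto
    next
      case (eng w1 w2)
      then have "w1 \<in> carrier G" "w2 \<in> carrier G" using gen by auto
      then show ?case using eng by (metis m_assoc)
    qed
    have "w \<otimes> w = \<one>" if "w \<in> generate G (x ` {..<k})" for w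
      using that
    proof (induction rule: generate.induct)
      case one then show ?case by simp
    next
      case (incl h) then show ?case using inv by auto
    next
      case (inv h)
      then show ?case using inv_x \<open>\<forall>i<k. x i \<otimes> x i = \<one>\<close> by auto
    next
      case (eng w1 w2)
      then have w: "w1 \<in> carrier G" "w2 \<in> carrier G" using gen by auto
      have "(w1 \<otimes> w2) \<otimes> (w1 \<otimes> w2) = w1 \<otimes> (w2 \<otimes> w1) \<otimes> w2" using w by (simp add: m_assoc)
      also have "w2 \<otimes> w1 = w1 \<otimes> w2" using comm2 eng w by blast
      also have "w1 \<otimes> (w1 \<otimes> w2) \<otimes> w2 = (w1 \<otimes> w1) \<otimes> (w2 \<otimes> w2)" using w by (simp add: m_assoc)
      finally show ?case using eng by simp
    qed
    then show thesis using g gen by blast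
  qed
qed

section \<open>Existence for two orbits and for nontrivial groups with more\<close>

lemma subset_group_2_iso: "subset_group 2 \<cong> integer_mod_group 2 \<times>\<times> integer_mod_group 2"
proof -
  let ?f = "\<lambda>A :: nat set. (of_bool (0 \<in> A) :: int, of_bool (1 \<in> A) :: int)"
  have Z: "carrier (integer_mod_group 2) = {0, 1}" by (auto simp: carrier_integer_mod_group)
  have two: "{..<2} = {0, 1::nat}" by auto
  have "?f \<in> hom (subset_group 2) (integer_mod_group 2 \<times>\<times> integer_mod_group 2)"
    by (rule homI) (auto simp: Z DirProd_def of_bool_def)
  moreover have "inj_on ?f (Pow {..<2})"
  proof (rule inj_onI)
    fix A B :: "nat set" assume AB: "A \<in> Pow {..<2}" "B \<in> Pow {..<2}" "?f A = ?f B"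
    have "y \<in> A \<longleftrightarrow> y \<in> B" for y using AB unfolding two by (cases "y \<in> {0, 1}") auto
    then show "A = B" by blast
  qed
  moreover have "?f ` Pow {..<2} = {0, 1} \<times> {0, 1}"
    unfolding two by (simp add: Pow_insert) auto
  ultimately show ?thesis
    by (intro is_isoI) (simp add: iso_def bij_betw_def Z)
qed

lemma subset_group_3_iso:
  "subset_group 3 \<cong> integer_mod_group 2 \<times>\<times> integer_mod_group 2 \<times>\<times> integer_mod_group 2"
proof -
  let ?f = "\<lambda>A :: nat set. (of_bool (0 \<in> A) :: int, of_bool (1 \<in> A) :: int, of_bool (2 \<in> A) :: int)"
  have Z: "carrier (integer_mod_group 2) = {0, 1}" by (auto simp: carrier_integer_mod_group)
  have three: "{..<3} = {0, 1, 2::nat}" by auto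
  have "?f \<in> hom (subset_group 3) (integer_mod_group 2 \<times>\<times> integer_mod_group 2 \<times>\<times> integer_mod_group 2)"
    by (rule homI) (auto simp: Z DirProd_def of_bool_def)
  moreover have "inj_on ?f (Pow {..<3})"
  proof (rule inj_onI)
    fix A B :: "nat set" assume AB: "A \<in> Pow {..<3}" "B \<in> Pow {..<3}" "?f A = ?f B"
    have "y \<in> A \<longleftrightarrow> y \<in> B" for y using AB unfolding three by (cases "y \<in> {0, 1, 2}") auto
    then show "A = B" by blast
  qed
  moreover have "?f ` Pow {..<3} = {0, 1} \<times> {0, 1} \<times> {0, 1}"
    unfolding three by (simp add: Pow_insert) auto
  ultimately show ?thesis
    by (intro is_isoI) (simp add: iso_def bij_betw_def Z)
qed

lemma is_PDR_iso: "is_PDR n G \<Gamma> \<Longrightarrow> G \<cong> H \<Longrightarrow> is_PDR n H \<Gamma>"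
  unfolding is_PDR_def using iso_trans by blast

lemma (in group) two_PDR:
  assumes fin: "finite (carrier G)"
    and ex: "\<not> G \<cong> integer_mod_group 1" "\<not> G \<cong> integer_mod_group 2" "\<not> G \<cong> integer_mod_group 3"
      "\<not> G \<cong> integer_mod_group 2 \<times>\<times> integer_mod_group 2"
      "\<not> G \<cong> integer_mod_group 2 \<times>\<times> integer_mod_group 2 \<times>\<times> integer_mod_group 2"
  shows "admits_PDR 2 G"
proof -
  obtain k x where mg: "min_generating G k x" using min_generating_exists[OF fin] .
  have cyc: "admits_PDR 2 G" if z: "z \<in> carrier G" "generate G {z} = carrier G" for z
  proof -
    have "G \<cong> integer_mod_group (order G)" by (rule iso_integer_mod_group[OF fin z])
    then have "order G \<noteq> 1" "order G \<noteq> 2" "order G \<noteq> 3" using ex by auto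
    moreover have "order G > 0" using fin by (simp add: order_gt_0_iff_finite)
    ultimately have "order G \<ge> 4" by linarith
    then show ?thesis using is_PDR_imp_admits_PDR[OF cyclic_haar_PDR[OF fin z] fin] by blast
  qed
  consider "k = 0" | "k = 1" | "k \<ge> 2" by linarith
  then show ?thesis
  proof cases
    case 1
    then have "generate G {} = carrier G" using mg by (simp add: min_generating_def)
    then have "carrier G = {\<one>}" by (simp add: generate_empty)
    then have "generate G {\<one>} = carrier G" using generate_one by simp
    then show ?thesis using cyc by blast
  next
    case 2
    then have "x ` {..<k} = {x 0}" by auto
    then show ?thesis using mg cyc[of "x 0"] by (simp add: min_generating_def)
  next
    case k: 3
    show ?thesis
    proof (cases "\<forall>g\<in>carrier G. g \<otimes> g = \<one>")
      case False
      then obtain y where y: "min_generating G k y" "y 0 \<otimes> y 0 \<noteq> \<one>"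
        using min_generating_noninvolution[OF mg] by blast
      have "generate G (y ` {..<k}) = carrier G" using y by (simp add: min_generating_def)
      from generators_haar_PDR[OF fin k min_generating_irredundant[OF y(1)] this y(2)]
      show ?thesis using fin by (rule is_PDR_imp_admits_PDR)
    next
      case True
      have "generate G (x ` {..<k}) = carrier G" using mg by (simp add: min_generating_def)
      then have iso: "subset_group k \<cong> G"
        using True by (intro exponent_two_iso[OF fin _ min_generating_irredundant[OF mg]]) auto
      then have iso': "G \<cong> subset_group k" by (rule group.iso_sym[OF group_subset_group])
      have "k \<noteq> 2" "k \<noteq> 3"
        using ex(4,5) iso_trans[OF iso'] subset_group_2_iso subset_group_3_iso by auto
      then have "k \<ge> 4" using k by linarith
      from is_PDR_iso[OF subset_group_haar_PDR[OF this] iso]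
      show ?thesis using fin by (rule is_PDR_imp_admits_PDR)
    qed
  qed
qed

lemma (in group) nontrivial_PDR:
  assumes fin: "finite (carrier G)" and ne: "order G \<noteq> 1" and n: "n \<ge> 3"
  shows "admits_PDR n G"
proof -
  obtain k x where mg: "min_generating G k x" using min_generating_exists[OF fin] .
  have gen: "generate G (x ` {..<k}) = carrier G" using mg by (simp add: min_generating_def)
  have "k \<noteq> 0"
  proof
    assume "k = 0"
    then have "carrier G = {\<one>}" using gen by (simp add: generate_empty)
    then show False using ne by (simp add: order_def)
  qed
  then have "k \<ge> 1" by simp
  from chain_PDR[OF fin n this min_generating_irredundant[OF mg] gen]
  show ?thesis using fin by (rule is_PDR_imp_admits_PDR)
qed

section \<open>The trivial group\<close>

text \<open>An asymmetric regular digraph of valency \<open>2\<close> on the \<open>k + 6\<close> vertices \<open>0, \<dots>, k + 5\<close>.\<close>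

definition rigid_arc :: "nat \<Rightarrow> nat \<Rightarrow> nat \<Rightarrow> bool" where
  "rigid_arc k i j \<longleftrightarrow>
     (i, j) \<in> {(0, 1), (0, 2), (1, 2), (1, 3), (2, 3), (2, 4), (3, 0), (3, k + 5), (4, 0), (k + 5, 1)} \<or>
     4 \<le> i \<and> j = Suc i \<or> 4 \<le> j \<and> i = Suc j"

text \<open>The generic inner vertex of the path is offered as \<open>Suc h\<close>, so that its
  predecessor simplifies to \<open>h\<close> in the neighbour sets.\<close>

lemma rigid_cases:
  fixes i k :: nat
  assumes "i < k + 6"
  obtains "i = 0" | "i = 1" | "i = 2" | "i = 3" | "i = 4" | "i = k + 5"
    | h where "i = Suc h" "4 \<le> h" "h < k + 4"
proof (cases "i < 5")
  case True
  then have "i \<in> {0, 1, 2, 3, 4}" by auto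
  then show ?thesis using that by blast
next
  case False
  then show ?thesis using assms that(6) that(7)[of "i - 1"] by (cases "i = k + 5") auto
qed

lemma rigid_arc_out:
  assumes "i < k + 6"
  shows "card {j. j < k + 6 \<and> rigid_arc k i j} = 2"
proof -
  let ?S = "if i = 0 then {1, 2} else if i = 1 then {2, 3} else if i = 2 then {3, 4} else
      if i = 3 then {0, k + 5} else if i = 4 then {0, 5} else if i = k + 5 then {1, k + 4} else {i - 1, Suc i}"
  have "{j. j < k + 6 \<and> rigid_arc k i j} = ?S"
    using assms by (cases rule: rigid_cases) (auto simp: rigid_arc_def)
  moreover have "card ?S = 2" using assms by (cases rule: rigid_cases) auto
  ultimately show ?thesis by simp
qed

lemma rigid_arc_in:
  assumes "i < k + 6"
  shows "card {j. j < k + 6 \<and> rigid_arc k j i} = 2"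
proof -
  let ?S = "if i = 0 then {3, 4} else if i = 1 then {0, k + 5} else if i = 2 then {0, 1} else
      if i = 3 then {1, 2} else if i = 4 then {2, 5} else if i = k + 5 then {3, k + 4} else {i - 1, Suc i}"
  have "{j. j < k + 6 \<and> rigid_arc k j i} = ?S"
    using assms by (cases rule: rigid_cases) (auto simp: rigid_arc_def)
  moreover have "card ?S = 2" using assms by (cases rule: rigid_cases) auto
  ultimately show ?thesis by simp
qed

text \<open>
  The digons form the path \<open>4, 5, \<dots>, k + 5\<close>.  It cannot be reversed because \<open>4\<close> and \<open>k + 5\<close> have
  the out-neighbours \<open>0\<close> and \<open>1\<close> outside the path and \<open>0 \<rightarrow> 1\<close> is not a digon.
\<close>

lemma rigid_arc_rigid:
  assumes n_def: "n = k + 6" and bij: "bij_betw s {..<n} {..<n}"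
    and s: "\<And>i j. i < n \<Longrightarrow> j < n \<Longrightarrow> rigid_arc k (s i) (s j) \<longleftrightarrow> rigid_arc k i j"
    and "i < n"
  shows "s i = i"
proof -
  let ?V = "{..<n}" and ?m = "k + 2"
  define D where "D i j \<longleftrightarrow> rigid_arc k i j \<and> rigid_arc k j i" for i j
  have Ds: "D (s u) (s v) \<longleftrightarrow> D u v" if "u \<in> ?V" "v \<in> ?V" for u v
    using s that by (auto simp: D_def)
  define S where "S = {(0, 1), (0, 2), (1, 2), (1, 3), (2, 3), (2, 4), (3, 0), (3, k + 5), (4, 0), (k + 5, 1)}"
  have rig: "rigid_arc k i j \<longleftrightarrow> (i, j) \<in> S \<or> (4 \<le> i \<and> j = Suc i \<or> 4 \<le> j \<and> i = Suc j)" for i j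
    unfolding rigid_arc_def S_def by (rule refl)
  \<comment> \<open>None of the ten exceptional arcs has its reverse in the digraph, so the digons
    are exactly those of the path.\<close>
  have single: "\<not> rigid_arc k j i" if "(i, j) \<in> S" for i j
    using that unfolding S_def by (elim insertE emptyE) (simp_all add: rigid_arc_def)
  have D: "D i j \<longleftrightarrow> 4 \<le> i \<and> j = Suc i \<or> 4 \<le> j \<and> i = Suc j" for i j
    using single[of i j] single[of j i] unfolding D_def rig by argo
  have path: "digon_path ?V D ?m (\<lambda>i. 4 + i)"
    unfolding digon_path_def
  proof (intro conjI allI impI ballI)
    fix i v assume "i < ?m" "v \<in> ?V"
    then show "D (4 + i) v \<longleftrightarrow> (\<exists>j<?m. v = 4 + j \<and> (j = Suc i \<or> i = Suc j))"
      unfolding D by (intro iffI exI[of _ "v - 4"]) (auto simp: n_def)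
  qed (auto simp: inj_on_def n_def)
  have sV: "s i < n" if "i < n" for i using bij_betw_apply[OF bij] that by simp
  have sinj: "i = j" if "s i = s j" "i < n" "j < n" for i j
    using inj_onD[OF bij_betw_imp_inj_on[OF bij] that(1)] that by simp
  have out: "rigid_arc k 0 j \<Longrightarrow> j = 1 \<or> j = 2" "rigid_arc k 1 j \<Longrightarrow> j = 2 \<or> j = 3"
    "rigid_arc k 4 j \<Longrightarrow> j = 0 \<or> j = 5" for j
    by (auto simp: rigid_arc_def)
  have out_last: "rigid_arc k (k + 5) j \<Longrightarrow> j < n \<Longrightarrow> j = 1 \<or> j = k + 4" for j
    by (auto simp: rigid_arc_def n_def)
  have arcs: "rigid_arc k 0 1" "rigid_arc k 0 2" "rigid_arc k 1 3" "rigid_arc k 4 0" "rigid_arc k (k + 5) 1"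
    "\<not> rigid_arc k 1 0"
    by (auto simp: rigid_arc_def)
  have n: "0 < n" "1 < n" "2 < n" "3 < n" "4 < n" "5 < n" "k + 4 < n" "k + 5 < n"
    by (simp_all add: n_def)
  have "D 4 5" by (simp add: D)
  then have "D (s 4) (s 5)" using Ds n by simp
  then have "4 \<le> s 4" by (auto simp: D)
  then obtain t where "s 4 = 4 + t" using le_Suc_ex by blast
  then have t: "s 4 = 4 + t" "t < ?m" using sV[of 4] by (simp_all add: n_def)
  have "t = 0 \<or> Suc t = ?m"
    by (rule digon_path_end[OF bij Ds path path]) (use t in auto)
  moreover have "Suc t \<noteq> ?m"
  proof
    assume e: "Suc t = ?m"
    have img: "s (4 + i) = 4 + (?m - Suc i)" if "i < ?m" for i
      by (rule digon_path_image[OF bij Ds path digon_path_rev[OF path]]) (use t e that in auto)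
    have s4: "s 4 = k + 5" and sn: "s (k + 5) = 4" using img[of 0] img[of "k + 1"] by (simp_all add: add.commute[of k])
    have s5: "s 5 = k + 4" and sn2: "s (k + 4) = 5"
      using img[of 1] img[of k] by (simp_all add: add.commute[of k])
    have "rigid_arc k (k + 5) (s 0)" using arcs(4) s[of 4 0] s4 n by simp
    then have "s 0 = 1 \<or> s 0 = k + 4" using out_last sV n by blast
    moreover have "s 0 \<noteq> k + 4" using sinj[of 0 5] s5 n by auto
    ultimately have s0: "s 0 = 1" by simp
    have "rigid_arc k 4 (s 1)" using arcs(5) s[of "k + 5" 1] sn n by simp
    then have "s 1 = 0 \<or> s 1 = 5" by (rule out(3))
    moreover have "s 1 \<noteq> 5" using sinj[of 1 "k + 4"] sn2 n by auto
    ultimately have "s 1 = 0" by simp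
    then show False using s[of 0 1] s0 arcs n by simp
  qed
  ultimately have s4: "s 4 = 4" using t by simp
  have img: "s (4 + i) = 4 + i" if "i < ?m" for i
    by (rule digon_path_image[OF bij Ds path path]) (use s4 that in auto)
  have s5: "s 5 = 5" and sn: "s (k + 5) = k + 5" and sn2: "s (k + 4) = k + 4"
    using img[of 1] img[of "k + 1"] img[of k] by (simp_all add: add.commute[of k])
  \<comment> \<open>With the path fixed pointwise, the other vertices follow one by one:
    \<open>0\<close> is the out-neighbour of \<open>4\<close> off the path, \<open>1\<close> that of
    \<open>k + 5\<close>, and \<open>2\<close> and \<open>3\<close> are the out-neighbours of
    \<open>0\<close> and \<open>1\<close> still left.\<close>
  have "rigid_arc k 4 (s 0)" using arcs(4) s[of 4 0] s4 n by simp
  then have "s 0 = 0 \<or> s 0 = 5" by (rule out(3))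
  then have s0: "s 0 = 0" using sinj[of 0 5] s5 n by auto
  have "rigid_arc k (k + 5) (s 1)" using arcs(5) s[of "k + 5" 1] sn n by simp
  then have "s 1 = 1 \<or> s 1 = k + 4" using out_last sV n by blast
  then have s1: "s 1 = 1" using sinj[of 1 "k + 4"] sn2 n by auto
  have "rigid_arc k 0 (s 2)" using arcs(2) s[of 0 2] s0 n by simp
  then have "s 2 = 1 \<or> s 2 = 2" by (rule out(1))
  then have s2: "s 2 = 2" using sinj[of 2 1] s1 n by auto
  have "rigid_arc k 1 (s 3)" using arcs(3) s[of 1 3] s1 n by simp
  then have "s 3 = 2 \<or> s 3 = 3" by (rule out(2))
  then have s3: "s 3 = 3" using sinj[of 3 2] s2 n by auto
  consider "i = 0" | "i = 1" | "i = 2" | "i = 3" | "4 \<le> i" by linarith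
  then show ?thesis
  proof cases
    case 5
    then show ?thesis using img[of "i - 4"] \<open>i < n\<close> by (simp add: n_def)
  qed (use s0 s1 s2 s3 in simp_all)
qed

lemma (in group) trivial_PDR:
  assumes triv: "carrier G = {\<one>}" and "n \<ge> 6"
  shows "is_PDR n G (layered G n (\<lambda>i j. if rigid_arc (n - 6) i j then {\<one>} else {}))"
proof (rule layered_PDR[where d = 2])
  define k where "k = n - 6"
  have nk: "n = k + 6" using assms by (simp add: k_def)
  let ?R = "\<lambda>i j. if rigid_arc (n - 6) i j then {\<one>} else {}"
  show "finite (carrier G)" "n \<ge> 1" using triv nk by auto
  show "?R i j \<subseteq> carrier G" for i j by simp
  show "?R i i = {}" for i by (auto simp: rigid_arc_def)
  have card: "(\<Sum>j<n. card (if P j then {\<one>} else {})) = card {j. j < n \<and> P j}" for P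
  proof -
    have "(\<Sum>j<n. card (if P j then {\<one>} else {})) = (\<Sum>j<n. if P j then 1 else 0)"
      by (rule sum.cong) auto
    also have "\<dots> = card {j. j < n \<and> P j}"
      by (simp add: sum.If_cases Collect_conj_eq lessThan_def)
    finally show ?thesis .
  qed
  show "(\<Sum>j<n. card (?R i j)) = 2" if "i < n" for i
    unfolding card using rigid_arc_out[of i k] that by (simp add: nk)
  show "(\<Sum>i<n. card (?R i j)) = 2" if "j < n" for j
    unfolding card using rigid_arc_in[of j k] that by (simp add: nk)
  fix \<sigma> assume \<sigma>: "\<sigma> \<in> digraph_automorphisms (layered G n ?R)"
  note bij = layered_AutD(1)[OF \<sigma>] and arc = layered_AutD(2)[OF \<sigma>]
  define s where "s i = snd (\<sigma> (\<one>, i))" for i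
  have im: "\<sigma> (\<one>, i) = (\<one>, s i)" "s i < n" if "i < n" for i
    using bij_betw_apply[OF bij, of "(\<one>, i)"] that triv by (auto simp: s_def)
  have inj: "inj_on s {..<n}"
  proof (rule inj_onI)
    fix i j assume ij: "i \<in> {..<n}" "j \<in> {..<n}" "s i = s j"
    then have "\<sigma> (\<one>, i) = \<sigma> (\<one>, j)" using im by simp
    then show "i = j"
      using inj_onD[OF bij_betw_imp_inj_on[OF bij], of "(\<one>, i)" "(\<one>, j)"] ij by simp
  qed
  moreover have "s ` {..<n} = {..<n}"
    by (rule endo_inj_surj[OF _ _ inj]) (use im in auto)
  ultimately have "bij_betw s {..<n} {..<n}" by (simp add: bij_betw_def)
  moreover have "rigid_arc k (s i) (s j) \<longleftrightarrow> rigid_arc k i j" if "i < n" "j < n" for i j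
    using arc[of "(\<one>, i)" "(\<one>, j)"] im that by (simp add: k_def split: if_splits)
  ultimately have "s i = i" if "i < n" for i using rigid_arc_rigid[OF nk] that by blast
  then have "\<sigma> (\<one>, i) = (\<one>, i)" if "i < n" for i using im that by metis
  then show "\<exists>a\<in>carrier G. \<forall>g\<in>carrier G. \<forall>i<n. \<sigma> (g, i) = (g \<otimes> a, i)"
    unfolding triv by simp
qed

section \<open>Valencies of partite representations\<close>

definition same_orbit :: "'v pair_pre_digraph \<Rightarrow> 'v \<Rightarrow> 'v \<Rightarrow> bool" where
  "same_orbit \<Gamma> u v \<longleftrightarrow> (\<exists>\<sigma>\<in>digraph_automorphisms \<Gamma>. v = \<sigma> u)"

lemma same_orbit_refl: "u \<in> pverts \<Gamma> \<Longrightarrow> same_orbit \<Gamma> u u"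
  unfolding same_orbit_def
  using monoid.one_closed[OF group.is_monoid[OF group_Aut_digraph[of \<Gamma>]]]
  by (intro bexI[of _ "\<lambda>x\<in>pverts \<Gamma>. x"]) auto

lemma Aut_inverse:
  assumes "\<sigma> \<in> digraph_automorphisms \<Gamma>"
  obtains \<tau> where "\<tau> \<in> digraph_automorphisms \<Gamma>" "\<And>v. v \<in> pverts \<Gamma> \<Longrightarrow> \<tau> (\<sigma> v) = v"
    "\<And>v. v \<in> pverts \<Gamma> \<Longrightarrow> \<sigma> (\<tau> v) = v"
proof -
  interpret A: group "Aut_digraph \<Gamma>" by (rule group_Aut_digraph)
  let ?\<tau> = "inv\<^bsub>Aut_digraph \<Gamma>\<^esub> \<sigma>"
  have s: "\<sigma> \<in> carrier (Aut_digraph \<Gamma>)" using assms by simp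
  then have t: "?\<tau> \<in> digraph_automorphisms \<Gamma>" using A.inv_closed by simp
  have "compose (pverts \<Gamma>) ?\<tau> \<sigma> = (\<lambda>x\<in>pverts \<Gamma>. x)" "compose (pverts \<Gamma>) \<sigma> ?\<tau> = (\<lambda>x\<in>pverts \<Gamma>. x)"
    using A.l_inv[OF s] A.r_inv[OF s] by (simp_all add: mult_Aut_digraph[OF t assms] mult_Aut_digraph[OF assms t])
  then have "?\<tau> (\<sigma> v) = v" "\<sigma> (?\<tau> v) = v" if "v \<in> pverts \<Gamma>" for v
    using that by (auto simp: compose_def fun_eq_iff split: if_splits)
  then show thesis using that[OF t] by blast
qed

lemma Aut_compose:
  assumes "\<sigma> \<in> digraph_automorphisms \<Gamma>" "\<tau> \<in> digraph_automorphisms \<Gamma>"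
  obtains \<rho> where "\<rho> \<in> digraph_automorphisms \<Gamma>" "\<And>v. v \<in> pverts \<Gamma> \<Longrightarrow> \<rho> v = \<sigma> (\<tau> v)"
proof -
  interpret A: group "Aut_digraph \<Gamma>" by (rule group_Aut_digraph)
  have "compose (pverts \<Gamma>) \<sigma> \<tau> \<in> digraph_automorphisms \<Gamma>"
    using A.m_closed[of \<sigma> \<tau>] assms by (simp add: mult_Aut_digraph)
  then show thesis using that[of "compose (pverts \<Gamma>) \<sigma> \<tau>"] by (simp add: compose_def)
qed

lemma same_orbit_sym: "u \<in> pverts \<Gamma> \<Longrightarrow> same_orbit \<Gamma> u v \<Longrightarrow> same_orbit \<Gamma> v u"
  unfolding same_orbit_def using Aut_inverse by metis

lemma same_orbit_trans:
  "u \<in> pverts \<Gamma> \<Longrightarrow> same_orbit \<Gamma> u v \<Longrightarrow> same_orbit \<Gamma> v w \<Longrightarrow> same_orbit \<Gamma> u w"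
  unfolding same_orbit_def using Aut_compose by metis

text \<open>Formulated for a relation rather than a digraph, so that it also serves the multipartite
  complement.\<close>

definition biregular :: "'v set \<Rightarrow> ('v \<Rightarrow> 'v \<Rightarrow> bool) \<Rightarrow> nat \<Rightarrow> bool" where
  "biregular V Q d \<longleftrightarrow> (\<forall>u\<in>V. card {v \<in> V. Q u v} = d \<and> card {v \<in> V. Q v u} = d)"

text \<open>Out-valency one gives a function, in-valency one its injectivity, and finiteness its
  surjectivity.\<close>

lemma biregular_1_function:
  assumes fin: "finite V" and Q: "biregular V Q 1"
  obtains f where "bij_betw f V V" "\<And>u. u \<in> V \<Longrightarrow> f u \<in> V"
    "\<And>u v. u \<in> V \<Longrightarrow> v \<in> V \<Longrightarrow> f u = f v \<longleftrightarrow> u = v"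
    "\<And>u v. u \<in> V \<Longrightarrow> v \<in> V \<Longrightarrow> Q u v \<longleftrightarrow> v = f u"
proof -
  have "\<exists>w. {v \<in> V. Q u v} = {w}" if "u \<in> V" for u
    using Q that by (simp add: biregular_def card_1_singleton_iff)
  then obtain f where f: "\<And>u. u \<in> V \<Longrightarrow> {v \<in> V. Q u v} = {f u}" by metis
  have fV: "f u \<in> V" "Q u (f u)" if "u \<in> V" for u using f[OF that] by blast+
  have inj: "inj_on f V"
  proof (rule inj_onI)
    fix u v assume uv: "u \<in> V" "v \<in> V" "f u = f v"
    have "card {w \<in> V. Q w (f u)} = 1" using Q fV(1)[OF uv(1)] by (simp add: biregular_def)
    then obtain w where w: "{w \<in> V. Q w (f u)} = {w}" by (auto simp: card_1_singleton_iff)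
    have "u \<in> {w \<in> V. Q w (f u)}" "v \<in> {w \<in> V. Q w (f u)}"
      using fV(2)[OF uv(1)] fV(2)[OF uv(2)] uv by simp_all
    then show "u = v" unfolding w by simp
  qed
  have "f ` V = V" by (rule endo_inj_surj[OF fin _ inj]) (use fV in auto)
  with inj have "bij_betw f V V" by (simp add: bij_betw_def)
  moreover have "Q u v \<longleftrightarrow> v = f u" if "u \<in> V" "v \<in> V" for u v
    using f[OF that(1)] that(2) by blast
  ultimately show thesis using that fV(1) inj_on_eq_iff[OF inj] by blast
qed

lemma regular_digraph_biregular:
  assumes wf: "pair_wf_digraph \<Gamma>" and "regular_digraph \<Gamma>"
  obtains d where "biregular (pverts \<Gamma>) (\<lambda>u v. (u, v) \<in> parcs \<Gamma>) d"
proof -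
  obtain d where d: "\<forall>v\<in>pverts \<Gamma>. out_degree (with_proj \<Gamma>) v = d \<and> in_degree (with_proj \<Gamma>) v = d"
    using assms(2) by (auto simp: regular_digraph_def)
  have V: "u \<in> pverts \<Gamma> \<and> v \<in> pverts \<Gamma>" if "(u, v) \<in> parcs \<Gamma>" for u v
    using wf that by (auto simp: pair_wf_digraph_def)
  have "out_arcs (with_proj \<Gamma>) u = Pair u ` {v \<in> pverts \<Gamma>. (u, v) \<in> parcs \<Gamma>}" for u
    using V by (auto simp: out_arcs_def)
  then have "out_degree (with_proj \<Gamma>) u = card {v \<in> pverts \<Gamma>. (u, v) \<in> parcs \<Gamma>}" for u
    unfolding out_degree_def by (simp add: card_image inj_on_def)
  moreover have "in_arcs (with_proj \<Gamma>) u = (\<lambda>v. (v, u)) ` {v \<in> pverts \<Gamma>. (v, u) \<in> parcs \<Gamma>}" for u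
    using V by (auto simp: in_arcs_def)
  then have "in_degree (with_proj \<Gamma>) u = card {v \<in> pverts \<Gamma>. (v, u) \<in> parcs \<Gamma>}" for u
    unfolding in_degree_def by (simp add: card_image inj_on_def)
  ultimately have "biregular (pverts \<Gamma>) (\<lambda>u v. (u, v) \<in> parcs \<Gamma>) d"
    unfolding biregular_def using d by simp
  then show thesis by (rule that)
qed

context
  fixes n :: nat and G :: "('g, 'm) monoid_scheme" and \<Gamma> :: "'v pair_pre_digraph"
  assumes pdr: "is_PDR n G \<Gamma>" and finG: "finite (carrier G)"
begin

private abbreviation "V \<equiv> pverts \<Gamma>"
private abbreviation sim (infix "\<sim>" 50) where "u \<sim> v \<equiv> same_orbit \<Gamma> u v"

lemma PDR_wf: "pair_wf_digraph \<Gamma>"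
  using pdr by (simp add: is_PDR_def)

lemma PDR_no_arc: "u \<in> V \<Longrightarrow> u \<sim> v \<Longrightarrow> (u, v) \<notin> parcs \<Gamma>"
proof
  assume u: "u \<in> V" and s: "u \<sim> v" and a: "(u, v) \<in> parcs \<Gamma>"
  let ?X = "orbit (Aut_digraph \<Gamma>) (\<lambda>\<sigma>. \<sigma>) u"
  have "?X \<in> orbits (Aut_digraph \<Gamma>) V (\<lambda>\<sigma>. \<sigma>)" using u by (auto simp: orbits_def)
  then have "arcs (with_proj \<Gamma> \<restriction> ?X) = {}" using pdr unfolding is_PDR_def by blast
  moreover have "u \<in> ?X" "v \<in> ?X"
    using same_orbit_refl[OF u] s by (auto simp: orbit_def same_orbit_def)
  ultimately show False using a by auto
qed

lemma PDR_free:
  assumes "\<sigma> \<in> digraph_automorphisms \<Gamma>" "v \<in> V" "\<sigma> v = v" "w \<in> V"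
  shows "\<sigma> w = w"
proof -
  have "\<sigma> \<in> stabilizer (Aut_digraph \<Gamma>) (\<lambda>\<sigma>. \<sigma>) v" using assms by (simp add: stabilizer_def)
  moreover have "stabilizer (Aut_digraph \<Gamma>) (\<lambda>\<sigma>. \<sigma>) v = {\<one>\<^bsub>Aut_digraph \<Gamma>\<^esub>}"
    using pdr assms(2) unfolding is_PDR_def semiregular_def by blast
  ultimately have "\<sigma> = (\<lambda>x\<in>V. x)" by simp
  then show ?thesis using assms(4) by simp
qed

lemma PDR_finite: "finite V"
  by (rule is_PDR_finite[OF pdr finG])

text \<open>The source of all contradictions: a permutation \<open>f\<close> that preserves the arcs
  must stay within orbits and cannot fix a vertex unless it fixes all. It may be arbitrary off the
  vertex set, being restricted here.\<close>

lemma PDR_automorphism: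
  assumes f: "bij_betw f V V"
    and arc: "\<And>u v. u \<in> V \<Longrightarrow> v \<in> V \<Longrightarrow> (f u, f v) \<in> parcs \<Gamma> \<longleftrightarrow> (u, v) \<in> parcs \<Gamma>"
    and u: "u \<in> V"
  shows "u \<sim> (f u)" and "w \<in> V \<Longrightarrow> f u = u \<Longrightarrow> f w = w"
proof -
  let ?f = "restrict f V"
  have "bij_betw ?f V V" using f by (simp cong: bij_betw_cong)
  then have A: "?f \<in> digraph_automorphisms \<Gamma>"
    using arc by (simp add: digraph_automorphisms_def Bij_def)
  then show "u \<sim> (f u)" using u by (auto simp: same_orbit_def intro!: bexI[of _ ?f])
  show "f w = w" if "w \<in> V" "f u = u" using PDR_free[OF A u _ that(1)] that u by simp
qed

text \<open>Evaluation at \<open>u\<close> is injective on the automorphisms: if two agree at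
  \<open>u\<close>, their quotient fixes \<open>u\<close>, hence everything.\<close>

lemma card_PDR_orbit:
  assumes u: "u \<in> V"
  shows "card {v \<in> V. u \<sim> v} = order G"
proof -
  have "{v \<in> V. u \<sim> v} = (\<lambda>\<sigma>. \<sigma> u) ` digraph_automorphisms \<Gamma>"
    using u Aut_maps by (auto simp: same_orbit_def)
  moreover have "inj_on (\<lambda>\<sigma>. \<sigma> u) (digraph_automorphisms \<Gamma>)"
  proof (rule inj_onI)
    fix \<sigma> \<tau> assume st: "\<sigma> \<in> digraph_automorphisms \<Gamma>" "\<tau> \<in> digraph_automorphisms \<Gamma>" "\<sigma> u = \<tau> u"
    obtain \<tau>' where t: "\<tau>' \<in> digraph_automorphisms \<Gamma>" "\<And>v. v \<in> V \<Longrightarrow> \<tau>' (\<tau> v) = v"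
      "\<And>v. v \<in> V \<Longrightarrow> \<tau> (\<tau>' v) = v" using Aut_inverse[OF st(2)] by blast
    obtain \<rho> where r: "\<rho> \<in> digraph_automorphisms \<Gamma>" "\<And>v. v \<in> V \<Longrightarrow> \<rho> v = \<tau>' (\<sigma> v)"
      using Aut_compose[OF t(1) st(1)] by blast
    have "\<rho> u = u" using r t st u by simp
    then have "\<tau>' (\<sigma> w) = w" if "w \<in> V" for w using PDR_free[OF r(1) u _ that] r that by simp
    then have eq: "\<sigma> w = \<tau> w" if "w \<in> V" for w using t(3) Aut_maps[OF st(1)] that by metis
    have "\<sigma> \<in> extensional V" "\<tau> \<in> extensional V"
      using st by (simp_all add: digraph_automorphisms_def Bij_def)
    then show "\<sigma> = \<tau>" using eq by (intro extensionalityI) auto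
  qed
  moreover have "card (digraph_automorphisms \<Gamma>) = order G"
  proof -
    have "Aut_digraph \<Gamma> \<cong> G" using pdr by (simp add: is_PDR_def)
    then obtain h where "bij_betw h (digraph_automorphisms \<Gamma>) (carrier G)"
      by (auto simp: is_iso_def iso_def)
    then show ?thesis by (simp add: order_def bij_betw_same_card)
  qed
  ultimately show ?thesis by (simp add: card_image)
qed

lemma orbit_eq_class:
  "u \<in> V \<Longrightarrow> orbit (Aut_digraph \<Gamma>) (\<lambda>\<sigma>. \<sigma>) u = {v \<in> V. u \<sim> v}"
  using Aut_maps by (auto simp: orbit_def same_orbit_def)

lemma card_PDR_vertices: "card V = order G * n"
proof -
  let ?O = "orbits (Aut_digraph \<Gamma>) V (\<lambda>\<sigma>. \<sigma>)"
  have O: "?O = (\<lambda>u. {v \<in> V. u \<sim> v}) ` V"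
    using orbit_eq_class by (auto simp: orbits_def)
  have U: "\<Union> ?O = V" unfolding O by (auto intro: same_orbit_refl)
  have "order G * card ?O = card (\<Union> ?O)"
  proof (rule card_partition)
    show "finite ?O" "finite (\<Union> ?O)" using pdr PDR_finite U by (simp_all add: is_PDR_def)
    show "card c = order G" if "c \<in> ?O" for c using that card_PDR_orbit unfolding O by auto
    fix c1 c2 assume c: "c1 \<in> ?O" "c2 \<in> ?O" "c1 \<noteq> c2"
    then obtain u1 u2 where u: "u1 \<in> V" "u2 \<in> V"
      "c1 = {v \<in> V. u1 \<sim> v}" "c2 = {v \<in> V. u2 \<sim> v}"
      unfolding O by auto
    show "c1 \<inter> c2 = {}"
    proof (rule ccontr)
      assume "c1 \<inter> c2 \<noteq> {}"
      then obtain w where w: "w \<in> V" "u1 \<sim> w" "u2 \<sim> w" using u by auto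
      have "u1 \<sim> u2"
        by (rule same_orbit_trans[OF u(1) w(2) same_orbit_sym[OF u(2) w(3)]])
      moreover have "u2 \<sim> u1"
        by (rule same_orbit_trans[OF u(2) w(3) same_orbit_sym[OF u(1) w(2)]])
      ultimately have "u1 \<sim> v \<longleftrightarrow> u2 \<sim> v" for v
        using same_orbit_trans[OF u(1)] same_orbit_trans[OF u(2)] by blast
      then have "c1 = c2" using u by simp
      then show False using c by simp
    qed
  qed
  then show ?thesis using pdr U by (simp add: is_PDR_def)
qed

lemma two_orbits:
  assumes "n = 2" "u \<in> V" "v \<in> V" "w \<in> V"
    and "\<not> u \<sim> v" "\<not> u \<sim> w"
  shows "v \<sim> w"
proof (rule ccontr)
  assume vw: "\<not> v \<sim> w"
  let ?c = "\<lambda>u. {v \<in> V. u \<sim> v}"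
  let ?O = "orbits (Aut_digraph \<Gamma>) V (\<lambda>\<sigma>. \<sigma>)"
  have "v \<in> ?c v" "w \<in> ?c w" using assms same_orbit_refl by simp_all
  moreover have "v \<notin> ?c u" "w \<notin> ?c u" "w \<notin> ?c v" using assms vw by simp_all
  ultimately have "?c u \<noteq> ?c v" "?c u \<noteq> ?c w" "?c v \<noteq> ?c w" by metis+
  then have c3: "card {?c u, ?c v, ?c w} = 3" by simp
  have sub: "{?c u, ?c v, ?c w} \<subseteq> ?O"
    using assms(2-4) by (auto simp: orbits_def orbit_eq_class[symmetric])
  have "finite ?O" using pdr by (simp add: is_PDR_def)
  then have "3 \<le> card ?O" using card_mono[OF _ sub] c3 by linarith
  then show False using pdr assms(1) by (simp add: is_PDR_def)
qed

text \<open>A transposition fixes every third vertex, so semiregularity leaves no room for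
  one.\<close>

lemma transposition_not_automorphism:
  assumes uv: "u \<in> V" "v \<in> V" "u \<noteq> v"
    and arc: "\<And>x y. x \<in> V \<Longrightarrow> y \<in> V \<Longrightarrow>
      (transpose u v x, transpose u v y) \<in> parcs \<Gamma> \<longleftrightarrow> (x, y) \<in> parcs \<Gamma>"
  shows "u \<sim> v" "V = {u, v}"
proof -
  have bij: "bij_betw (transpose u v) V V" using uv by simp
  show "u \<sim> v" using PDR_automorphism(1)[OF bij arc uv(1)] by simp
  show "V = {u, v}"
  proof (rule ccontr)
    assume "V \<noteq> {u, v}"
    then obtain w where "w \<in> V" "w \<noteq> u" "w \<noteq> v" using uv by blast
    then show False using PDR_automorphism(2)[OF bij arc, of w u] uv by simp
  qed
qed

lemma PDR_valency:
  obtains d where "biregular V (\<lambda>u v. (u, v) \<in> parcs \<Gamma>) d"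
  using regular_digraph_biregular[OF PDR_wf] pdr by (auto simp: is_PDR_def)

lemma biregular_cross: "biregular V (\<lambda>u v. \<not> u \<sim> v) (order G * (n - 1))"
  unfolding biregular_def
proof (intro ballI conjI)
  fix u assume u: "u \<in> V"
  have "{v \<in> V. \<not> u \<sim> v} = V - {v \<in> V. u \<sim> v}" by blast
  then show "card {v \<in> V. \<not> u \<sim> v} = order G * (n - 1)"
    using PDR_finite by (simp add: card_Diff_subset card_PDR_orbit[OF u] card_PDR_vertices diff_mult_distrib2)
  moreover have "v \<sim> u \<longleftrightarrow> u \<sim> v" if "v \<in> V" for v
    using same_orbit_sym[OF u] same_orbit_sym[OF that] by blast
  then have "{v \<in> V. \<not> v \<sim> u} = {v \<in> V. \<not> u \<sim> v}"
    by blast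
  ultimately show "card {v \<in> V. \<not> v \<sim> u} = order G * (n - 1)" by simp
qed

lemma biregular_complement:
  assumes E: "biregular V (\<lambda>u v. (u, v) \<in> parcs \<Gamma>) d"
  shows "biregular V (\<lambda>u v. \<not> u \<sim> v \<and> (u, v) \<notin> parcs \<Gamma>) (order G * (n - 1) - d)"
  unfolding biregular_def
proof (intro ballI conjI)
  fix u assume u: "u \<in> V"
  note c = biregular_cross[unfolded biregular_def, rule_format, OF u]
    and e = E[unfolded biregular_def, rule_format, OF u]
  have sub: "{v \<in> V. (u, v) \<in> parcs \<Gamma>} \<subseteq> {v \<in> V. \<not> u \<sim> v}"
    "{v \<in> V. (v, u) \<in> parcs \<Gamma>} \<subseteq> {v \<in> V. \<not> v \<sim> u}"
    using PDR_no_arc u by auto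
  have eq: "{v \<in> V. \<not> u \<sim> v \<and> (u, v) \<notin> parcs \<Gamma>} =
      {v \<in> V. \<not> u \<sim> v} - {v \<in> V. (u, v) \<in> parcs \<Gamma>}"
    "{v \<in> V. \<not> v \<sim> u \<and> (v, u) \<notin> parcs \<Gamma>} =
      {v \<in> V. \<not> v \<sim> u} - {v \<in> V. (v, u) \<in> parcs \<Gamma>}"
    by blast+
  show "card {v \<in> V. \<not> u \<sim> v \<and> (u, v) \<notin> parcs \<Gamma>} = order G * (n - 1) - d"
    unfolding eq by (subst card_Diff_subset[OF _ sub(1)]) (use PDR_finite c e in auto)
  show "card {v \<in> V. \<not> v \<sim> u \<and> (v, u) \<notin> parcs \<Gamma>} = order G * (n - 1) - d"
    unfolding eq by (subst card_Diff_subset[OF _ sub(2)]) (use PDR_finite c e in auto)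
qed

lemma order_G_pos: "order G > 0"
proof -
  obtain u where u: "u \<in> V" using pdr by (auto simp: is_PDR_def)
  have "card {v \<in> V. u \<sim> v} > 0"
    using PDR_finite u same_orbit_refl[OF u] by (subst card_gt_0_iff) auto
  then show ?thesis using card_PDR_orbit[OF u] by simp
qed

lemma trivial_same_orbit:
  assumes "order G = 1" "u \<in> V" "v \<in> V"
  shows "u \<sim> v \<longleftrightarrow> u = v"
proof
  assume s: "u \<sim> v"
  obtain w where w: "{v \<in> V. u \<sim> v} = {w}"
    using card_PDR_orbit[OF assms(2)] assms(1) by (auto simp: card_1_singleton_iff)
  have "u \<in> {v \<in> V. u \<sim> v}" "v \<in> {v \<in> V. u \<sim> v}"
    using assms s same_orbit_refl by auto
  then show "u = v" unfolding w by simp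
qed (use assms same_orbit_refl in auto)

text \<open>The Boolean \<open>b\<close> treats the edgeless and the complete multipartite digraph
  together. Both admit the transposition of two vertices of one orbit or, when the orbits are
  points, of any two vertices.\<close>

lemma PDR_not_multipartite:
  assumes n: "n \<ge> 2"
    and arc: "\<And>u v. u \<in> V \<Longrightarrow> v \<in> V \<Longrightarrow> (u, v) \<in> parcs \<Gamma> \<longleftrightarrow> b \<and> \<not> u \<sim> v"
  shows False
proof (cases "order G = 1")
  case True
  then have "card V \<ge> 2" using n by (simp add: card_PDR_vertices)
  then obtain u v where uv: "u \<in> V" "v \<in> V" "u \<noteq> v"
    by (auto simp: card_le_Suc_iff numeral_eq_Suc)
  have "u \<sim> v"
  proof (rule transposition_not_automorphism(1)[OF uv])
    fix x y assume xy: "x \<in> V" "y \<in> V"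
    then have "transpose u v x \<in> V" "transpose u v y \<in> V"
      using uv by (auto simp: transpose_def)
    then show "(transpose u v x, transpose u v y) \<in> parcs \<Gamma> \<longleftrightarrow> (x, y) \<in> parcs \<Gamma>"
      using xy by (simp add: arc trivial_same_orbit[OF True] inj_eq[OF inj_transpose])
  qed
  then show False using uv trivial_same_orbit[OF True] by blast
next
  case False
  then have big: "order G \<ge> 2" using order_G_pos by linarith
  obtain u where u: "u \<in> V" using pdr by (auto simp: is_PDR_def)
  let ?X = "{v \<in> V. u \<sim> v}"
  have "\<not> ?X \<subseteq> {u}"
  proof
    assume "?X \<subseteq> {u}"
    then have "card ?X \<le> 1" using card_mono[of "{u}" ?X] by simp
    then show False using big card_PDR_orbit[OF u] by simp
  qed
  then obtain v where v: "v \<in> V" "u \<sim> v" "v \<noteq> u" by blast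
  have vu: "v \<sim> u" by (rule same_orbit_sym[OF u v(2)])
  have move: "x \<sim> (transpose u v x)" "(transpose u v x) \<sim> x"
    "transpose u v x \<in> V" if "x \<in> V" for x
    using that u v vu same_orbit_refl[OF that] by (auto simp: transpose_def)
  have "V = {u, v}"
  proof (rule transposition_not_automorphism(2)[OF u v(1) v(3)[symmetric]])
    fix x y assume xy: "x \<in> V" "y \<in> V"
    have "(transpose u v x) \<sim> (transpose u v y) \<longleftrightarrow> x \<sim> y"
    proof
      assume s: "x \<sim> y"
      show "(transpose u v x) \<sim> (transpose u v y)"
        by (rule same_orbit_trans[OF move(3)[OF xy(1)] same_orbit_trans[OF move(3)[OF xy(1)] move(2)[OF xy(1)] s]
              move(1)[OF xy(2)]])
    next
      assume s: "(transpose u v x) \<sim> (transpose u v y)"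
      show "x \<sim> y"
        by (rule same_orbit_trans[OF xy(1) same_orbit_trans[OF xy(1) move(1)[OF xy(1)] s]
              move(2)[OF xy(2)]])
    qed
    then show "(transpose u v x, transpose u v y) \<in> parcs \<Gamma> \<longleftrightarrow> (x, y) \<in> parcs \<Gamma>"
      using arc xy move(3) by simp
  qed
  then have "card V \<le> 2" by (simp add: card_insert_if)
  moreover have "2 * 2 \<le> order G * n" by (rule mult_le_mono[OF big n])
  ultimately show False by (simp add: card_PDR_vertices)
qed

text \<open>At valency one the successor map is an automorphism, yet it moves a vertex along an arc
  and hence out of its orbit. The same map for the complement is an automorphism once it respects
  the orbit partition, which is where \<open>small\<close> enters.\<close>

lemma PDR_valency_bounds:
  assumes n: "n \<ge> 2" and small: "n = 2 \<or> order G = 1"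
    and E: "biregular V (\<lambda>u v. (u, v) \<in> parcs \<Gamma>) d"
  shows "1 < d" "d + 1 < order G * (n - 1)"
proof -
  let ?Q = "\<lambda>u v. \<not> u \<sim> v \<and> (u, v) \<notin> parcs \<Gamma>"
  have empty: "\<not> Q u v" if "biregular V Q 0" "u \<in> V" "v \<in> V" for Q u v
    using that PDR_finite unfolding biregular_def by auto
  have "d \<noteq> 0"
  proof
    assume "d = 0"
    then show False using empty[OF E[unfolded \<open>d = 0\<close>]] PDR_not_multipartite[OF n, of False] by auto
  qed
  moreover have "d \<noteq> 1"
  proof
    assume "d = 1"
    obtain f where f: "bij_betw f V V"
      and fV: "\<And>u. u \<in> V \<Longrightarrow> f u \<in> V"
      and inj: "\<And>u v. u \<in> V \<Longrightarrow> v \<in> V \<Longrightarrow> f u = f v \<longleftrightarrow> u = v"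
      and succ: "\<And>u v. u \<in> V \<Longrightarrow> v \<in> V \<Longrightarrow> (u, v) \<in> parcs \<Gamma> \<longleftrightarrow> v = f u"
      using biregular_1_function[OF PDR_finite E[unfolded \<open>d = 1\<close>]] by blast
    obtain u where u: "u \<in> V" using pdr by (auto simp: is_PDR_def)
    have "u \<sim> (f u)"
      by (rule PDR_automorphism(1)[OF f _ u]) (use succ fV inj in simp)
    then have "(u, f u) \<notin> parcs \<Gamma>" by (rule PDR_no_arc[OF u])
    then show False using succ u fV by blast
  qed
  ultimately show "1 < d" by linarith
  note Q = biregular_complement[OF E]
  have "order G * (n - 1) - d \<noteq> 0"
  proof
    assume "order G * (n - 1) - d = 0"
    then have "biregular V ?Q 0" using Q by simp
    from empty[OF this] show False
      by (intro PDR_not_multipartite[OF n, of True]) (use PDR_no_arc in auto)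
  qed
  moreover have "order G * (n - 1) - d \<noteq> 1"
  proof
    assume "order G * (n - 1) - d = 1"
    then have "biregular V ?Q 1" using Q by simp
    then obtain f where f: "bij_betw f V V"
      and fV: "\<And>u. u \<in> V \<Longrightarrow> f u \<in> V"
      and inj: "\<And>u v. u \<in> V \<Longrightarrow> v \<in> V \<Longrightarrow> f u = f v \<longleftrightarrow> u = v"
      and succ: "\<And>u v. u \<in> V \<Longrightarrow> v \<in> V \<Longrightarrow> ?Q u v \<longleftrightarrow> v = f u"
      using biregular_1_function[OF PDR_finite] by blast
    have other: "\<not> u \<sim> (f u)" if "u \<in> V" for u using succ[OF that fV[OF that]] by blast
    \<comment> \<open>If the orbits are points this is injectivity. If there are two orbits,
      \<open>f\<close> leaves the orbit of its argument and so interchanges them.\<close>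
    have same: "(f u) \<sim> (f v) \<longleftrightarrow> u \<sim> v"
      if uv: "u \<in> V" "v \<in> V" for u v
    proof (cases "order G = 1")
      case True
      then show ?thesis using uv fV inj by (simp add: trivial_same_orbit)
    next
      case False
      then have n2: "n = 2" using small by blast
      note fu = fV[OF uv(1)] and fv = fV[OF uv(2)]
      show ?thesis
      proof
        assume s: "u \<sim> v"
        have "\<not> u \<sim> (f v)"
          using other[OF uv(2)] same_orbit_trans[OF uv(2) same_orbit_sym[OF uv(1) s]] by blast
        then show "(f u) \<sim> (f v)"
          by (rule two_orbits[OF n2 uv(1) fu fv other[OF uv(1)]])
      next
        assume s: "(f u) \<sim> (f v)"
        have "\<not> (f u) \<sim> u" using other[OF uv(1)] same_orbit_sym[OF fu] by blast
        moreover have "\<not> (f u) \<sim> v"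
          using other[OF uv(2)] same_orbit_trans[OF fv same_orbit_sym[OF fu s]] same_orbit_sym[OF fv] by blast
        ultimately show "u \<sim> v" by (rule two_orbits[OF n2 fu uv])
      qed
    qed
    have arc: "(u, v) \<in> parcs \<Gamma> \<longleftrightarrow> \<not> u \<sim> v \<and> v \<noteq> f u"
      if "u \<in> V" "v \<in> V" for u v
      using succ[OF that] PDR_no_arc[OF that(1)] by blast
    obtain u where u: "u \<in> V" using pdr by (auto simp: is_PDR_def)
    have "u \<sim> (f u)"
      by (rule PDR_automorphism(1)[OF f _ u]) (simp add: arc fV inj same)
    then show False using other[OF u] by blast
  qed
  ultimately show "d + 1 < order G * (n - 1)" by linarith
qed

lemma one_PDR_order:
  assumes "n = 1"
  shows "order G \<le> 2"
proof (rule ccontr)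
  assume big: "\<not> order G \<le> 2"
  obtain u where u: "u \<in> V" using pdr by (auto simp: is_PDR_def)
  have "{v \<in> V. u \<sim> v} = V"
    using PDR_finite card_PDR_orbit[OF u] card_PDR_vertices assms by (intro card_subset_eq) auto
  then have all: "u \<sim> v" if "v \<in> V" for v using that by blast
  have no: "(x, y) \<notin> parcs \<Gamma>" if "x \<in> V" "y \<in> V" for x y
    by (rule PDR_no_arc[OF that(1)])
      (rule same_orbit_trans[OF that(1) same_orbit_sym[OF u all[OF that(1)]] all[OF that(2)]])
  have "\<not> V \<subseteq> {u}"
  proof
    assume "V \<subseteq> {u}"
    then have "card V \<le> 1" using card_mono[of "{u}" "V"] by simp
    then show False using big assms by (simp add: card_PDR_vertices)
  qed
  then obtain v where v: "v \<in> V" "u \<noteq> v" by blast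
  have "V = {u, v}"
  proof (rule transposition_not_automorphism(2)[OF u v])
    fix x y assume xy: "x \<in> V" "y \<in> V"
    then have "transpose u v x \<in> V" "transpose u v y \<in> V"
      using u v by (auto simp: transpose_def)
    then show "(transpose u v x, transpose u v y) \<in> parcs \<Gamma> \<longleftrightarrow> (x, y) \<in> parcs \<Gamma>"
      using no xy by blast
  qed
  then have "card V \<le> 2" by (simp add: card_insert_if)
  then show False using big assms by (simp add: card_PDR_vertices)
qed

end

section \<open>Finite searches\<close>

text \<open>Depth-first search through the lists whose prefixes all satisfy \<open>P\<close>, checking \<open>Q\<close> at the leaves.\<close>

fun prefix_search :: "('a list \<Rightarrow> 'a list) \<Rightarrow> ('a list \<Rightarrow> bool) \<Rightarrow> ('a list \<Rightarrow> bool) \<Rightarrow> nat \<Rightarrow> 'a list \<Rightarrow> bool" where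
  "prefix_search C P Q 0 c = Q c"
| "prefix_search C P Q (Suc n) c = list_all (\<lambda>v. if P (c @ [v]) then prefix_search C P Q n (c @ [v]) else True) (C c)"

lemma prefix_search_sound:
  assumes "prefix_search C P Q n c" "length w = n"
    and "\<And>i. i < n \<Longrightarrow> w ! i \<in> set (C (c @ take i w)) \<and> P (c @ take (Suc i) w)"
  shows "Q (c @ w)"
  using assms
proof (induction n arbitrary: c w)
  case (Suc n)
  then obtain v w' where w: "w = v # w'" "length w' = n" by (cases w) auto
  have "v \<in> set (C c)" "P (c @ [v])" using Suc.prems(3)[of 0] w by auto
  then have "prefix_search C P Q n (c @ [v])" using Suc.prems(1) by (auto simp: list_all_iff)
  moreover have "w' ! i \<in> set (C ((c @ [v]) @ take i w')) \<and> P ((c @ [v]) @ take (Suc i) w')" if "i < n" for i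
    using Suc.prems(3)[of "Suc i"] that w by simp
  ultimately have "Q ((c @ [v]) @ w')" using Suc.IH w(2) by blast
  then show ?case using w by simp
qed simp

text \<open>Bitwise exclusive or on \<open>{..<8}\<close>, tabulated for the benefit of \<open>code_simp\<close>.\<close>

definition xor_table :: "nat \<Rightarrow> nat \<Rightarrow> nat" where
  "xor_table i j =
    [
    [0, 1, 2, 3, 4, 5, 6, 7], [1, 0, 3, 2, 5, 4, 7, 6], [2, 3, 0, 1, 6, 7, 4, 5],
    [3, 2, 1, 0, 7, 6, 5, 4], [4, 5, 6, 7, 0, 1, 2, 3], [5, 4, 7, 6, 1, 0, 3, 2],
    [6, 7, 4, 5, 2, 3, 0, 1], [7, 6, 5, 4, 3, 2, 1, 0]] ! i ! j"

text \<open>A permutation given by its list of values is affine over the field of order 2 when it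
  respects sums of three points, here \<open>i\<close>, \<open>j\<close> and 0. For
  \<open>m = 4\<close> only the corner of the table with entries below 4 is consulted.\<close>

definition affine_list :: "nat \<Rightarrow> nat list \<Rightarrow> bool" where
  "affine_list m p \<longleftrightarrow> length p = m \<and> distinct p \<and> list_all (\<lambda>x. x < m) p \<and>
     list_all (\<lambda>i. list_all (\<lambda>j. p ! xor_table i j = xor_table (xor_table (p ! i) (p ! j)) (p ! 0)) [0..<m]) [0..<m]"

text \<open>
  Entry \<open>k\<close> lists the \<open>a < b < d < k\<close> such that \<open>{a, b, d, k}\<close> is a plane of the affine space \<open>{..<8}\<close>.
  A colouring that is constant on both pairs of a partition of a plane into two pairs is preserved
  by the affine map that swapping_maps each pair and fixes the points off the plane. The colourings without
  such a plane form a single orbit of the affine group; for any two of the four colours, one of the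
  42 maps in \<open>swapping_maps\<close> interchanges them and preserves the others.
\<close>

definition plane_triples :: "(nat \<times> nat \<times> nat) list list" where
  "plane_triples =
    [[], [], [], [(0, 1, 2)], [], [(0, 1, 4), (2, 3, 4)], [(0, 2, 4), (0, 3, 5), (1, 2, 5), (1, 3, 4)], [(0, 1, 6), (0, 2, 5), (0, 3, 4), (1, 2, 4), (1, 3, 5), (2, 3, 6), (4, 5, 6)]]"

definition swapping_maps :: "nat list list" where
  "swapping_maps =
    [
    [2, 3, 0, 1, 7, 6, 5, 4], [3, 2, 1, 0, 6, 7, 4, 5], [1, 0, 3, 2, 7, 6, 5, 4],
    [3, 2, 1, 0, 5, 4, 7, 6], [1, 0, 3, 2, 6, 7, 4, 5], [2, 3, 0, 1, 5, 4, 7, 6],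
    [4, 5, 7, 6, 0, 1, 3, 2], [5, 4, 6, 7, 1, 0, 2, 3], [6, 7, 5, 4, 3, 2, 0, 1],
    [7, 6, 4, 5, 2, 3, 1, 0], [1, 0, 5, 4, 3, 2, 7, 6], [7, 6, 3, 2, 5, 4, 1, 0],
    [1, 0, 4, 5, 2, 3, 7, 6], [6, 7, 3, 2, 5, 4, 0, 1], [1, 0, 7, 6, 5, 4, 3, 2],
    [5, 4, 3, 2, 1, 0, 7, 6], [1, 0, 6, 7, 5, 4, 2, 3], [4, 5, 3, 2, 0, 1, 7, 6],
    [4, 6, 5, 7, 0, 2, 1, 3], [7, 5, 6, 4, 3, 1, 2, 0], [5, 7, 4, 6, 2, 0, 3, 1],
    [6, 4, 7, 5, 1, 3, 0, 2], [4, 7, 6, 5, 0, 3, 2, 1], [6, 5, 4, 7, 2, 1, 0, 3],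
    [5, 6, 7, 4, 3, 0, 1, 2], [7, 4, 5, 6, 1, 2, 3, 0], [2, 6, 0, 4, 3, 7, 1, 5],
    [7, 3, 5, 1, 6, 2, 4, 0], [3, 7, 4, 0, 2, 6, 5, 1], [6, 2, 1, 5, 7, 3, 0, 4],
    [2, 7, 0, 5, 6, 3, 4, 1], [6, 3, 4, 1, 2, 7, 0, 5], [3, 6, 5, 0, 7, 2, 1, 4],
    [7, 2, 1, 4, 3, 6, 5, 0], [2, 4, 0, 6, 1, 7, 3, 5], [5, 3, 7, 1, 6, 0, 4, 2],
    [3, 5, 6, 0, 7, 1, 2, 4], [4, 2, 1, 7, 0, 6, 5, 3], [2, 5, 0, 7, 6, 1, 4, 3],
    [4, 3, 6, 1, 0, 7, 2, 5], [3, 4, 7, 0, 1, 6, 5, 2], [5, 2, 1, 6, 7, 0, 3, 4]]"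

definition bad_pairing :: "'a list \<Rightarrow> nat \<Rightarrow> nat \<times> nat \<times> nat \<Rightarrow> bool" where
  "bad_pairing c k = (\<lambda>(a, b, d). c ! a = c ! b \<and> c ! d = c ! k \<or> c ! a = c ! d \<and> c ! b = c ! k \<or>
     c ! b = c ! d \<and> c ! a = c ! k)"

text \<open>Only planes whose largest point is the one just coloured are examined; over all prefixes
  this covers every plane once.\<close>

definition rigid_prefix :: "'a list \<Rightarrow> bool" where
  "rigid_prefix c \<longleftrightarrow> (let k = length c - 1 in \<not> list_ex (bad_pairing c k) (plane_triples ! k))"

definition swaps_labels :: "nat list \<Rightarrow> nat \<Rightarrow> nat \<Rightarrow> bool" where
  "swaps_labels w a b \<longleftrightarrow> list_ex (\<lambda>p. list_all (\<lambda>i. w ! (p ! i) = (if w ! i = a then b else if w ! i = b then a else w ! i))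
     [0..<8]) swapping_maps"

text \<open>A new label may exceed the number of labels used so far by nothing, so colourings are
  enumerated up to renaming of the colours. The renaming forgets which two labels stand for the
  one-directional colours, hence the leaf test asks for an exchange of every pair of labels.\<close>

lemma search_8:
  "prefix_search (\<lambda>w. [0..<min 4 (Suc (length (remdups w)))]) rigid_prefix
     (\<lambda>w. list_all (\<lambda>a. a \<in> set w \<and> list_all (\<lambda>b. swaps_labels w a b) [0..<a]) [0..<4]) 8 []"
  by code_simp

definition pair_swap :: "nat \<Rightarrow> nat \<Rightarrow> nat \<Rightarrow> nat \<Rightarrow> nat list" where
  "pair_swap a b d k = map (transpose a b \<circ> transpose d k) [0..<8]"

lemma swapping_maps_affine: "list_all (affine_list 8) swapping_maps"
  by code_simp

text \<open>On the plane the map is translation by the difference of the two points of a pair, a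
  direction of the plane; off the plane it is the identity. As the indicator of a plane is an affine
  function, this is an affine transvection.\<close>

lemma pair_swap_affine:
  "list_all (\<lambda>k. list_all (\<lambda>(a, b, d). a < b \<and> b < d \<and> d < k \<and>
     affine_list 8 (pair_swap a b d k) \<and> affine_list 8 (pair_swap a d b k) \<and>
     affine_list 8 (pair_swap b d a k)) (plane_triples ! k)) [0..<8]"
  by code_simp

text \<open>The affine group of the plane of order 2 is the full symmetric group on its four
  points.\<close>

lemma transpose_affine:
  "list_all (\<lambda>j. list_all (\<lambda>i. affine_list 4 (map (transpose i j) [0..<4])) [0..<j]) [0..<4]"
  by code_simp

text \<open>Every colouring factors through one whose labels are numbered in order of first occurrence.\<close>

lemma canonical_labels:
  fixes c :: "nat \<Rightarrow> 'c"
  shows "\<exists>w \<pi>. length w = n \<and> distinct \<pi> \<and> set w = {..<length \<pi>} \<and> (\<forall>i<n. \<pi> ! (w ! i) = c i) \<and>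
    (\<forall>i<n. w ! i \<le> card (set (take i w)))"
proof (induction n)
  case 0
  show ?case by (intro exI[of _ "[]"]) auto
next
  case (Suc n)
  then obtain w \<pi> where w: "length w = n" "distinct \<pi>" "set w = {..<length \<pi>}"
    "\<And>i. i < n \<Longrightarrow> \<pi> ! (w ! i) = c i" "\<And>i. i < n \<Longrightarrow> w ! i \<le> card (set (take i w))" by blast
  have lab: "w ! i < length \<pi>" if "i < n" for i using w(1,3) that nth_mem by blast
  show ?case
  proof (cases "c n \<in> set \<pi>")
    case True
    then obtain j where j: "j < length \<pi>" "\<pi> ! j = c n" by (auto simp: in_set_conv_nth)
    have "\<pi> ! ((w @ [j]) ! i) = c i \<and> (w @ [j]) ! i \<le> card (set (take i (w @ [j])))"
      if "i < Suc n" for i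
    proof (cases "i = n")
      case True
      then show ?thesis using w(1,3) j by (simp add: nth_append)
    next
      case False
      then show ?thesis using that w by (simp add: nth_append)
    qed
    note all = this
    show ?thesis
    proof (intro exI conjI allI impI)
      show "length (w @ [j]) = Suc n" "distinct \<pi>" "set (w @ [j]) = {..<length \<pi>}"
        using w(1-3) j by auto
      show "\<pi> ! ((w @ [j]) ! i) = c i" "(w @ [j]) ! i \<le> card (set (take i (w @ [j])))"
        if "i < Suc n" for i using all[OF that] by blast+
    qed
  next
    case False
    let ?w = "w @ [length \<pi>]" and ?\<pi> = "\<pi> @ [c n]"
    have "?\<pi> ! (?w ! i) = c i \<and> ?w ! i \<le> card (set (take i ?w))" if "i < Suc n" for i
    proof (cases "i = n")
      case True
      then show ?thesis using w(1,3) by (simp add: nth_append)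
    next
      case False
      then show ?thesis using that w lab[of i] by (simp add: nth_append)
    qed
    note all = this
    show ?thesis
    proof (intro exI conjI allI impI)
      show "length ?w = Suc n" "distinct ?\<pi>" "set ?w = {..<length ?\<pi>}"
        using w(1-3) False by (simp_all add: lessThan_Suc)
      show "?\<pi> ! (?w ! i) = c i" "?w ! i \<le> card (set (take i ?w))"
        if "i < Suc n" for i using all[OF that] by blast+
    qed
  qed
qed

lemma pair_swap_preserves:
  assumes "c a = c b" "c d = c k" "i < 8"
  shows "c (pair_swap a b d k ! i) = c i"
proof -
  have swap: "c (transpose u v x) = c x" if "c u = c v" for u v x
    using that unfolding transpose_def by presburger
  show ?thesis using assms(3) swap[OF assms(1)] swap[OF assms(2)] by (simp add: pair_swap_def)
qed

lemma pair_swap_moves: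
  assumes "a \<noteq> b" "a \<noteq> d" "a \<noteq> k" "a < 8"
  shows "pair_swap a b d k \<noteq> [0..<8]"
proof
  assume e: "pair_swap a b d k = [0..<8]"
  have "pair_swap a b d k ! a = b" using assms by (simp add: pair_swap_def)
  then show False using assms by (simp add: e)
qed

text \<open>The two components of a colour record the arcs in the two directions between the layers,
  so \<open>prod.swap\<close> belongs to exchanging the layers. Nontriviality of \<open>p\<close> is
  asked only in the first alternative: an exchange of the layers is never trivial.\<close>

definition affine_symmetric :: "nat \<Rightarrow> (nat \<Rightarrow> bool \<times> bool) \<Rightarrow> bool" where
  "affine_symmetric m c \<longleftrightarrow> (\<exists>p. affine_list m p \<and>
     (p \<noteq> [0..<m] \<and> (\<forall>i<m. c (p ! i) = c i) \<or> (\<forall>i<m. c (p ! i) = prod.swap (c i))))"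

lemma card_UNIV_bool_pairs: "card (UNIV :: (bool \<times> bool) set) = 4"
  unfolding UNIV_Times_UNIV[symmetric] card_cartesian_product by simp

lemma affine_symmetric_8: "affine_symmetric 8 c"
proof -
  obtain w \<pi> where w: "length w = 8" "distinct \<pi>" "set w = {..<length \<pi>}"
    "\<And>i. i < 8 \<Longrightarrow> \<pi> ! (w ! i) = c i" "\<And>i. i < 8 \<Longrightarrow> w ! i \<le> card (set (take i w))"
    using canonical_labels[of 8 c] by blast
  have lab: "w ! i < length \<pi>" if "i < 8" for i using w(1,3) that nth_mem by fastforce
  have col: "c i = c j \<longleftrightarrow> w ! i = w ! j" if "i < 8" "j < 8" for i j
    using w(4)[OF that(1)] w(4)[OF that(2)] lab that w(2) nth_eq_iff_index_eq by metis
  have len4: "length \<pi> \<le> 4"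
    using card_mono[of UNIV "set \<pi>"] distinct_card[OF w(2)] card_UNIV_bool_pairs by simp
  show ?thesis
  proof (cases "\<forall>i<8. rigid_prefix (take (Suc i) w)")
    case True
    have "w ! i \<in> set [0..<min 4 (Suc (length (remdups (take i w))))]" if "i < 8" for i
      unfolding set_upt atLeastLessThan_iff length_remdups_card_conv
      using lab[OF that] len4 w(5)[OF that] by linarith
    then have Q: "list_all (\<lambda>a. a \<in> set w \<and> list_all (\<lambda>b. swaps_labels w a b) [0..<a]) [0..<4]"
      using prefix_search_sound[OF search_8 w(1)] True by simp
    \<comment> \<open>All four labels occur, so \<open>\<pi>\<close> lists all colours, in
      particular both one-directional ones.\<close>
    then have "3 \<in> set w" by (simp add: list_all_iff)
    then have len: "length \<pi> = 4" using len4 w(3) by auto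
    then have "set \<pi> = UNIV"
      using distinct_card[OF w(2)] card_UNIV_bool_pairs by (intro card_subset_eq) auto
    then obtain a b where ab: "a < 4" "\<pi> ! a = (True, False)" "b < 4" "\<pi> ! b = (False, True)"
      using len by (metis UNIV_I in_set_conv_nth)
    \<comment> \<open>The search compares a label only with smaller ones; the hypothesis on
      unordered pairs leaves open which of the two stands for \<open>(True, False)\<close>.\<close>
    have swapped: "affine_symmetric 8 c"
      if xy: "x < 4" "y < x" "{\<pi> ! x, \<pi> ! y} = {(True, False), (False, True)}" for x y
    proof -
      have "swaps_labels w x y" using Q xy by (simp add: list_all_iff)
      then obtain p where p: "p \<in> set swapping_maps"
        "\<And>i. i < 8 \<Longrightarrow> w ! (p ! i) = (if w ! i = x then y else if w ! i = y then x else w ! i)"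
        unfolding swaps_labels_def list_ex_iff list_all_iff by auto
      have aff: "affine_list 8 p" using p(1) swapping_maps_affine by (simp add: list_all_iff)
      have "c (p ! i) = prod.swap (c i)" if i: "i < 8" for i
      proof -
        have pi: "p ! i < 8" using aff i unfolding affine_list_def list_all_iff by (metis nth_mem)
        have sw: "prod.swap (\<pi> ! x) = \<pi> ! y" "prod.swap (\<pi> ! y) = \<pi> ! x"
          using xy(3) by (auto simp: doubleton_eq_iff)
        have ci: "c i = \<pi> ! (w ! i)" and cp: "c (p ! i) = \<pi> ! (w ! (p ! i))"
          using w(4) i pi by simp_all
        consider "w ! i = x" | "w ! i = y" | "w ! i \<noteq> x" "w ! i \<noteq> y" by blast
        then show ?thesis
        proof cases
          case 1 then show ?thesis using p(2)[OF i] ci cp sw by simp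
        next
          case 2 then show ?thesis using p(2)[OF i] ci cp sw xy(2) by simp
        next
          case 3
          then have "\<pi> ! (w ! i) \<noteq> \<pi> ! x" "\<pi> ! (w ! i) \<noteq> \<pi> ! y"
            using lab[OF i] len xy w(2) by (simp_all add: nth_eq_iff_index_eq)
          then have "c i \<notin> {(True, False), (False, True)}" unfolding xy(3)[symmetric] ci by simp
          then have "prod.swap (c i) = c i" by (cases "c i") auto
          then show ?thesis using p(2)[OF i] 3 ci cp by simp
        qed
      qed
      then show ?thesis unfolding affine_symmetric_def using aff by blast
    qed
    have "a \<noteq> b" using ab by auto
    then consider "b < a" | "a < b" by linarith
    then show ?thesis using swapped[of a b] swapped[of b a] ab by cases auto
  next
    case False
    then obtain k where k: "k < 8" "\<not> rigid_prefix (take (Suc k) w)" by blast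
    then obtain a b d where t: "(a, b, d) \<in> set (plane_triples ! k)"
      "bad_pairing (take (Suc k) w) k (a, b, d)"
      using w(1) by (auto simp: rigid_prefix_def list_ex_iff Let_def)
    from k(1) t(1) have lt: "a < b" "b < d" "d < k" and aff: "affine_list 8 (pair_swap a b d k)"
      "affine_list 8 (pair_swap a d b k)" "affine_list 8 (pair_swap b d a k)"
      using pair_swap_affine by (auto simp: list_all_iff)
    \<comment> \<open>A prefix that fails provides a plane split into two monochromatic pairs, and
      exchanging the points of each pair preserves the colouring.\<close>
    have sym: "affine_symmetric 8 c"
      if "affine_list 8 (pair_swap u v y z)" "c u = c v" "c y = c z" "u \<notin> {v, y, z}" "u < 8" for u v y z
      unfolding affine_symmetric_def
      using that pair_swap_preserves[of c u v y z] pair_swap_moves[of u v y z] by auto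
    have "c a = c b \<and> c d = c k \<or> c a = c d \<and> c b = c k \<or> c b = c d \<and> c a = c k"
      using t(2) lt k(1) w(1) by (auto simp: bad_pairing_def col)
    then show ?thesis
      using sym[OF aff(1)] sym[OF aff(2)] sym[OF aff(3)] lt k(1) by auto
  qed
qed

text \<open>A transposition always suffices: of two points with a common colour if there are any,
  and otherwise of the points carrying the two one-directional colours.\<close>

lemma affine_symmetric_4: "affine_symmetric 4 c"
proof -
  have aff: "affine_list 4 (map (transpose i j) [0..<4])" if ij: "i < 4" "j < 4" "i \<noteq> j" for i j
  proof -
    consider "i < j" | "j < i" using ij by linarith
    then show ?thesis
    proof cases
      case 1
      then show ?thesis using transpose_affine ij by (simp add: list_all_iff)
    next
      case 2
      then show ?thesis
        using transpose_affine ij unfolding transpose_commute[of i j] by (simp add: list_all_iff)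
    qed
  qed
  show ?thesis
  proof (cases "inj_on c {..<4}")
    case False
    then obtain i j where ij: "i < 4" "j < 4" "i \<noteq> j" "c i = c j" by (auto simp: inj_on_def)
    let ?p = "map (transpose i j) [0..<4]"
    have "?p ! i \<noteq> [0..<4] ! i" using ij by simp
    then have "?p \<noteq> [0..<4]" by metis
    moreover have "c (?p ! l) = c l" if "l < 4" for l using that ij by (auto simp: transpose_def)
    ultimately show ?thesis unfolding affine_symmetric_def using aff[OF ij(1-3)] by blast
  next
    case True
    have "card (c ` {..<4}) = card (UNIV :: (bool \<times> bool) set)"
      using card_image[OF True] by (simp add: card_UNIV_bool_pairs)
    then have "c ` {..<4} = UNIV" by (intro card_subset_eq) auto
    then obtain i j where ij: "i < 4" "c i = (True, False)" "j < 4" "c j = (False, True)"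
      by (metis UNIV_I imageE lessThan_iff)
    have ne: "i \<noteq> j" using ij by auto
    let ?p = "map (transpose i j) [0..<4]"
    have "c (?p ! l) = prod.swap (c l)" if l: "l < 4" for l
    proof -
      have "l = i \<or> l = j \<or> c l \<notin> {(True, False), (False, True)}"
        using inj_onD[OF True, of l] ij l by auto
      then show ?thesis using ij l ne by (cases "c l") (auto simp: transpose_def)
    qed
    then show ?thesis unfolding affine_symmetric_def using aff[OF ij(1,3) ne] by blast
  qed
qed

section \<open>Two orbits over elementary abelian 2-groups\<close>

text \<open>Affine for groups in which every element is its own inverse: the last factor cancels the
  surplus constant term.\<close>

definition affine_bij :: "('g, 'm) monoid_scheme \<Rightarrow> ('g \<Rightarrow> 'g) \<Rightarrow> bool" where
  "affine_bij G \<alpha> \<longleftrightarrow> bij_betw \<alpha> (carrier G) (carrier G) \<and>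
     (\<forall>x\<in>carrier G. \<forall>y\<in>carrier G.
        \<alpha> (x \<otimes>\<^bsub>G\<^esub> y) = \<alpha> x \<otimes>\<^bsub>G\<^esub> \<alpha> y \<otimes>\<^bsub>G\<^esub> \<alpha> \<one>\<^bsub>G\<^esub>)"

text \<open>Vertices get coordinates in \<open>G\<close> times a Boolean layer, and arcs depend only
  on \<open>x \<otimes> y\<close>, which is the quotient because elements are their own inverses. An
  affine map that preserves or swaps the colours lifts to a digraph automorphism; it must be trivial
  in the first case, and in the second it would move a vertex to the other orbit.\<close>

lemma (in comm_group) two_PDR_colouring:
  assumes pdr: "is_PDR 2 G \<Gamma>" and fin: "finite (carrier G)"
    and sq: "\<And>x. x \<in> carrier G \<Longrightarrow> x \<otimes> x = \<one>"
  obtains c :: "'a \<Rightarrow> bool \<times> bool"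
  where "\<And>\<alpha>. affine_bij G \<alpha> \<Longrightarrow> \<forall>x\<in>carrier G. c (\<alpha> x) = c x \<Longrightarrow> \<forall>x\<in>carrier G. \<alpha> x = x"
    and "\<And>\<alpha>. affine_bij G \<alpha> \<Longrightarrow> \<forall>x\<in>carrier G. c (\<alpha> x) = prod.swap (c x) \<Longrightarrow> False"
proof -
  let ?V = "pverts \<Gamma>" and ?A = "digraph_automorphisms \<Gamma>"
  have "G \<cong> Aut_digraph \<Gamma>"
    using pdr group.iso_sym[OF group_Aut_digraph] by (auto simp: is_PDR_def)
  then obtain h where hom: "h \<in> hom G (Aut_digraph \<Gamma>)" and hbij: "bij_betw h (carrier G) ?A"
    by (auto simp: is_iso_def iso_def)
  have hA: "h x \<in> ?A" if "x \<in> carrier G" for x using bij_betw_apply[OF hbij that] .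
  have hh: "h x (h y v) = h (x \<otimes> y) v" if "x \<in> carrier G" "y \<in> carrier G" "v \<in> ?V" for x y v
    using hom_mult[OF hom that(1,2)] that by (simp add: mult_Aut_digraph hA compose_def)
  have h1: "h \<one> v = v" if "v \<in> ?V" for v
    using hom_one[OF hom is_group group_Aut_digraph] that by simp
  obtain u0 where u0: "u0 \<in> ?V" using pdr by (auto simp: is_PDR_def)
  have "\<exists>u1\<in>?V. \<not> same_orbit \<Gamma> u0 u1"
  proof (rule ccontr)
    assume "\<not> ?thesis"
    then have "{v \<in> ?V. same_orbit \<Gamma> u0 v} = ?V" by blast
    then have "order G = order G * 2" using card_PDR_orbit[OF pdr fin u0] card_PDR_vertices[OF pdr fin] by simp
    then show False using order_G_pos[OF pdr fin] by simp
  qed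
  then obtain u1 where u1: "u1 \<in> ?V" "\<not> same_orbit \<Gamma> u0 u1" by blast
  define base where "base b = (if b then u1 else u0)" for b
  have base: "base b \<in> ?V" for b using u0 u1 by (simp add: base_def)
  \<comment> \<open>Coordinates: layer \<open>b\<close> is the orbit of \<open>base b\<close>, on
    which the group acts regularly.\<close>
  define W where "W = (\<lambda>(x, b). h x (base b))"
  let ?D = "carrier G \<times> (UNIV :: bool set)"
  have same: "same_orbit \<Gamma> (base b) v \<longleftrightarrow> (\<exists>x\<in>carrier G. v = h x (base b))" for b v
    unfolding same_orbit_def bij_betw_imp_surj_on[OF hbij, symmetric] by auto
  have sameW: "same_orbit \<Gamma> (W (x, b)) (W (y, b'))  \<longleftrightarrow> b = b'"
    if xy: "x \<in> carrier G" "y \<in> carrier G" for x y b b'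
  proof -
    have W: "same_orbit \<Gamma> (base b) (W (z, b))" "W (z, b) \<in> ?V" if "z \<in> carrier G" for z b
      using that same Aut_maps[OF hA[OF that] base] by (auto simp: W_def)
    note sym = same_orbit_sym and trans = same_orbit_trans
    show ?thesis
    proof
      assume "same_orbit \<Gamma> (W (x, b)) (W (y, b'))"
      then have "same_orbit \<Gamma> (base b) (W (y, b'))" by (rule trans[OF base W(1)[OF xy(1)]])
      then have "same_orbit \<Gamma> (base b) (base b')"
        by (rule trans[OF base _ sym[OF base W(1)[OF xy(2)]]])
      then show "b = b'" using u1(2) same_orbit_sym[OF u1(1), of u0] unfolding base_def by (auto split: if_splits)
    next
      assume "b = b'"
      then show "same_orbit \<Gamma> (W (x, b)) (W (y, b'))"
        using trans[OF W(2)[OF xy(1)] sym[OF base W(1)[OF xy(1)]] W(1)[OF xy(2)]] by simp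
    qed
  qed
  have WV: "W p \<in> ?V" if "p \<in> ?D" for p
    using that Aut_maps[OF hA base] by (auto simp: W_def)
  have Winj: "inj_on W ?D"
  proof (rule inj_onI)
    fix p q assume pq: "p \<in> ?D" "q \<in> ?D" "W p = W q"
    obtain x b y b' where [simp]: "p = (x, b)" "q = (y, b')" and xy: "x \<in> carrier G" "y \<in> carrier G"
      using pq by (cases p; cases q) auto
    have "same_orbit \<Gamma> (W p) (W q)" using same_orbit_refl[OF WV[OF pq(1)]] pq(3) by simp
    then have b: "b = b'" using sameW[OF xy] by simp
    have "h x (base b) = h y (base b)" using pq(3) b by (simp add: W_def)
    then have "h y (h x (base b)) = h y (h y (base b))" by simp
    then have "h (y \<otimes> x) (base b) = base b" using xy base by (simp add: hh sq h1)
    then have "h (y \<otimes> x) v = h \<one> v" if "v \<in> ?V" for v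
      using PDR_free[OF pdr fin hA base _ that] xy that h1 by simp
    then have "h (y \<otimes> x) = h \<one>"
      using hA[of "y \<otimes> x"] hA[of \<one>] xy
      by (intro extensionalityI[of _ ?V]) (auto simp: digraph_automorphisms_def Bij_def)
    then have "y \<otimes> x = \<one>" using bij_betw_imp_inj_on[OF hbij] xy by (auto dest!: inj_onD)
    then have "y = inv x" using inv_equality[of y x] xy by simp
    moreover have "inv x = x" using sq xy inv_equality by simp
    ultimately show "p = q" using b by simp
  qed
  have "card (W ` ?D) = card ?V"
    using card_image[OF Winj] card_PDR_vertices[OF pdr fin]
    by (simp add: card_cartesian_product order_def)
  then have Wsurj: "W ` ?D = ?V"
    using PDR_finite[OF pdr fin] WV by (intro card_subset_eq) auto
  define col where "col b z \<longleftrightarrow> (base b, h z (base (\<not> b))) \<in> parcs \<Gamma>" for b z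
  have arcW: "(W (x, b), W (y, b')) \<in> parcs \<Gamma> \<longleftrightarrow> b \<noteq> b' \<and> col b (x \<otimes> y)"
    if xy: "x \<in> carrier G" "y \<in> carrier G" for x y b b'
  proof (cases "b = b'")
    case True
    then have "same_orbit \<Gamma> (W (x, b)) (W (y, b'))" using sameW[OF xy] by simp
    then show ?thesis using PDR_no_arc[OF pdr fin WV] xy True by auto
  next
    case False
    then have b': "b' = (\<not> b)" by blast
    have "x \<otimes> (x \<otimes> y) = y" using xy sq by (simp flip: m_assoc)
    then have "W (y, b') = h x (h (x \<otimes> y) (base b'))" using xy base by (simp add: W_def hh)
    moreover have "(h x (base b), h x (h (x \<otimes> y) (base b'))) \<in> parcs \<Gamma> \<longleftrightarrow>
        (base b, h (x \<otimes> y) (base b')) \<in> parcs \<Gamma>"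
      using hA[OF xy(1)] base[of b] Aut_maps[OF hA[of "x \<otimes> y"] base[of b']] xy
      by (simp add: digraph_automorphisms_def)
    ultimately show ?thesis using False b' by (simp add: W_def col_def)
  qed
  have lift: "same_orbit \<Gamma> (W p) (W (F p))" "W (F p) = W p \<Longrightarrow> q \<in> ?D \<Longrightarrow> F q = q"
    if F: "bij_betw F ?D ?D"
      and FW: "\<And>p q. p \<in> ?D \<Longrightarrow> q \<in> ?D \<Longrightarrow> (W (F p), W (F q)) \<in> parcs \<Gamma> \<longleftrightarrow> (W p, W q) \<in> parcs \<Gamma>"
      and p: "p \<in> ?D" for F p q
  proof -
    let ?\<sigma> = "W \<circ> (F \<circ> inv_into ?D W)"
    have Wbij: "bij_betw W ?D ?V" using Winj Wsurj by (simp add: bij_betw_def)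
    have bij: "bij_betw ?\<sigma> ?V ?V"
      by (rule bij_betw_trans[OF bij_betw_trans[OF bij_betw_inv_into[OF Wbij] F] Wbij])
    have \<sigma>W: "?\<sigma> (W p) = W (F p)" if "p \<in> ?D" for p using inv_into_f_f[OF Winj that] by simp
    have arc: "(?\<sigma> u, ?\<sigma> v) \<in> parcs \<Gamma> \<longleftrightarrow> (u, v) \<in> parcs \<Gamma>" if uv: "u \<in> ?V" "v \<in> ?V" for u v
    proof -
      have "u \<in> W ` ?D" "v \<in> W ` ?D" using uv unfolding Wsurj .
      then obtain p q where "p \<in> ?D" "q \<in> ?D" "u = W p" "v = W q" by (elim imageE)
      then show ?thesis using FW[of p q] \<sigma>W[of p] \<sigma>W[of q] by (simp only:)
    qed
    show "same_orbit \<Gamma> (W p) (W (F p))"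
      using PDR_automorphism(1)[OF pdr fin bij arc WV[OF p]] by (simp only: \<sigma>W[OF p])
    show "F q = q" if fixp: "W (F p) = W p" and q: "q \<in> ?D"
    proof -
      have "?\<sigma> (W p) = W p" by (rule trans[OF \<sigma>W[OF p] fixp])
      then have "?\<sigma> (W q) = W q"
        using PDR_automorphism(2)[OF pdr fin bij arc WV[OF p] WV[OF q]] by blast
      then have "W (F q) = W q" using \<sigma>W[OF q] by metis
      then show ?thesis by (rule inj_onD[OF Winj _ bij_betw_apply[OF F q] q])
    qed
  qed
  \<comment> \<open>The shift by \<open>\<alpha> \<one>\<close> on one layer only absorbs the
    constant term of \<open>\<alpha>\<close> exactly once in a quotient between different layers.
    The flag \<open>e\<close> tells whether layers are kept or exchanged.\<close>
  have affine: "bij_betw (\<lambda>(x, b). (if b then \<alpha> x else \<alpha> x \<otimes> \<alpha> \<one>, b = e)) ?D ?D"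
    and quot: "\<And>x y b b'. x \<in> carrier G \<Longrightarrow> y \<in> carrier G \<Longrightarrow> b \<noteq> b' \<Longrightarrow>
      (if b then \<alpha> x else \<alpha> x \<otimes> \<alpha> \<one>) \<otimes> (if b' then \<alpha> y else \<alpha> y \<otimes> \<alpha> \<one>) = \<alpha> (x \<otimes> y)"
    if \<alpha>: "bij_betw \<alpha> (carrier G) (carrier G)"
      and aff: "\<And>x y. x \<in> carrier G \<Longrightarrow> y \<in> carrier G \<Longrightarrow> \<alpha> (x \<otimes> y) = \<alpha> x \<otimes> \<alpha> y \<otimes> \<alpha> \<one>" for \<alpha> e
  proof -
    have c: "\<alpha> x \<in> carrier G" if "x \<in> carrier G" for x using bij_betw_apply[OF \<alpha> that] .
    have inj: "\<alpha> x = \<alpha> y \<longleftrightarrow> x = y" if "x \<in> carrier G" "y \<in> carrier G" for x y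
      using bij_betw_imp_inj_on[OF \<alpha>] that by (auto dest: inj_onD)
    let ?F = "\<lambda>(x, b). (if b then \<alpha> x else \<alpha> x \<otimes> \<alpha> \<one>, b = e)"
    have "inj_on ?F ?D"
    proof (rule inj_onI)
      fix p q assume pq: "p \<in> ?D" "q \<in> ?D" "?F p = ?F q"
      obtain x b y b' where [simp]: "p = (x, b)" "q = (y, b')" and xy: "x \<in> carrier G" "y \<in> carrier G"
        using pq by (cases p; cases q) auto
      have "b = b'" using pq(3) by auto
      moreover have "\<alpha> x = \<alpha> y" using pq(3) c xy \<open>b = b'\<close> by (cases b) simp_all
      ultimately show "p = q" using inj[OF xy] by simp
    qed
    moreover from this have "?F ` ?D = ?D"
    proof (rule endo_inj_surj[rotated 2])
      show "finite ?D" using fin by simp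
      show "?F ` ?D \<subseteq> ?D"
      proof (rule image_subsetI)
        fix p assume "p \<in> ?D"
        then show "?F p \<in> ?D" using c by (cases p; cases "snd p") simp_all
      qed
    qed
    ultimately show "bij_betw ?F ?D ?D" by (simp add: bij_betw_def)
    fix x y b b' assume "x \<in> carrier G" "y \<in> carrier G" "b \<noteq> (b' :: bool)"
    then show "(if b then \<alpha> x else \<alpha> x \<otimes> \<alpha> \<one>) \<otimes> (if b' then \<alpha> y else \<alpha> y \<otimes> \<alpha> \<one>) = \<alpha> (x \<otimes> y)"
      by (cases b; cases b') (simp_all add: aff c m_ac)
  qed
  have orbit_image: "same_orbit \<Gamma> (W (\<one>, True)) (W (\<alpha> \<one>, True = e))"
    and fixed: "e \<Longrightarrow> \<forall>x\<in>carrier G. \<alpha> x = x"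
    if ab: "affine_bij G \<alpha>"
      and col: "\<And>b x. x \<in> carrier G \<Longrightarrow> col (b = e) (\<alpha> x) \<longleftrightarrow> col b x" for \<alpha> e
  proof -
    have \<alpha>: "bij_betw \<alpha> (carrier G) (carrier G)"
      and aff: "\<And>x y. x \<in> carrier G \<Longrightarrow> y \<in> carrier G \<Longrightarrow> \<alpha> (x \<otimes> y) = \<alpha> x \<otimes> \<alpha> y \<otimes> \<alpha> \<one>"
      using ab by (auto simp: affine_bij_def)
    have c: "\<alpha> x \<in> carrier G" if "x \<in> carrier G" for x using bij_betw_apply[OF \<alpha> that] .
    let ?F = "\<lambda>(x, b). (if b then \<alpha> x else \<alpha> x \<otimes> \<alpha> \<one>, b = e)"
    have FW: "(W (?F p), W (?F q)) \<in> parcs \<Gamma> \<longleftrightarrow> (W p, W q) \<in> parcs \<Gamma>" if pq: "p \<in> ?D" "q \<in> ?D" for p q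
    proof -
      obtain x b y b' where [simp]: "p = (x, b)" "q = (y, b')" and xy: "x \<in> carrier G" "y \<in> carrier G"
        using pq by (cases p; cases q) auto
      have cl: "(if b then \<alpha> x else \<alpha> x \<otimes> \<alpha> \<one>) \<in> carrier G" "(if b' then \<alpha> y else \<alpha> y \<otimes> \<alpha> \<one>) \<in> carrier G"
        using c xy by auto
      have "((b = e) \<noteq> (b' = e)) = (b \<noteq> b')" by blast
      then show ?thesis
        using arcW[OF cl, of "b = e" "b' = e"] arcW[OF xy, of b b'] quot[OF \<alpha> aff xy, of b b']
          col[of "x \<otimes> y" b] xy by (cases "b = b'") simp_all
    qed
    have "same_orbit \<Gamma> (W (\<one>, True)) (W (?F (\<one>, True)))"
      by (rule lift(1)[OF affine[OF \<alpha> aff] FW]) auto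
    then show "same_orbit \<Gamma> (W (\<one>, True)) (W (\<alpha> \<one>, True = e))" by simp
    show "\<forall>x\<in>carrier G. \<alpha> x = x" if e
    proof
      fix x assume x: "x \<in> carrier G"
      \<comment> \<open>On the shifted layer the constant term occurs twice and cancels, so the lift
        has a fixed vertex and is trivial by semiregularity.\<close>
      have "?F (\<one>, False) = (\<one>, False)" using c sq that by simp
      then have "?F (x, True) = (x, True)"
        by (intro lift(2)[OF affine[OF \<alpha> aff] FW, of "(\<one>, False)" "(x, True)"]) (use x in auto)
      then show "\<alpha> x = x" by simp
    qed
  qed
  show thesis
  proof (rule that[of "\<lambda>x. (col False x, col True x)"])
    fix \<alpha> assume \<alpha>: "affine_bij G \<alpha>"
      and pres: "\<forall>x\<in>carrier G. (col False (\<alpha> x), col True (\<alpha> x)) = (col False x, col True x)"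
    show "\<forall>x\<in>carrier G. \<alpha> x = x"
    proof (rule fixed[OF \<alpha>, of True])
      show "col (b = True) (\<alpha> x) \<longleftrightarrow> col b x" if "x \<in> carrier G" for b x
        using pres that by (cases b) auto
    qed simp
  next
    fix \<alpha> assume \<alpha>: "affine_bij G \<alpha>"
      and swap: "\<forall>x\<in>carrier G. (col False (\<alpha> x), col True (\<alpha> x)) = prod.swap (col False x, col True x)"
    have "same_orbit \<Gamma> (W (\<one>, True)) (W (\<alpha> \<one>, True = False))"
    proof (rule orbit_image[OF \<alpha>])
      show "col (b = False) (\<alpha> x) \<longleftrightarrow> col b x" if "x \<in> carrier G" for b x
        using swap that by (cases b) auto
    qed
    moreover have "\<alpha> \<one> \<in> carrier G" using \<alpha> by (auto simp: affine_bij_def bij_betw_def)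
    ultimately show False using sameW[OF one_closed, of "\<alpha> \<one>" True "True = False"] by simp
  qed
qed

text \<open>Carries the list computations over to the group: \<open>f\<close> numbers the elements
  so that the group operation becomes exclusive or.\<close>

lemma (in comm_group) two_PDR_not_affine_symmetric:
  assumes pdr: "is_PDR 2 G \<Gamma>" and sq: "\<And>x. x \<in> carrier G \<Longrightarrow> x \<otimes> x = \<one>"
    and f: "bij_betw f {..<m} (carrier G)" and f0: "f 0 = \<one>"
    and xor_table: "\<And>i j. i < m \<Longrightarrow> j < m \<Longrightarrow> xor_table i j < m \<and> f (xor_table i j) = f i \<otimes> f j"
    and sym: "\<And>c. affine_symmetric m c"
  shows False
proof -
  have fin: "finite (carrier G)" using bij_betw_finite[OF f] by simp
  have fC: "f i \<in> carrier G" if "i < m" for i using bij_betw_apply[OF f] that by simp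
  have m: "0 < m" using bij_betw_imp_surj_on[OF f] one_closed by (cases m) auto
  obtain c :: "'a \<Rightarrow> bool \<times> bool" where
    pres: "\<And>\<alpha>. affine_bij G \<alpha> \<Longrightarrow> \<forall>x\<in>carrier G. c (\<alpha> x) = c x \<Longrightarrow> \<forall>x\<in>carrier G. \<alpha> x = x"
    and swap: "\<And>\<alpha>. affine_bij G \<alpha> \<Longrightarrow> \<forall>x\<in>carrier G. c (\<alpha> x) = prod.swap (c x) \<Longrightarrow> False"
    using two_PDR_colouring[OF pdr fin sq] by blast
  obtain p where aff: "affine_list m p" and
    p: "p \<noteq> [0..<m] \<and> (\<forall>i<m. c (f (p ! i)) = c (f i)) \<or> (\<forall>i<m. c (f (p ! i)) = prod.swap (c (f i)))"
    using sym[of "\<lambda>i. c (f i)"] unfolding affine_symmetric_def by blast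
  have len: "length p = m" and dist: "distinct p" and
    plt: "\<And>i. i < m \<Longrightarrow> p ! i < m" and
    paff: "\<And>i j. i < m \<Longrightarrow> j < m \<Longrightarrow> p ! xor_table i j = xor_table (xor_table (p ! i) (p ! j)) (p ! 0)"
    using aff by (auto simp: affine_list_def list_all_iff)
  let ?g = "inv_into {..<m} f"
  define \<alpha> where "\<alpha> x = f (p ! ?g x)" for x
  have gf: "?g (f i) = i" if "i < m" for i
    using inv_into_f_f[OF bij_betw_imp_inj_on[OF f]] that by simp
  have \<alpha>f: "\<alpha> (f i) = f (p ! i)" if "i < m" for i using gf that by (simp add: \<alpha>_def)
  have ex: "\<exists>i<m. x = f i" if "x \<in> carrier G" for x
    using bij_betw_imp_surj_on[OF f] that by force
  have "inj_on (nth p) {..<m}" using inj_on_nth[OF dist] len by simp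
  moreover from this have "nth p ` {..<m} = {..<m}"
    by (intro endo_inj_surj) (use plt in auto)
  ultimately have "bij_betw (nth p) {..<m} {..<m}" by (simp add: bij_betw_def)
  then have "bij_betw (f \<circ> (nth p \<circ> ?g)) (carrier G) (carrier G)"
    by (intro bij_betw_trans[OF bij_betw_trans[OF bij_betw_inv_into[OF f]] f])
  moreover have "f \<circ> (nth p \<circ> ?g) = \<alpha>" by (simp add: \<alpha>_def fun_eq_iff)
  ultimately have bij: "bij_betw \<alpha> (carrier G) (carrier G)" by simp
  have affine: "\<alpha> (x \<otimes> y) = \<alpha> x \<otimes> \<alpha> y \<otimes> \<alpha> \<one>" if xy: "x \<in> carrier G" "y \<in> carrier G" for x y
  proof -
    obtain i j where ij: "i < m" "j < m" "x = f i" "y = f j" using ex xy by blast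
    have "\<alpha> (x \<otimes> y) = f (xor_table (xor_table (p ! i) (p ! j)) (p ! 0))"
      using xor_table[OF ij(1,2)] \<alpha>f[of "xor_table i j"] paff[OF ij(1,2)] ij by simp
    also have "\<dots> = f (p ! i) \<otimes> f (p ! j) \<otimes> f (p ! 0)"
      using xor_table plt ij m by simp
    finally show ?thesis using \<alpha>f ij \<alpha>f[OF m] f0 by simp
  qed
  have ab: "affine_bij G \<alpha>" using bij affine by (simp add: affine_bij_def)
  from p show False
  proof (elim disjE conjE)
    assume ne: "p \<noteq> [0..<m]" and pr: "\<forall>i<m. c (f (p ! i)) = c (f i)"
    have "c (\<alpha> x) = c x" if "x \<in> carrier G" for x using ex[OF that] \<alpha>f pr by auto
    then have "\<forall>x\<in>carrier G. \<alpha> x = x" by (intro pres ab) blast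
    then have fixed: "f (p ! i) = f i" if "i < m" for i using fC[OF that] \<alpha>f[OF that] by simp
    then have "p ! i = i" if "i < m" for i
      using inj_onD[OF bij_betw_imp_inj_on[OF f] fixed[OF that]] plt that by simp
    then have "p = [0..<m]" using len by (intro nth_equalityI) auto
    then show False using ne by simp
  next
    assume pr: "\<forall>i<m. c (f (p ! i)) = prod.swap (c (f i))"
    have "c (\<alpha> x) = prod.swap (c x)" if "x \<in> carrier G" for x using ex[OF that] \<alpha>f pr by auto
    then show False by (intro swap[OF ab]) blast
  qed
qed

section \<open>Excluding the elementary abelian groups of order four and eight\<close>

lemma carrier_integer_mod_2: "carrier (integer_mod_group 2) = {0, 1}"
  by (auto simp: carrier_integer_mod_group)

lemma comm_group_DirProd:
  assumes "comm_group G" "comm_group H"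
  shows "comm_group (G \<times>\<times> H)"
proof -
  interpret G: comm_group G by fact
  interpret H: comm_group H by fact
  show ?thesis
    by (rule group.group_comm_groupI[OF DirProd_group[OF G.is_group H.is_group]])
      (auto simp: G.m_comm H.m_comm)
qed

text \<open>Entry \<open>i\<close> holds the binary digits of \<open>i\<close>, lowest first, to
  match \<open>xor_table\<close>; likewise for \<open>triples_2\<close>.\<close>

definition pairs_2 :: "(int \<times> int) list" where
  "pairs_2 = [(0, 0), (1, 0), (0, 1), (1, 1)]"

definition triples_2 :: "(int \<times> int \<times> int) list" where
  "triples_2 = [(0, 0, 0), (1, 0, 0), (0, 1, 0), (1, 1, 0), (0, 0, 1), (1, 0, 1), (0, 1, 1), (1, 1, 1)]"

lemma xor_table_pairs_2:
  "list_all (\<lambda>i. list_all (\<lambda>j. xor_table i j < 4 \<and> pairs_2 ! xor_table i j =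
     (case pairs_2 ! i of (a, b) \<Rightarrow> case pairs_2 ! j of (a', b') \<Rightarrow> ((a + a') mod 2, (b + b') mod 2)))
     [0..<4]) [0..<4]"
  by code_simp

lemma xor_table_triples_2:
  "list_all (\<lambda>i. list_all (\<lambda>j. xor_table i j < 8 \<and> triples_2 ! xor_table i j =
     (case triples_2 ! i of (a, b, c) \<Rightarrow> case triples_2 ! j of (a', b', c') \<Rightarrow>
       ((a + a') mod 2, (b + b') mod 2, (c + c') mod 2))) [0..<8]) [0..<8]"
  by code_simp

lemma bij_betw_nthI:
  assumes "distinct xs" "set xs = A" "length xs = m"
  shows "bij_betw (nth xs) {..<m} A"
  using bij_betw_nth[OF assms(1), of "{..<m}" A] assms by auto

lemma Klein_four_no_two_PDR: "\<not> is_PDR 2 (integer_mod_group 2 \<times>\<times> integer_mod_group 2) \<Gamma>"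
proof
  let ?G = "integer_mod_group 2 \<times>\<times> integer_mod_group 2"
  let ?f = "nth pairs_2"
  assume pdr: "is_PDR 2 ?G \<Gamma>"
  interpret comm_group ?G by (intro comm_group_DirProd abelian_integer_mod_group)
  have C: "carrier ?G = {0, 1} \<times> {0, 1}" by (simp add: carrier_integer_mod_2)
  show False
  proof (rule two_PDR_not_affine_symmetric[OF pdr, where f = ?f and m = 4])
    show "x \<otimes>\<^bsub>?G\<^esub> x = \<one>\<^bsub>?G\<^esub>" for x
      by (cases x) (auto simp: DirProd_def simp flip: mult_2)
    show "bij_betw ?f {..<4} (carrier ?G)"
      unfolding C by (rule bij_betw_nthI) (auto simp: pairs_2_def)
    show "?f 0 = \<one>\<^bsub>?G\<^esub>" by (simp add: pairs_2_def)
    show "xor_table i j < 4 \<and> ?f (xor_table i j) = ?f i \<otimes>\<^bsub>?G\<^esub> ?f j" if "i < 4" "j < 4" for i j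
      using xor_table_pairs_2[unfolded list_all_iff, rule_format, of i j] that
      by (cases "pairs_2 ! i"; cases "pairs_2 ! j") (simp add: DirProd_def)
  qed (rule affine_symmetric_4)
qed

lemma elementary_eight_no_two_PDR:
  "\<not> is_PDR 2 (integer_mod_group 2 \<times>\<times> integer_mod_group 2 \<times>\<times> integer_mod_group 2) \<Gamma>"
proof
  let ?G = "integer_mod_group 2 \<times>\<times> integer_mod_group 2 \<times>\<times> integer_mod_group 2"
  let ?f = "nth triples_2"
  assume pdr: "is_PDR 2 ?G \<Gamma>"
  interpret comm_group ?G by (intro comm_group_DirProd abelian_integer_mod_group)
  have C: "carrier ?G = {0, 1} \<times> {0, 1} \<times> {0, 1}" by (simp add: carrier_integer_mod_2)
  show False
  proof (rule two_PDR_not_affine_symmetric[OF pdr, where f = ?f and m = 8])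
    show "x \<otimes>\<^bsub>?G\<^esub> x = \<one>\<^bsub>?G\<^esub>" for x
      by (cases x) (auto simp: DirProd_def simp flip: mult_2)
    show "bij_betw ?f {..<8} (carrier ?G)"
      unfolding C by (rule bij_betw_nthI) (auto simp: triples_2_def)
    show "?f 0 = \<one>\<^bsub>?G\<^esub>" by (simp add: triples_2_def)
    show "xor_table i j < 8 \<and> ?f (xor_table i j) = ?f i \<otimes>\<^bsub>?G\<^esub> ?f j" if "i < 8" "j < 8" for i j
      using xor_table_triples_2[unfolded list_all_iff, rule_format, of i j] that
      by (cases "triples_2 ! i"; cases "triples_2 ! j") (simp add: DirProd_def)
  qed (rule affine_symmetric_8)
qed

section \<open>Excluding the trivial group with five orbits\<close>

text \<open>The 15 products of two disjoint transpositions, followed by the six 5-cycles sending 0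
  to 1. The latter contain one generator of each subgroup of order 5, which is enough, since a power
  of an automorphism is an automorphism.\<close>

definition five_perms :: "nat list list" where
  "five_perms =
    [
    [0, 2, 1, 4, 3], [0, 3, 4, 1, 2], [0, 4, 3, 2, 1], [1, 0, 2, 4, 3], [1, 0, 3, 2, 4],
    [1, 0, 4, 3, 2], [2, 1, 0, 4, 3], [2, 3, 0, 1, 4], [2, 4, 0, 3, 1], [3, 1, 4, 0, 2],
    [3, 2, 1, 0, 4], [3, 4, 2, 0, 1], [4, 1, 3, 2, 0], [4, 2, 1, 3, 0], [4, 3, 2, 1, 0],
    [1, 2, 3, 4, 0], [1, 2, 4, 0, 3], [1, 3, 0, 4, 2], [1, 3, 4, 2, 0], [1, 4, 0, 2, 3],
    [1, 4, 3, 0, 2]]"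

definition two_subsets :: "nat \<Rightarrow> nat list list" where
  "two_subsets i = filter (\<lambda>r. i \<notin> set r)
     [[0, 1], [0, 2], [0, 3], [0, 4], [1, 2], [1, 3], [1, 4], [2, 3], [2, 4], [3, 4]]"

text \<open>Entry \<open>i\<close> of the searched list is the out-neighbourhood of
  \<open>i\<close>. Branches are cut when an in-valency exceeds 2; with ten arcs in all, every
  in-valency equals 2 at the leaves.\<close>

lemma search_5:
  "prefix_search (\<lambda>c. two_subsets (length c)) (\<lambda>c. list_all (\<lambda>j. length (filter (\<lambda>r. j \<in> set r) c) \<le> 2) [0..<5])
     (\<lambda>c. list_ex (\<lambda>p. list_all (\<lambda>i. list_all (\<lambda>j. (p ! j \<in> set (c ! (p ! i))) = (j \<in> set (c ! i))) [0..<5]) [0..<5])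
       five_perms) 5 []"
  by code_simp

lemma five_perms_perms:
  "list_all (\<lambda>p. length p = 5 \<and> distinct p \<and> list_all (\<lambda>x. x < 5) p \<and> p \<noteq> [0..<5]) five_perms"
  by code_simp

text \<open>The bounds on the valency leave 2 as its only value, and every such digraph on five
  vertices has a nontrivial automorphism by \<open>search_5\<close>.\<close>

lemma (in group) trivial_no_five_PDR:
  assumes triv: "order G = 1" and fin: "finite (carrier G)"
  shows "\<not> is_PDR 5 G \<Gamma>"
proof
  assume pdr: "is_PDR 5 G \<Gamma>"
  let ?V = "pverts \<Gamma>"
  obtain d where d: "biregular ?V (\<lambda>u v. (u, v) \<in> parcs \<Gamma>) d" by (rule PDR_valency[OF pdr fin])
  have "1 < d" "d + 1 < 4" using PDR_valency_bounds[OF pdr fin _ _ d] triv by simp_all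
  then have "d = 2" by simp
  note d2 = d[unfolded this biregular_def, rule_format]
  have V: "finite ?V" "card ?V = 5" using PDR_finite[OF pdr fin] card_PDR_vertices[OF pdr fin] triv by simp_all
  then obtain f :: "nat \<Rightarrow> _" where f: "bij_betw f {..<5} ?V"
    using ex_bij_betw_nat_finite[of ?V] by (auto simp: atLeast0LessThan)
  have fV: "f i \<in> ?V" if "i < 5" for i using bij_betw_apply[OF f] that by simp
  define E where "E i j \<longleftrightarrow> (f i, f j) \<in> parcs \<Gamma>" for i j
  have tr: "card {j. j < 5 \<and> P (f j)} = card {v \<in> ?V. P v}" for P
  proof -
    have "{v \<in> ?V. P v} = f ` {j. j < 5 \<and> P (f j)}"
      using bij_betw_imp_surj_on[OF f] by auto
    moreover have "inj_on f {j. j < 5 \<and> P (f j)}"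
      by (rule inj_on_subset[OF bij_betw_imp_inj_on[OF f]]) auto
    ultimately show ?thesis by (simp add: card_image)
  qed
  have rows: "card {j. j < 5 \<and> E i j} = 2" and cols: "card {j. j < 5 \<and> E j i} = 2" if "i < 5" for i
    using d2[OF fV[OF that]] tr[of "\<lambda>v. (f i, v) \<in> parcs \<Gamma>"] tr[of "\<lambda>v. (v, f i) \<in> parcs \<Gamma>"]
    by (simp_all add: E_def)
  have irr: "\<not> E i i" if "i < 5" for i
    using PDR_no_arc[OF pdr fin fV[OF that] same_orbit_refl[OF fV[OF that]]] by (simp add: E_def)
  define row where "row i = filter (E i) [0..<5]" for i
  define w where "w = map row [0..<5]"
  have mem: "j \<in> set (row i) \<longleftrightarrow> j < 5 \<and> E i j" for i j by (auto simp: row_def)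
  have two: "row i \<in> set (two_subsets i)" if i: "i < 5" for i
  proof -
    have "set (row i) = {j. j < 5 \<and> E i j}" by (auto simp: row_def)
    then have "length (row i) = 2"
      using rows[OF i] distinct_card[of "row i"] by (simp add: row_def)
    then obtain a b where ab: "row i = [a, b]" by (auto simp: length_Suc_conv numeral_2_eq_2)
    \<comment> \<open>The order matters: the entries of \<open>two_subsets\<close> are increasing
      lists, and membership is equality of lists.\<close>
    have "sorted_wrt (<) (row i)" by (simp add: row_def sorted_wrt_filter)
    then have "a < b" "b < 5" "a \<noteq> i" "b \<noteq> i" using ab mem[of a i] mem[of b i] irr[OF i] by auto
    moreover from this have "a \<in> {0, 1, 2, 3}" "b \<in> {1, 2, 3, 4}" by auto
    ultimately show ?thesis unfolding ab two_subsets_def by auto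
  qed
  have "list_all (\<lambda>j. length (filter (\<lambda>r. j \<in> set r) (take k w)) \<le> 2) [0..<5]" for k
    unfolding list_all_iff
  proof
    fix j assume j: "j \<in> set [0..<5]"
    have "filter (\<lambda>r. j \<in> set r) w = map row (filter (\<lambda>i. E i j) [0..<5])"
      using j by (simp add: w_def filter_map comp_def mem)
    moreover have "length (filter (\<lambda>i. E i j) [0..<5]) = card {i. i < 5 \<and> E i j}"
      by (subst distinct_card[symmetric]) (auto intro: arg_cong[where f = card])
    ultimately have "length (filter (\<lambda>r. j \<in> set r) w) = 2" using cols j by simp
    moreover have "filter (\<lambda>r. j \<in> set r) w =
        filter (\<lambda>r. j \<in> set r) (take k w) @ filter (\<lambda>r. j \<in> set r) (drop k w)"
      by (simp flip: filter_append)
    ultimately show "length (filter (\<lambda>r. j \<in> set r) (take k w)) \<le> 2" by simp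
  qed
  moreover have "w ! i \<in> set (two_subsets (length (take i w)))" if "i < 5" for i
    using two that by (simp add: w_def)
  ultimately obtain p where p: "p \<in> set five_perms"
    "\<forall>i<5. \<forall>j<5. (p ! j \<in> set (w ! (p ! i))) = (j \<in> set (w ! i))"
    using prefix_search_sound[OF search_5, of w] by (auto simp: w_def list_ex_iff list_all_iff)
  have pp: "length p = 5" "distinct p" "p \<noteq> [0..<5]" "\<And>i. i < 5 \<Longrightarrow> p ! i < 5"
    using five_perms_perms p(1) by (auto simp: list_all_iff)
  have E: "E (p ! i) (p ! j) \<longleftrightarrow> E i j" if "i < 5" "j < 5" for i j
    using p(2) that pp(4) by (simp add: w_def mem)
  have "inj_on (nth p) {..<5}" using inj_on_nth[OF pp(2)] pp(1) by simp
  moreover from this have "nth p ` {..<5} = {..<5}"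
    by (intro endo_inj_surj) (use pp(4) in auto)
  ultimately have pb: "bij_betw (nth p) {..<5} {..<5}" by (simp add: bij_betw_def)
  let ?\<sigma> = "f \<circ> (nth p \<circ> inv_into {..<5} f)"
  have bij: "bij_betw ?\<sigma> ?V ?V"
    by (rule bij_betw_trans[OF bij_betw_trans[OF bij_betw_inv_into[OF f] pb] f])
  have \<sigma>f: "?\<sigma> (f i) = f (p ! i)" if "i < 5" for i
    using inv_into_f_f[OF bij_betw_imp_inj_on[OF f], of i] that by simp
  have arc: "(?\<sigma> u, ?\<sigma> v) \<in> parcs \<Gamma> \<longleftrightarrow> (u, v) \<in> parcs \<Gamma>" if uv: "u \<in> ?V" "v \<in> ?V" for u v
  proof -
    have "u \<in> f ` {..<5}" "v \<in> f ` {..<5}" using uv bij_betw_imp_surj_on[OF f] by simp_all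
    then obtain i j where "i < 5" "j < 5" "u = f i" "v = f j" by auto
    then show ?thesis using E \<sigma>f unfolding E_def by metis
  qed
  have "p ! i = i" if i: "i < 5" for i
  proof -
    have "same_orbit \<Gamma> (f i) (f (p ! i))"
      using PDR_automorphism(1)[OF pdr fin bij arc fV[OF i]] by (simp only: \<sigma>f[OF i])
    then have "f i = f (p ! i)" using trivial_same_orbit[OF pdr fin triv fV[OF i] fV[OF pp(4)[OF i]]] by simp
    then show ?thesis using inj_onD[OF bij_betw_imp_inj_on[OF f], of i "p ! i"] i pp(4)[OF i] by simp
  qed
  then have "p = [0..<5]" using pp(1) by (intro nth_equalityI) auto
  then show False using pp(3) by simp
qed

section \<open>Assembling the exceptional cases and the equivalence\<close>

lemma no_PDR:
  fixes G :: "('g, 'm) monoid_scheme"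
  assumes "group G" and fin: "finite (carrier G)"
    and ex: "(n = 1 \<and> order G \<ge> 3) \<or>
    (n = 2 \<and>
      (G \<cong> integer_mod_group 1 \<or>
       G \<cong> integer_mod_group 2 \<or>
       G \<cong> integer_mod_group 3 \<or>
       G \<cong> integer_mod_group 2 \<times>\<times> integer_mod_group 2 \<or>
       G \<cong> integer_mod_group 2 \<times>\<times> integer_mod_group 2 \<times>\<times> integer_mod_group 2)) \<or>
    (3 \<le> n \<and> n \<le> 5 \<and> G \<cong> integer_mod_group 1)"
  shows "\<not> is_PDR n G \<Gamma>"
proof
  interpret group G by fact
  assume pdr: "is_PDR n G \<Gamma>"
  have order: "order G = m" if "G \<cong> integer_mod_group m" "m > 0" for m
    using that by (auto simp: is_iso_def iso_def order_def carrier_integer_mod_group dest!: bij_betw_same_card)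
  \<comment> \<open>No \<open>d\<close> satisfies \<open>1 < d\<close> and
    \<open>d + 1 < order G * (n - 1)\<close> when the right-hand side is at most 3. This settles the
    cyclic groups with two orbits and the trivial group with three or four.\<close>
  have small: False if n: "n \<ge> 2" and s: "n = 2 \<or> order G = 1" and c: "order G * (n - 1) \<le> 3"
  proof -
    obtain d where "biregular (pverts \<Gamma>) (\<lambda>u v. (u, v) \<in> parcs \<Gamma>) d"
      by (rule PDR_valency[OF pdr fin])
    from PDR_valency_bounds[OF pdr fin n s this] c show False by linarith
  qed
  from ex show False
  proof (elim disjE conjE)
    assume "n = 1" "order G \<ge> 3"
    then show False using one_PDR_order[OF pdr fin] by simp
  next
    assume "n = 2" "G \<cong> integer_mod_group 1"
    then show False using small order[of 1] by simp
  next
    assume "n = 2" "G \<cong> integer_mod_group 2"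
    then show False using small order[of 2] by simp
  next
    assume "n = 2" "G \<cong> integer_mod_group 3"
    then show False using small order[of 3] by simp
  next
    assume "n = 2" "G \<cong> integer_mod_group 2 \<times>\<times> integer_mod_group 2"
    then show False using is_PDR_iso[OF pdr] Klein_four_no_two_PDR by blast
  next
    assume "n = 2" "G \<cong> integer_mod_group 2 \<times>\<times> integer_mod_group 2 \<times>\<times> integer_mod_group 2"
    then show False using is_PDR_iso[OF pdr] elementary_eight_no_two_PDR by blast
  next
    assume n: "3 \<le> n" "n \<le> 5" and "G \<cong> integer_mod_group 1"
    then have triv: "order G = 1" using order by simp
    show False
    proof (cases "n = 5")
      case True
      then show False using trivial_no_five_PDR[OF triv fin] pdr by blast
    next
      case False
      then have "order G * (n - 1) \<le> 3" using n triv by simp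
      then show False using small n triv by simp
    qed
  qed
qed

theorem theorem1p1:
  fixes G :: "('g, 'm) monoid_scheme" and n :: nat
  assumes "group G" and "finite (carrier G)" and "n \<ge> 1"
  shows "\<not> admits_PDR n G \<longleftrightarrow>
    (n = 1 \<and> order G \<ge> 3) \<or>
    (n = 2 \<and>
      (G \<cong> integer_mod_group 1 \<or>
       G \<cong> integer_mod_group 2 \<or>
       G \<cong> integer_mod_group 3 \<or>
       G \<cong> integer_mod_group 2 \<times>\<times> integer_mod_group 2 \<or>
       G \<cong> integer_mod_group 2 \<times>\<times> integer_mod_group 2 \<times>\<times> integer_mod_group 2)) \<or>
    (3 \<le> n \<and> n \<le> 5 \<and> G \<cong> integer_mod_group 1)"
    (is "_ \<longleftrightarrow> ?exceptions")
proof
  interpret group G by fact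
  assume no: "\<not> admits_PDR n G"
  show ?exceptions
  proof (rule ccontr)
    assume ex: "\<not> ?exceptions"
    consider "n = 1" | "n = 2" | "n \<ge> 3" using assms(3) by linarith
    then have "admits_PDR n G"
    proof cases
      case 1
      then have "order G \<le> 2" using ex by simp
      from is_PDR_imp_admits_PDR[OF edgeless_PDR[OF assms(2) this] assms(2)]
      show ?thesis using 1 by simp
    next
      case 2
      then show ?thesis using two_PDR[OF assms(2)] ex by blast
    next
      case 3
      show ?thesis
      proof (cases "order G = 1")
        case False
        then show ?thesis using nontrivial_PDR[OF assms(2) _ 3] by blast
      next
        case True
        then obtain a where "carrier G = {a}" by (auto simp: order_def card_1_singleton_iff)
        then have triv: "carrier G = {\<one>\<^bsub>G\<^esub>}" using one_closed by auto
        then have "generate G {\<one>\<^bsub>G\<^esub>} = carrier G" using generate_one by simp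
        from iso_integer_mod_group[OF assms(2) one_closed this] True
        have "G \<cong> integer_mod_group 1" by simp
        then have "n \<ge> 6" using ex 3 by auto
        from is_PDR_imp_admits_PDR[OF trivial_PDR[OF triv this] assms(2)] show ?thesis .
      qed
    qed
    then show False using no by blast
  qed
next
  assume ?exceptions
  then show "\<not> admits_PDR n G"
    unfolding admits_PDR_def using no_PDR[OF assms(1,2)] by blast
qed

end
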